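(* Let $\mathcal{C}$ be a skeletally small preadditive category and let $\mathcal{F}=\{\mathcal{F}_C\}_{C\in\mathcal{C}}$ be a left Gabriel filter for $\mathcal{C}$. Then there exists an equivalence of categories $$\mathrm{Mod}(\mathcal{C},\mathcal{F})\simeq \mathrm{Mod}(\mathcal{C})/\mathcal{T}_{\mathcal{F}},$$ where $\mathrm{Mod}(\mathcal{C},\mathcal{F})$ is the full subcategory of $\mathcal{F}$-closed modules and the right-hand side is the Serre quotient by the class $\mathcal{T}_{\mathcal{F}}$ of $\mathcal{F}$-torsion modules.
   Context: $\mathrm{Mod}(\mathcal{C})$ is the category of additive covariant functors $\mathcal{C}\to\mathbf{Ab}$, with natural transformations as morphisms; its objects are called $\mathcal{C}$-modules. A left ideal of $\mathrm{Hom}_{\mathcal{C}}(C,-)$ is an additive subfunctor $I=I(C,-)\subseteq \mathrm{Hom}_{\mathcal{C}}(C,-)$. For $h:C\to B$ in $\mathcal{C}$, $(I:h)$ is the left ideal of $\mathrm{Hom}_{\mathcal{C}}(B,-)$ given by $(I:h)(C')=\{f\in \mathrm{Hom}_{\mathcal{C}}(B,C')\mid f\circ h\in I(C,C')\}$. A left linear filter for $\mathcal{C}$ is a collection $\mathcal{F}=\{\mathcal{F}_C\}_{C\in\mathcal{C}}$, where each $\mathcal{F}_C$ is a nonempty family of left ideals of $\mathrm{Hom}_{\mathcal{C}}(C,-)$, such that: (T1) if $I\in\mathcal{F}_C$ and $I\subseteq J$ then $J\in\mathcal{F}_C$; (T2) if $I,J\in\mathcal{F}_C$ then $I\cap J\in\mathcal{F}_C$;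 (T3) if $I\in\mathcal{F}_C$ and $h:C\to B$ then $(I:h)\in\mathcal{F}_B$. A left Gabriel filter is a left linear filter such that moreover: (T4) if $J\in\mathcal{F}_C$ and $I$ is a left ideal of $\mathrm{Hom}_{\mathcal{C}}(C,-)$ with $(I:h)\in\mathcal{F}_B$ for all $B\in\mathcal{C}$ and all $h\in J(C,B)$, then $I\in\mathcal{F}_C$. For $M\in\mathrm{Mod}(\mathcal{C})$ and $x\in M(C)$, $\mathrm{Ann}(x,-)\subseteq\mathrm{Hom}_{\mathcal{C}}(C,-)$ is the left ideal $\mathrm{Ann}(x,C')=\{f\in\mathrm{Hom}_{\mathcal{C}}(C,C')\mid M(f)(x)=0\}$. $\mathcal{T}_{\mathcal{F}}$ is the class of all $M$ such that $\mathrm{Ann}(x,-)\in\mathcal{F}_C$ for all $C\in\mathcal{C}$ and $x\in M(C)$; it is a hereditary torsion class, in particular a Serre subcategory. A $\mathcal{C}$-module $M$ is $\mathcal{F}$-closed if for all $C\in\mathcal{C}$ and $I\in\mathcal{F}_C$ the map $\mathrm{Hom}_{\mathrm{Mod}(\mathcal{C})}(\mathrm{Hom}_{\mathcal{C}}(C,-),M)\to\mathrm{Hom}_{\mathrm{Mod}(\mathcal{C})}(I,M)$ given by restriction along the inclusion $I\hookrightarrow\mathrm{Hom}_{\mathcal{C}}(C,-)$ is an isomorphism. *)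

theory Defs
  imports "HOL-Algebra.Coset" "HOL-Library.Equipollence"
begin

section \<open>Categories\<close>

text \<open>Hom-sets of different pairs of objects may overlap, hence composition carries its three
  objects: \<open>Comp C X Y Z g f\<close> is \<open>g \<circ> f\<close> for \<open>f : X \<rightarrow> Y\<close> and \<open>g : Y \<rightarrow> Z\<close>.\<close>

record ('o, 'a) cat =
  Obj :: "'o set"
  Hom :: "'o \<Rightarrow> 'o \<Rightarrow> 'a set"
  Comp :: "'o \<Rightarrow> 'o \<Rightarrow> 'o \<Rightarrow> 'a \<Rightarrow> 'a \<Rightarrow> 'a"
  Ide :: "'o \<Rightarrow> 'a"

locale category =
  fixes C :: "('o, 'a, 'z) cat_scheme"
  assumes ide_in_hom: "X \<in> Obj C \<Longrightarrow> Ide C X \<in> Hom C X X"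
    and comp_in_hom: "\<lbrakk>X \<in> Obj C; Y \<in> Obj C; Z \<in> Obj C; f \<in> Hom C X Y; g \<in> Hom C Y Z\<rbrakk>
      \<Longrightarrow> Comp C X Y Z g f \<in> Hom C X Z"
    and comp_ide_right: "\<lbrakk>X \<in> Obj C; Y \<in> Obj C; f \<in> Hom C X Y\<rbrakk>
      \<Longrightarrow> Comp C X X Y f (Ide C X) = f"
    and comp_ide_left: "\<lbrakk>X \<in> Obj C; Y \<in> Obj C; f \<in> Hom C X Y\<rbrakk>
      \<Longrightarrow> Comp C X Y Y (Ide C Y) f = f"
    and comp_assoc: "\<lbrakk>W \<in> Obj C; X \<in> Obj C; Y \<in> Obj C; Z \<in> Obj C;
        f \<in> Hom C W X; g \<in> Hom C X Y; h \<in> Hom C Y Z\<rbrakk>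
      \<Longrightarrow> Comp C W Y Z h (Comp C W X Y g f) = Comp C W X Z (Comp C X Y Z h g) f"

definition iso_arrow :: "('o, 'a, 'z) cat_scheme \<Rightarrow> 'o \<Rightarrow> 'o \<Rightarrow> 'a \<Rightarrow> bool" where
  "iso_arrow C X Y f \<longleftrightarrow> f \<in> Hom C X Y \<and>
     (\<exists>g\<in>Hom C Y X. Comp C X Y X g f = Ide C X \<and> Comp C Y X Y f g = Ide C Y)"

definition is_functor ::
  "('o, 'a, 'y) cat_scheme \<Rightarrow> ('p, 'b, 'z) cat_scheme \<Rightarrow> ('o \<Rightarrow> 'p) \<Rightarrow> ('o \<Rightarrow> 'o \<Rightarrow> 'a \<Rightarrow> 'b) \<Rightarrow> bool"
  where
  "is_functor A B Fo Fa \<longleftrightarrow>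
     (\<forall>X\<in>Obj A. Fo X \<in> Obj B) \<and>
     (\<forall>X\<in>Obj A. \<forall>Y\<in>Obj A. \<forall>f\<in>Hom A X Y. Fa X Y f \<in> Hom B (Fo X) (Fo Y)) \<and>
     (\<forall>X\<in>Obj A. Fa X X (Ide A X) = Ide B (Fo X)) \<and>
     (\<forall>X\<in>Obj A. \<forall>Y\<in>Obj A. \<forall>Z\<in>Obj A. \<forall>f\<in>Hom A X Y. \<forall>g\<in>Hom A Y Z.
        Fa X Z (Comp A X Y Z g f) = Comp B (Fo X) (Fo Y) (Fo Z) (Fa Y Z g) (Fa X Y f))"

definition natural_iso ::
  "('o, 'a, 'y) cat_scheme \<Rightarrow> ('p, 'b, 'z) cat_scheme \<Rightarrow>
   ('o \<Rightarrow> 'p) \<Rightarrow> ('o \<Rightarrow> 'o \<Rightarrow> 'a \<Rightarrow> 'b) \<Rightarrow> ('o \<Rightarrow> 'p) \<Rightarrow> ('o \<Rightarrow> 'o \<Rightarrow> 'a \<Rightarrow> 'b) \<Rightarrow> ('o \<Rightarrow> 'b) \<Rightarrow> bool"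
  where
  "natural_iso A B Fo Fa Go Ga \<tau> \<longleftrightarrow>
     (\<forall>X\<in>Obj A. iso_arrow B (Fo X) (Go X) (\<tau> X)) \<and>
     (\<forall>X\<in>Obj A. \<forall>Y\<in>Obj A. \<forall>f\<in>Hom A X Y.
        Comp B (Fo X) (Fo Y) (Go Y) (\<tau> Y) (Fa X Y f) =
        Comp B (Fo X) (Go X) (Go Y) (Ga X Y f) (\<tau> X))"

definition equivalent_categories ::
  "('o, 'a, 'y) cat_scheme \<Rightarrow> ('p, 'b, 'z) cat_scheme \<Rightarrow> bool" where
  "equivalent_categories A B \<longleftrightarrow> category A \<and> category B \<and>
     (\<exists>Fo Fa Go Ga. is_functor A B Fo Fa \<and> is_functor B A Go Ga \<and>
        (\<exists>\<eta>. natural_iso A A (\<lambda>X. X) (\<lambda>X Y f. f)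
               (\<lambda>X. Go (Fo X)) (\<lambda>X Y f. Ga (Fo X) (Fo Y) (Fa X Y f)) \<eta>) \<and>
        (\<exists>\<epsilon>. natural_iso B B (\<lambda>X. Fo (Go X)) (\<lambda>X Y f. Fa (Go X) (Go Y) (Ga X Y f))
               (\<lambda>X. X) (\<lambda>X Y f. f) \<epsilon>))"


section \<open>Size\<close>

text \<open>
  Every category over HOL types is small in the absolute sense, so size is expressed relative to
  two parameters. An index set \<open>J\<close> bounds the size of a skeleton: \<open>C\<close> is skeletally \<open>J\<close>-small if
  it has a set of representatives of the isomorphism classes of objects with at most \<open>|J|\<close> arrows
  between them. A family \<open>U\<close> of subsets of a type serves as the class of carriers of the
  objects of \<open>Ab\<close>; it has to be closed under taking sets of smaller or equal cardinality
  (thus under subsets and quotients) and under products indexed by \<open>J\<close>. The usual reading is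
  the instance where \<open>U\<close> consists of the sets of cardinality below an inaccessible cardinal
  and \<open>|J|\<close> is below it, too. The closure conditions do not need an inaccessible cardinal, though: the lemma
  \<open>universe_UNIV\<close> below exhibits arbitrarily large such \<open>U\<close> for each \<open>J\<close>.
\<close>

definition arrows :: "('o, 'a, 'z) cat_scheme \<Rightarrow> 'o set \<Rightarrow> ('o \<times> 'o \<times> 'a) set" where
  "arrows C S = {(X, Y, f). X \<in> S \<and> Y \<in> S \<and> f \<in> Hom C X Y}"

definition skeletally_small :: "'j set \<Rightarrow> ('o, 'a, 'z) cat_scheme \<Rightarrow> bool" where
  "skeletally_small J C \<longleftrightarrow>
     (\<exists>S\<subseteq>Obj C. (\<forall>X\<in>Obj C. \<exists>Y\<in>S. \<exists>f. iso_arrow C X Y f) \<and> arrows C S \<lesssim> J)"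

definition universe :: "'j set \<Rightarrow> 'u set set \<Rightarrow> bool" where
  "universe J U \<longleftrightarrow>
     (\<forall>X\<in>U. \<forall>Y. Y \<lesssim> X \<longrightarrow> Y \<in> U) \<and>
     (\<forall>X\<in>J \<rightarrow> U. \<exists>Y\<in>U. (\<Pi>\<^sub>E j\<in>J. X j) \<lesssim> Y)"

lemma universe_UNIV: "universe (J :: 'j set) (UNIV :: ('j \<times> nat \<Rightarrow> 'v) set set)"
proof -
  have "infinite (UNIV :: ('j \<times> nat) set)"
    by (simp add: finite_prod)
  then obtain b :: "('j \<times> nat) \<times> ('j \<times> nat) \<Rightarrow> 'j \<times> nat" where b: "bij b"
    using card_of_Times_same_infinite[of "UNIV :: ('j \<times> nat) set"]
    by (auto simp flip: card_of_ordIso)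
  define e :: "('j \<Rightarrow> 'j \<times> nat \<Rightarrow> 'v) \<Rightarrow> 'j \<times> nat \<Rightarrow> 'v"
    where "e h z = h (fst (fst (inv_into UNIV b z))) (snd (inv_into UNIV b z))" for h z
  have "inj e"
  proof (rule injI, rule ext, rule ext)
    fix h k :: "'j \<Rightarrow> 'j \<times> nat \<Rightarrow> 'v" and j i
    assume "e h = e k"
    then have "e h (b ((j, 0), i)) = e k (b ((j, 0), i))" by simp
    then show "h j i = k j i"
      using b by (simp add: e_def bij_is_inj)
  qed
  then have "(\<Pi>\<^sub>E j\<in>J. X j) \<lesssim> (UNIV :: ('j \<times> nat \<Rightarrow> 'v) set)"
    for X :: "'j \<Rightarrow> ('j \<times> nat \<Rightarrow> 'v) set"
    unfolding lepoll_def by (intro exI[of _ e]) (auto intro: inj_on_subset)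
  then show ?thesis
    unfolding universe_def by blast
qed


section \<open>Preadditive categories\<close>

text \<open>Abelian groups are the library's \<open>comm_group\<close>, hence written multiplicatively.\<close>

record ('o, 'm) preadd = "('o, 'm) cat" +
  Add :: "'o \<Rightarrow> 'o \<Rightarrow> 'm \<Rightarrow> 'm \<Rightarrow> 'm"
  Zero :: "'o \<Rightarrow> 'o \<Rightarrow> 'm"

definition hom_group :: "('o, 'm, 'z) preadd_scheme \<Rightarrow> 'o \<Rightarrow> 'o \<Rightarrow> 'm monoid" where
  "hom_group C X Y = \<lparr>carrier = Hom C X Y, monoid.mult = Add C X Y, one = Zero C X Y\<rparr>"

locale preadditive_category = category C
  for C :: "('o, 'm, 'z) preadd_scheme" +
  assumes comm_group_hom: "\<lbrakk>X \<in> Obj C; Y \<in> Obj C\<rbrakk> \<Longrightarrow> comm_group (hom_group C X Y)"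
    and comp_additive_right: "\<lbrakk>X \<in> Obj C; Y \<in> Obj C; Z \<in> Obj C; g \<in> Hom C Y Z\<rbrakk>
      \<Longrightarrow> (\<lambda>f. Comp C X Y Z g f) \<in> hom (hom_group C X Y) (hom_group C X Z)"
    and comp_additive_left: "\<lbrakk>X \<in> Obj C; Y \<in> Obj C; Z \<in> Obj C; f \<in> Hom C X Y\<rbrakk>
      \<Longrightarrow> (\<lambda>g. Comp C X Y Z g f) \<in> hom (hom_group C Y Z) (hom_group C X Z)"


section \<open>Modules over a preadditive category\<close>

text \<open>\<open>Grp M X\<close> is the abelian group \<open>M(X)\<close>, and \<open>Act M X Y f : M(X) \<rightarrow> M(Y)\<close> is \<open>M(f)\<close> for
  \<open>f : X \<rightarrow> Y\<close>. Values of these fields outside the objects, arrows and carriers are irrelevant;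
  natural transformations, in contrast, are extensional, so that equality of morphisms is the
  intended one.\<close>

record ('o, 'm, 'u) cmod =
  Grp :: "'o \<Rightarrow> 'u monoid"
  Act :: "'o \<Rightarrow> 'o \<Rightarrow> 'm \<Rightarrow> 'u \<Rightarrow> 'u"

definition is_module :: "('o, 'm, 'z) preadd_scheme \<Rightarrow> ('o, 'm, 'u) cmod \<Rightarrow> bool" where
  "is_module C M \<longleftrightarrow>
     (\<forall>X\<in>Obj C. comm_group (Grp M X)) \<and>
     (\<forall>X\<in>Obj C. \<forall>Y\<in>Obj C. \<forall>f\<in>Hom C X Y. Act M X Y f \<in> hom (Grp M X) (Grp M Y)) \<and>
     (\<forall>X\<in>Obj C. \<forall>x\<in>carrier (Grp M X). Act M X X (Ide C X) x = x) \<and>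
     (\<forall>X\<in>Obj C. \<forall>Y\<in>Obj C. \<forall>Z\<in>Obj C. \<forall>f\<in>Hom C X Y. \<forall>g\<in>Hom C Y Z. \<forall>x\<in>carrier (Grp M X).
        Act M X Z (Comp C X Y Z g f) x = Act M Y Z g (Act M X Y f x)) \<and>
     (\<forall>X\<in>Obj C. \<forall>Y\<in>Obj C. \<forall>f\<in>Hom C X Y. \<forall>g\<in>Hom C X Y. \<forall>x\<in>carrier (Grp M X).
        Act M X Y (Add C X Y f g) x = Act M X Y f x \<otimes>\<^bsub>Grp M Y\<^esub> Act M X Y g x)"

definition nat_hom ::
  "('o, 'm, 'z) preadd_scheme \<Rightarrow> ('o, 'm, 'u) cmod \<Rightarrow> ('o, 'm, 'v) cmod \<Rightarrow> ('o \<Rightarrow> 'u \<Rightarrow> 'v) set"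
  where
  "nat_hom C M N =
     {\<eta> \<in> (\<Pi>\<^sub>E X\<in>Obj C. hom (Grp M X) (Grp N X) \<inter> extensional (carrier (Grp M X))).
        \<forall>X\<in>Obj C. \<forall>Y\<in>Obj C. \<forall>f\<in>Hom C X Y. \<forall>x\<in>carrier (Grp M X).
          \<eta> Y (Act M X Y f x) = Act N X Y f (\<eta> X x)}"

definition nat_hom_group ::
  "('o, 'm, 'z) preadd_scheme \<Rightarrow> ('o, 'm, 'u) cmod \<Rightarrow> ('o, 'm, 'v) cmod \<Rightarrow> ('o \<Rightarrow> 'u \<Rightarrow> 'v) monoid"
  where
  "nat_hom_group C M N =
     \<lparr>carrier = nat_hom C M N,
      monoid.mult = (\<lambda>\<eta> \<theta>. \<lambda>X\<in>Obj C. \<lambda>x\<in>carrier (Grp M X). \<eta> X x \<otimes>\<^bsub>Grp N X\<^esub> \<theta> X x),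
      one = (\<lambda>X\<in>Obj C. \<lambda>x\<in>carrier (Grp M X). \<one>\<^bsub>Grp N X\<^esub>)\<rparr>"

definition Mod_cat ::
  "'u set set \<Rightarrow> ('o, 'm, 'z) preadd_scheme \<Rightarrow> (('o, 'm, 'u) cmod, 'o \<Rightarrow> 'u \<Rightarrow> 'u) cat" where
  "Mod_cat U C =
     \<lparr>Obj = {M. is_module C M \<and> (\<forall>X\<in>Obj C. carrier (Grp M X) \<in> U)},
      Hom = nat_hom C,
      Comp = (\<lambda>L M N g f. \<lambda>X\<in>Obj C. compose (carrier (Grp L X)) (g X) (f X)),
      Ide = (\<lambda>M. \<lambda>X\<in>Obj C. \<lambda>x\<in>carrier (Grp M X). x)\<rparr>"

text \<open>Subfunctors are set to be empty outside the objects, so that they are determined by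
  their values on objects.\<close>

definition submodule ::
  "('o, 'm, 'z) preadd_scheme \<Rightarrow> ('o, 'm, 'u) cmod \<Rightarrow> ('o \<Rightarrow> 'u set) \<Rightarrow> bool" where
  "submodule C M S \<longleftrightarrow>
     (\<forall>X\<in>Obj C. subgroup (S X) (Grp M X)) \<and>
     (\<forall>X\<in>Obj C. \<forall>Y\<in>Obj C. \<forall>f\<in>Hom C X Y. \<forall>x\<in>S X. Act M X Y f x \<in> S Y) \<and>
     (\<forall>X. X \<notin> Obj C \<longrightarrow> S X = {})"

definition sub_mod :: "('o, 'm, 'u) cmod \<Rightarrow> ('o \<Rightarrow> 'u set) \<Rightarrow> ('o, 'm, 'u) cmod" where
  "sub_mod M S = \<lparr>Grp = (\<lambda>X. (Grp M X)\<lparr>carrier := S X\<rparr>), Act = Act M\<rparr>"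

definition quot_mod :: "('o, 'm, 'u) cmod \<Rightarrow> ('o \<Rightarrow> 'u set) \<Rightarrow> ('o, 'm, 'u set) cmod" where
  "quot_mod M S =
     \<lparr>Grp = (\<lambda>X. Grp M X Mod S X),
      Act = (\<lambda>X Y f K. S Y <#>\<^bsub>Grp M Y\<^esub> (Act M X Y f ` K))\<rparr>"

definition representable :: "('o, 'm, 'z) preadd_scheme \<Rightarrow> 'o \<Rightarrow> ('o, 'm, 'm) cmod" where
  "representable C X = \<lparr>Grp = hom_group C X, Act = Comp C X\<rparr>"


section \<open>Gabriel filters\<close>

definition left_ideal :: "('o, 'm, 'z) preadd_scheme \<Rightarrow> 'o \<Rightarrow> ('o \<Rightarrow> 'm set) \<Rightarrow> bool" where
  "left_ideal C X I \<longleftrightarrow> submodule C (representable C X) I"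

text \<open>\<open>colon C I X Y h\<close> is the left ideal \<open>(I : h)\<close> of \<open>Hom(Y,-)\<close> for \<open>h : X \<rightarrow> Y\<close>.\<close>

definition colon ::
  "('o, 'm, 'z) preadd_scheme \<Rightarrow> ('o \<Rightarrow> 'm set) \<Rightarrow> 'o \<Rightarrow> 'o \<Rightarrow> 'm \<Rightarrow> 'o \<Rightarrow> 'm set" where
  "colon C I X Y h = (\<lambda>Z. if Z \<in> Obj C then {f \<in> Hom C Y Z. Comp C X Y Z f h \<in> I Z} else {})"

locale left_linear_filter =
  fixes C :: "('o, 'm, 'z) preadd_scheme" and F :: "'o \<Rightarrow> ('o \<Rightarrow> 'm set) set"
  assumes ideals: "\<lbrakk>X \<in> Obj C; I \<in> F X\<rbrakk> \<Longrightarrow> left_ideal C X I"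
    and nonempty: "X \<in> Obj C \<Longrightarrow> F X \<noteq> {}"
    and T1: "\<lbrakk>X \<in> Obj C; I \<in> F X; left_ideal C X J; \<And>Z. I Z \<subseteq> J Z\<rbrakk> \<Longrightarrow> J \<in> F X"
    and T2: "\<lbrakk>X \<in> Obj C; I \<in> F X; J \<in> F X\<rbrakk> \<Longrightarrow> (\<lambda>Z. I Z \<inter> J Z) \<in> F X"
    and T3: "\<lbrakk>X \<in> Obj C; Y \<in> Obj C; I \<in> F X; h \<in> Hom C X Y\<rbrakk> \<Longrightarrow> colon C I X Y h \<in> F Y"

locale left_Gabriel_filter = left_linear_filter C F
  for C :: "('o, 'm, 'z) preadd_scheme" and F :: "'o \<Rightarrow> ('o \<Rightarrow> 'm set) set" +
  assumes T4: "\<lbrakk>X \<in> Obj C; J \<in> F X; left_ideal C X I;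
      \<And>Y h. \<lbrakk>Y \<in> Obj C; h \<in> J Y\<rbrakk> \<Longrightarrow> colon C I X Y h \<in> F Y\<rbrakk> \<Longrightarrow> I \<in> F X"

definition annihilator ::
  "('o, 'm, 'z) preadd_scheme \<Rightarrow> ('o, 'm, 'u) cmod \<Rightarrow> 'o \<Rightarrow> 'u \<Rightarrow> 'o \<Rightarrow> 'm set" where
  "annihilator C M X x =
     (\<lambda>Y. if Y \<in> Obj C then {f \<in> Hom C X Y. Act M X Y f x = \<one>\<^bsub>Grp M Y\<^esub>} else {})"

definition torsion ::
  "('o, 'm, 'z) preadd_scheme \<Rightarrow> ('o \<Rightarrow> ('o \<Rightarrow> 'm set) set) \<Rightarrow> ('o, 'm, 'u) cmod \<Rightarrow> bool" where
  "torsion C F M \<longleftrightarrow>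
     is_module C M \<and> (\<forall>X\<in>Obj C. \<forall>x\<in>carrier (Grp M X). annihilator C M X x \<in> F X)"

definition closed_module ::
  "('o, 'm, 'z) preadd_scheme \<Rightarrow> ('o \<Rightarrow> ('o \<Rightarrow> 'm set) set) \<Rightarrow> ('o, 'm, 'u) cmod \<Rightarrow> bool" where
  "closed_module C F M \<longleftrightarrow>
     (\<forall>X\<in>Obj C. \<forall>I\<in>F X.
        (\<lambda>\<eta>. \<lambda>Y\<in>Obj C. restrict (\<eta> Y) (I Y))
          \<in> iso (nat_hom_group C (representable C X) M)
                (nat_hom_group C (sub_mod (representable C X) I) M))"

definition closed_Mod_cat ::
  "'u set set \<Rightarrow> ('o, 'm, 'z) preadd_scheme \<Rightarrow> ('o \<Rightarrow> ('o \<Rightarrow> 'm set) set)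
   \<Rightarrow> (('o, 'm, 'u) cmod, 'o \<Rightarrow> 'u \<Rightarrow> 'u) cat" where
  "closed_Mod_cat U C F =
     (Mod_cat U C)\<lparr>Obj := {M \<in> Obj (Mod_cat U C). closed_module C F M}\<rparr>"


section \<open>The Serre quotient by the torsion modules\<close>

text \<open>
  Gabriel's construction: the objects are those of \<open>Mod(C)\<close>, and the morphisms from \<open>M\<close> to \<open>N\<close>
  are the elements of the filtered colimit of the groups \<open>Hom(S, N/T)\<close> over the submodules
  \<open>S \<subseteq> M\<close> with \<open>M/S\<close> torsion and \<open>T \<subseteq> N\<close> with \<open>T\<close> torsion, where \<open>S\<close> decreases and \<open>T\<close>
  increases. The transition maps restrict to the smaller \<open>S\<close> and push forward to the quotient by
  the larger \<open>T\<close>; on cosets the latter is multiplication by the larger subgroup.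
\<close>

definition dense_sub ::
  "('o, 'm, 'z) preadd_scheme \<Rightarrow> ('o \<Rightarrow> ('o \<Rightarrow> 'm set) set) \<Rightarrow> ('o, 'm, 'u) cmod
   \<Rightarrow> ('o \<Rightarrow> 'u set) \<Rightarrow> bool" where
  "dense_sub C F M S \<longleftrightarrow> submodule C M S \<and> torsion C F (quot_mod M S)"

definition torsion_sub ::
  "('o, 'm, 'z) preadd_scheme \<Rightarrow> ('o \<Rightarrow> ('o \<Rightarrow> 'm set) set) \<Rightarrow> ('o, 'm, 'u) cmod
   \<Rightarrow> ('o \<Rightarrow> 'u set) \<Rightarrow> bool" where
  "torsion_sub C F N T \<longleftrightarrow> submodule C N T \<and> torsion C F (sub_mod N T)"

type_synonym ('o, 'u) partial_hom = "('o \<Rightarrow> 'u set) \<times> ('o \<Rightarrow> 'u set) \<times> ('o \<Rightarrow> 'u \<Rightarrow> 'u set)"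

definition partial_homs ::
  "('o, 'm, 'z) preadd_scheme \<Rightarrow> ('o \<Rightarrow> ('o \<Rightarrow> 'm set) set) \<Rightarrow> ('o, 'm, 'u) cmod
   \<Rightarrow> ('o, 'm, 'u) cmod \<Rightarrow> ('o, 'u) partial_hom set" where
  "partial_homs C F M N =
     {(S, T, f). dense_sub C F M S \<and> torsion_sub C F N T \<and>
        f \<in> nat_hom C (sub_mod M S) (quot_mod N T)}"

definition partial_hom_rel ::
  "('o, 'm, 'z) preadd_scheme \<Rightarrow> ('o \<Rightarrow> ('o \<Rightarrow> 'm set) set) \<Rightarrow> ('o, 'm, 'u) cmod
   \<Rightarrow> ('o, 'm, 'u) cmod \<Rightarrow> (('o, 'u) partial_hom \<times> ('o, 'u) partial_hom) set" where
  "partial_hom_rel C F M N =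
     {((S, T, f), (S', T', f')).
        (S, T, f) \<in> partial_homs C F M N \<and> (S', T', f') \<in> partial_homs C F M N \<and>
        (\<exists>S0 T0. dense_sub C F M S0 \<and> torsion_sub C F N T0 \<and>
           (\<forall>X. S0 X \<subseteq> S X \<inter> S' X) \<and> (\<forall>X. T X \<union> T' X \<subseteq> T0 X) \<and>
           (\<forall>X\<in>Obj C. \<forall>x\<in>S0 X.
              T0 X <#>\<^bsub>Grp N X\<^esub> f X x = T0 X <#>\<^bsub>Grp N X\<^esub> f' X x))}"

text \<open>
  Composition of \<open>f : S \<rightarrow> N/T\<close> with \<open>g : S' \<rightarrow> P/T'\<close>, where \<open>S' \<subseteq> N\<close> and \<open>T' \<subseteq> P\<close>: its domain
  is \<open>f\<^sup>-\<^sup>1((S'+T)/T)\<close>, its values lie in \<open>P/T''\<close> with \<open>T''/T' = g(S' \<inter> T)\<close>, and it is the composite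
  of the map induced by \<open>f\<close>, the isomorphism \<open>(S'+T)/T \<cong> S'/(S' \<inter> T)\<close> and the map
  \<open>S'/(S' \<inter> T) \<rightarrow> P/T''\<close> induced by \<open>g\<close>. As \<open>f x\<close> is a coset of \<open>T\<close>, it belongs to \<open>(S'+T)/T\<close> iff it
  meets \<open>S'\<close>, and the \<open>T''\<close>-coset assigned to \<open>x\<close> is then the union of the \<open>T'\<close>-cosets \<open>g n\<close>
  for \<open>n\<close> in that intersection.
\<close>

definition partial_comp ::
  "('o, 'm, 'z) preadd_scheme \<Rightarrow> ('o, 'u) partial_hom \<Rightarrow> ('o, 'u) partial_hom
   \<Rightarrow> ('o, 'u) partial_hom" where
  "partial_comp C = (\<lambda>(S', T', g) (S, T, f).
     let D = (\<lambda>X. {x \<in> S X. f X x \<inter> S' X \<noteq> {}}) in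
       (D,
        (\<lambda>X. \<Union>n\<in>T X \<inter> S' X. g X n),
        (\<lambda>X\<in>Obj C. \<lambda>x\<in>D X. \<Union>n\<in>f X x \<inter> S' X. g X n)))"

definition partial_ide ::
  "('o, 'm, 'z) preadd_scheme \<Rightarrow> ('o, 'm, 'u) cmod \<Rightarrow> ('o, 'u) partial_hom" where
  "partial_ide C M =
     ((\<lambda>X. if X \<in> Obj C then carrier (Grp M X) else {}),
      (\<lambda>X. if X \<in> Obj C then {\<one>\<^bsub>Grp M X\<^esub>} else {}),
      (\<lambda>X\<in>Obj C. \<lambda>x\<in>carrier (Grp M X). {\<one>\<^bsub>Grp M X\<^esub>} #>\<^bsub>Grp M X\<^esub> x))"

definition Serre_quotient ::
  "'u set set \<Rightarrow> ('o, 'm, 'z) preadd_scheme \<Rightarrow> ('o \<Rightarrow> ('o \<Rightarrow> 'm set) set)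
   \<Rightarrow> (('o, 'm, 'u) cmod, ('o, 'u) partial_hom set) cat" where
  "Serre_quotient U C F =
     \<lparr>Obj = Obj (Mod_cat U C),
      Hom = (\<lambda>M N. partial_homs C F M N // partial_hom_rel C F M N),
      Comp = (\<lambda>M N P \<psi> \<phi>. \<Union>b\<in>\<psi>. \<Union>a\<in>\<phi>. partial_hom_rel C F M P `` {partial_comp C b a}),
      Ide = (\<lambda>M. partial_hom_rel C F M M `` {partial_ide C M})\<rparr>"

end

theory Submission
  imports Defs "HOL-Algebra.Product_Groups"
begin

text \<open>
  Say that a property of the arrows out of \<open>X\<close> holds almost everywhere if it holds on an ideal in
  \<open>\<F>\<^sub>X\<close>. A module is closed iff elements that agree almost everywhere are equal and every
  homomorphism defined on an ideal of the filter is given by an element. Each module \<open>N\<close> has a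
  map into a closed module \<open>L\<close> with torsion kernel and dense image: the elements of \<open>L(X)\<close> are
  functions from the arrows out of \<open>X\<close> to \<open>N\<close> that are homomorphisms up to torsion almost everywhere,
  modulo equality up to torsion almost everywhere. Such a class is determined by the values of any
  representative on a skeleton, which bounds the size of \<open>L(X)\<close>.

  A homomorphism into a closed module extends uniquely from a dense submodule, and it may even be
  multivalued up to torsion. Hence an element of the colimit defining the morphisms \<open>M \<rightarrow> N\<close> of the Serre
  quotient is the same as a homomorphism between the localizations of \<open>M\<close> and \<open>N\<close>, compatibly with
  composition. If the localization of a closed module is chosen to be the module itself, the
  inclusion of the closed modules becomes a strict section of the localization functor.
\<close>

text \<open>The colimit of the groups Hom(I,N) over the ideals I of the filter gives a closed module
  only for suitable N; in general one first divides by the torsion, or repeats the construction.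
  Asking of a fraction only that it be a homomorphism up to torsion merges the two steps. That a
  single pass suffices rests on T4, which enters through \<open>almost_local\<close> alone: an ideal
  predicate that holds almost everywhere after almost every arrow holds almost everywhere. Locality
  of torsion, transitivity of density and the domain of a glued map all depend on it.

  The second obstacle is size and type. Fractions are functions on arrows, whereas the objects of
  both categories have carriers of elements of \<open>'u\<close> that belong to \<open>U\<close>.
  Classes of fractions therefore have to be coded by elements of \<open>'u\<close>; this is the
  place where skeletal smallness and the closure of \<open>U\<close> under products come in.

  That \<open>partial_hom_rel\<close> is an equivalence relation and that composition respects it is
  not shown directly. Both follow from the comparison with homomorphisms between
  localizations.\<close>

locale gabriel_modules = preadditive_category C + left_Gabriel_filter C F
  for C :: "('o, 'm, 'z) preadd_scheme" and F :: "'o \<Rightarrow> ('o \<Rightarrow> 'm set) set"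
begin

section \<open>Arithmetic in modules\<close>

lemma hom_group_simps [simp]:
  "carrier (hom_group C X Y) = Hom C X Y" "monoid.mult (hom_group C X Y) = Add C X Y"
  "one (hom_group C X Y) = Zero C X Y"
  by (simp_all add: hom_group_def)

lemma zero_in_hom [simp]: "\<lbrakk>X \<in> Obj C; Y \<in> Obj C\<rbrakk> \<Longrightarrow> Zero C X Y \<in> Hom C X Y"
  using comm_group_hom[of X Y, THEN comm_group.axioms(2), THEN group.is_monoid, THEN monoid.one_closed]
  by simp

lemma add_in_hom [simp]:
  "\<lbrakk>X \<in> Obj C; Y \<in> Obj C; f \<in> Hom C X Y; g \<in> Hom C X Y\<rbrakk> \<Longrightarrow> Add C X Y f g \<in> Hom C X Y"
  using comm_group_hom[of X Y, THEN comm_group.axioms(2), THEN group.is_monoid, THEN monoid.m_closed]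
  by simp

declare ide_in_hom [simp] comp_in_hom [simp] comp_ide_left [simp] comp_ide_right [simp]

lemma comp_add_left:
  "\<lbrakk>X \<in> Obj C; Y \<in> Obj C; Z \<in> Obj C; f \<in> Hom C X Y; g \<in> Hom C Y Z; h \<in> Hom C Y Z\<rbrakk>
   \<Longrightarrow> Comp C X Y Z (Add C Y Z g h) f = Add C X Z (Comp C X Y Z g f) (Comp C X Y Z h f)"
  using comp_additive_left[of X Y Z f] by (simp add: hom_def)

lemma comp_add_right:
  "\<lbrakk>X \<in> Obj C; Y \<in> Obj C; Z \<in> Obj C; f \<in> Hom C X Y; g \<in> Hom C X Y; h \<in> Hom C Y Z\<rbrakk>
   \<Longrightarrow> Comp C X Y Z h (Add C X Y f g) = Add C X Z (Comp C X Y Z h f) (Comp C X Y Z h g)"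
  using comp_additive_right[of X Y Z h] by (simp add: hom_def)

lemma comp_zero_left:
  assumes "X \<in> Obj C" "Y \<in> Obj C" "Z \<in> Obj C" "f \<in> Hom C X Y"
  shows "Comp C X Y Z (Zero C Y Z) f = Zero C X Z"
  using hom_one[OF comp_additive_left[of X Y Z f]] comm_group_hom assms
  by (simp add: comm_group_def)

lemma module_group: "\<lbrakk>is_module C M; X \<in> Obj C\<rbrakk> \<Longrightarrow> comm_group (Grp M X)"
  by (simp add: is_module_def)

lemma module_m_closed [simp]:
  "\<lbrakk>is_module C M; X \<in> Obj C; x \<in> carrier (Grp M X); y \<in> carrier (Grp M X)\<rbrakk>
   \<Longrightarrow> x \<otimes>\<^bsub>Grp M X\<^esub> y \<in> carrier (Grp M X)"
  using monoid.m_closed[OF group.is_monoid[OF comm_group.axioms(2)[OF module_group]]] .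

lemma module_one_closed [simp]:
  "\<lbrakk>is_module C M; X \<in> Obj C\<rbrakk> \<Longrightarrow> \<one>\<^bsub>Grp M X\<^esub> \<in> carrier (Grp M X)"
  using monoid.one_closed[OF group.is_monoid[OF comm_group.axioms(2)[OF module_group]]] .

lemma module_inv_closed [simp]:
  "\<lbrakk>is_module C M; X \<in> Obj C; x \<in> carrier (Grp M X)\<rbrakk>
   \<Longrightarrow> inv\<^bsub>Grp M X\<^esub> x \<in> carrier (Grp M X)"
  using group.inv_closed[OF comm_group.axioms(2)[OF module_group]] .

lemma act_closed [simp]:
  "\<lbrakk>is_module C M; X \<in> Obj C; Y \<in> Obj C; f \<in> Hom C X Y; x \<in> carrier (Grp M X)\<rbrakk>
   \<Longrightarrow> Act M X Y f x \<in> carrier (Grp M Y)"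
  unfolding is_module_def by (blast intro: hom_in_carrier)

lemma act_hom: "\<lbrakk>is_module C M; X \<in> Obj C; Y \<in> Obj C; f \<in> Hom C X Y\<rbrakk>
   \<Longrightarrow> Act M X Y f \<in> hom (Grp M X) (Grp M Y)"
  by (auto simp: is_module_def)

lemma act_mult:
  "\<lbrakk>is_module C M; X \<in> Obj C; Y \<in> Obj C; f \<in> Hom C X Y; x \<in> carrier (Grp M X); y \<in> carrier (Grp M X)\<rbrakk>
   \<Longrightarrow> Act M X Y f (x \<otimes>\<^bsub>Grp M X\<^esub> y) = Act M X Y f x \<otimes>\<^bsub>Grp M Y\<^esub> Act M X Y f y"
  by (rule hom_mult[OF act_hom])

lemma act_one:
  "\<lbrakk>is_module C M; X \<in> Obj C; Y \<in> Obj C; f \<in> Hom C X Y\<rbrakk>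
   \<Longrightarrow> Act M X Y f \<one>\<^bsub>Grp M X\<^esub> = \<one>\<^bsub>Grp M Y\<^esub>"
  by (rule hom_one[OF act_hom]) (auto dest: module_group simp: comm_group_def)

lemma act_inv:
  assumes "is_module C M" "X \<in> Obj C" "Y \<in> Obj C" "f \<in> Hom C X Y" "x \<in> carrier (Grp M X)"
  shows "Act M X Y f (inv\<^bsub>Grp M X\<^esub> x) = inv\<^bsub>Grp M Y\<^esub> Act M X Y f x"
proof -
  interpret group_hom "Grp M X" "Grp M Y" "Act M X Y f"
    using assms module_group act_hom
    by (auto simp: comm_group_def group_hom_def group_hom_axioms_def)
  show ?thesis using assms by simp
qed

lemma act_id [simp]:
  "\<lbrakk>is_module C M; X \<in> Obj C; x \<in> carrier (Grp M X)\<rbrakk> \<Longrightarrow> Act M X X (Ide C X) x = x"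
  by (auto simp: is_module_def)

lemma act_comp:
  "\<lbrakk>is_module C M; X \<in> Obj C; Y \<in> Obj C; Z \<in> Obj C; f \<in> Hom C X Y; g \<in> Hom C Y Z;
    x \<in> carrier (Grp M X)\<rbrakk>
   \<Longrightarrow> Act M X Z (Comp C X Y Z g f) x = Act M Y Z g (Act M X Y f x)"
  by (auto simp: is_module_def)

lemma act_add:
  "\<lbrakk>is_module C M; X \<in> Obj C; Y \<in> Obj C; f \<in> Hom C X Y; g \<in> Hom C X Y; x \<in> carrier (Grp M X)\<rbrakk>
   \<Longrightarrow> Act M X Y (Add C X Y f g) x = Act M X Y f x \<otimes>\<^bsub>Grp M Y\<^esub> Act M X Y g x"
  by (auto simp: is_module_def)

lemma act_zero:
  assumes "is_module C M" "X \<in> Obj C" "Y \<in> Obj C" "x \<in> carrier (Grp M X)"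
  shows "Act M X Y (Zero C X Y) x = \<one>\<^bsub>Grp M Y\<^esub>"
proof -
  interpret G: comm_group "Grp M Y" using module_group assms by blast
  interpret H: comm_group "hom_group C X Y" using comm_group_hom assms by blast
  have "Add C X Y (Zero C X Y) (Zero C X Y) = Zero C X Y"
    using H.l_one[of "Zero C X Y"] assms by simp
  then show ?thesis
    using act_add[of M X Y "Zero C X Y" "Zero C X Y" x] assms G.l_cancel_one'[of "Act M X Y (Zero C X Y) x"]
    by simp
qed

text \<open>A module structure is pushed forward along surjections \<open>\<pi> X\<close>. The
  groups of \<open>A\<close> have to be genuine, but the other module laws are demanded only after
  \<open>\<pi>\<close>: fractions satisfy additivity in the arrow merely up to the relation that
  \<open>\<pi>\<close> divides out. The carriers may have another type, as for quotient
  modules.\<close>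

lemma is_module_image:
  fixes A :: "('o, 'm, 'v) cmod" and L :: "('o, 'm, 'w) cmod"
  assumes "\<And>X. X \<in> Obj C \<Longrightarrow> comm_group (Grp A X)"
    and surj: "\<And>X. X \<in> Obj C \<Longrightarrow> \<pi> X ` carrier (Grp A X) = carrier (Grp L X)"
    and mult: "\<And>X a b. \<lbrakk>X \<in> Obj C; a \<in> carrier (Grp A X); b \<in> carrier (Grp A X)\<rbrakk>
      \<Longrightarrow> \<pi> X (a \<otimes>\<^bsub>Grp A X\<^esub> b) = \<pi> X a \<otimes>\<^bsub>Grp L X\<^esub> \<pi> X b"
    and one: "\<And>X. X \<in> Obj C \<Longrightarrow> \<pi> X \<one>\<^bsub>Grp A X\<^esub> = \<one>\<^bsub>Grp L X\<^esub>"
    and closed: "\<And>X Y f a. \<lbrakk>X \<in> Obj C; Y \<in> Obj C; f \<in> Hom C X Y; a \<in> carrier (Grp A X)\<rbrakk>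
      \<Longrightarrow> Act A X Y f a \<in> carrier (Grp A Y)"
    and act: "\<And>X Y f a. \<lbrakk>X \<in> Obj C; Y \<in> Obj C; f \<in> Hom C X Y; a \<in> carrier (Grp A X)\<rbrakk>
      \<Longrightarrow> Act L X Y f (\<pi> X a) = \<pi> Y (Act A X Y f a)"
    and "\<And>X Y f a b. \<lbrakk>X \<in> Obj C; Y \<in> Obj C; f \<in> Hom C X Y; a \<in> carrier (Grp A X); b \<in> carrier (Grp A X)\<rbrakk>
      \<Longrightarrow> \<pi> Y (Act A X Y f (a \<otimes>\<^bsub>Grp A X\<^esub> b)) = \<pi> Y (Act A X Y f a \<otimes>\<^bsub>Grp A Y\<^esub> Act A X Y f b)"
    and "\<And>X a. \<lbrakk>X \<in> Obj C; a \<in> carrier (Grp A X)\<rbrakk> \<Longrightarrow> \<pi> X (Act A X X (Ide C X) a) = \<pi> X a"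
    and "\<And>X Y Z f g a. \<lbrakk>X \<in> Obj C; Y \<in> Obj C; Z \<in> Obj C; f \<in> Hom C X Y; g \<in> Hom C Y Z;
        a \<in> carrier (Grp A X)\<rbrakk>
      \<Longrightarrow> \<pi> Z (Act A X Z (Comp C X Y Z g f) a) = \<pi> Z (Act A Y Z g (Act A X Y f a))"
    and "\<And>X Y f g a. \<lbrakk>X \<in> Obj C; Y \<in> Obj C; f \<in> Hom C X Y; g \<in> Hom C X Y; a \<in> carrier (Grp A X)\<rbrakk>
      \<Longrightarrow> \<pi> Y (Act A X Y (Add C X Y f g) a) = \<pi> Y (Act A X Y f a \<otimes>\<^bsub>Grp A Y\<^esub> Act A X Y g a)"
  shows "is_module C L"
proof -
  have grp: "comm_group (Grp L X)" if X: "X \<in> Obj C" for X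
  proof -
    have "\<pi> X \<in> hom (Grp A X) (Grp L X)"
      using surj[OF X] mult[OF X] by (auto simp: hom_def)
    \<comment> \<open>This yields a group whose carrier and unit are overwritten by the image and by
      \<open>\<pi> X \<one>\<close>; \<open>surj\<close> and \<open>one\<close> show that nothing
      has changed.\<close>
    from comm_group.hom_imp_img_comm_group[OF assms(1)[OF X] this]
    show ?thesis by (simp add: surj[OF X] one[OF X])
  qed
  have cl: "\<pi> X a \<in> carrier (Grp L X)" if "X \<in> Obj C" "a \<in> carrier (Grp A X)" for X a
    using surj[OF that(1)] that(2) by auto
  have "Act L X Y f \<in> hom (Grp L X) (Grp L Y)"
    if XY: "X \<in> Obj C" "Y \<in> Obj C" "f \<in> Hom C X Y" for X Y f
  proof (rule homI)
    fix x assume "x \<in> carrier (Grp L X)"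
    then obtain a where "a \<in> carrier (Grp A X)" "x = \<pi> X a" using surj[OF XY(1)] by blast
    then show "Act L X Y f x \<in> carrier (Grp L Y)"
      using XY by (simp add: act cl closed)
  next
    fix x y assume "x \<in> carrier (Grp L X)" "y \<in> carrier (Grp L X)"
    then obtain a b where ab: "a \<in> carrier (Grp A X)" "x = \<pi> X a" "b \<in> carrier (Grp A X)" "y = \<pi> X b"
      using surj[OF XY(1)] by blast
    interpret A: comm_group "Grp A X" using assms(1) XY by blast
    show "Act L X Y f (x \<otimes>\<^bsub>Grp L X\<^esub> y) = Act L X Y f x \<otimes>\<^bsub>Grp L Y\<^esub> Act L X Y f y"
      using XY ab by (simp add: act closed assms(7) flip: mult)
  qed
  then show ?thesis
    unfolding is_module_def
  proof (intro conjI ballI)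
    fix X assume X: "X \<in> Obj C"
    show "comm_group (Grp L X)" using grp[OF X] .
    fix x assume "x \<in> carrier (Grp L X)"
    then obtain a where a: "a \<in> carrier (Grp A X)" "x = \<pi> X a" using surj[OF X] by blast
    then show "Act L X X (Ide C X) x = x"
      using X assms(8) by (simp add: act)
    fix Y assume Y: "Y \<in> Obj C"
    fix f assume f: "f \<in> Hom C X Y"
    show "Act L X Z (Comp C X Y Z g f) x = Act L Y Z g (Act L X Y f x)"
      if "Z \<in> Obj C" "g \<in> Hom C Y Z" for Z g
      using X Y f a that assms(9) by (simp add: act closed)
    show "Act L X Y (Add C X Y f g) x = Act L X Y f x \<otimes>\<^bsub>Grp L Y\<^esub> Act L X Y g x"
      if "g \<in> Hom C X Y" for g
      using X Y f a that assms(10) by (simp add: act closed flip: mult)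
  qed
qed

section \<open>Properties that hold on an ideal of the filter\<close>

text \<open>\<open>P\<close> need not cut out an ideal itself; it only has to contain one of the
  filter. Properties that are not closed under addition of arrows can thus be handled.\<close>

definition almost :: "'o \<Rightarrow> ('o \<Rightarrow> 'm \<Rightarrow> bool) \<Rightarrow> bool" where
  "almost X P \<longleftrightarrow> (\<exists>I\<in>F X. \<forall>Y\<in>Obj C. \<forall>h\<in>I Y. P Y h)"

text \<open>No clause for inverses: the inverse of \<open>h\<close> is the composite of
  \<open>h\<close> with the inverse of the identity, so the last clause yields it.\<close>

definition ideal_pred :: "'o \<Rightarrow> ('o \<Rightarrow> 'm \<Rightarrow> bool) \<Rightarrow> bool" where
  "ideal_pred X P \<longleftrightarrow>
     (\<forall>Y\<in>Obj C. P Y (Zero C X Y)) \<and>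
     (\<forall>Y\<in>Obj C. \<forall>f\<in>Hom C X Y. \<forall>g\<in>Hom C X Y. P Y f \<longrightarrow> P Y g \<longrightarrow> P Y (Add C X Y f g)) \<and>
     (\<forall>Y\<in>Obj C. \<forall>Z\<in>Obj C. \<forall>f\<in>Hom C X Y. \<forall>g\<in>Hom C Y Z. P Y f \<longrightarrow> P Z (Comp C X Y Z g f))"

definition pred_ideal :: "'o \<Rightarrow> ('o \<Rightarrow> 'm \<Rightarrow> bool) \<Rightarrow> 'o \<Rightarrow> 'm set" where
  "pred_ideal X P = (\<lambda>Y. if Y \<in> Obj C then {h \<in> Hom C X Y. P Y h} else {})"

lemma ideal_subset:
  assumes "X \<in> Obj C" "I \<in> F X" "Y \<in> Obj C" "h \<in> I Y"
  shows "h \<in> Hom C X Y"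
  using ideals[OF assms(1,2)] assms(3,4) subgroup.subset[of "I Y" "hom_group C X Y"]
  by (auto simp: left_ideal_def submodule_def representable_def)

lemma ideal_comp:
  "\<lbrakk>X \<in> Obj C; I \<in> F X; Y \<in> Obj C; Z \<in> Obj C; f \<in> I Y; g \<in> Hom C Y Z\<rbrakk>
   \<Longrightarrow> Comp C X Y Z g f \<in> I Z"
  using ideals[of X I] by (auto simp: left_ideal_def submodule_def representable_def)

lemma ideal_add:
  "\<lbrakk>X \<in> Obj C; I \<in> F X; Y \<in> Obj C; f \<in> I Y; g \<in> I Y\<rbrakk> \<Longrightarrow> Add C X Y f g \<in> I Y"
  using ideals[of X I] subgroup.m_closed[of "I Y" "hom_group C X Y" f g]
  by (auto simp: left_ideal_def submodule_def representable_def)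

lemma left_ideal_pred_ideal:
  assumes X: "X \<in> Obj C" and P: "ideal_pred X P"
  shows "left_ideal C X (pred_ideal X P)"
proof -
  have "subgroup {h \<in> Hom C X Y. P Y h} (hom_group C X Y)" if Y: "Y \<in> Obj C" for Y
  proof -
    interpret G: comm_group "hom_group C X Y" using comm_group_hom X Y by blast
    interpret E: comm_group "hom_group C Y Y" using comm_group_hom Y by blast
    have inv: "P Y (inv\<^bsub>hom_group C X Y\<^esub> h)" if h: "h \<in> Hom C X Y" "P Y h" for h
    proof -
      let ?m = "inv\<^bsub>hom_group C Y Y\<^esub> (Ide C Y)"
      have m: "?m \<in> Hom C Y Y" using E.inv_closed[of "Ide C Y"] Y by simp
      have "Add C X Y (Comp C X Y Y ?m h) h = Comp C X Y Y (Add C Y Y ?m (Ide C Y)) h"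
        using X Y h m by (simp add: comp_add_left)
      also have "Add C Y Y ?m (Ide C Y) = Zero C Y Y"
        using E.l_inv[of "Ide C Y"] Y by simp
      finally have "Add C X Y (Comp C X Y Y ?m h) h = Zero C X Y"
        using X Y h by (simp add: comp_zero_left)
      then have "inv\<^bsub>hom_group C X Y\<^esub> h = Comp C X Y Y ?m h"
        using G.inv_equality[of "Comp C X Y Y ?m h" h] h m X Y by simp
      then show ?thesis using P h m X Y by (auto simp: ideal_pred_def)
    qed
    show ?thesis
      using inv P X Y G.inv_closed by unfold_locales (auto simp: ideal_pred_def)
  qed
  then show ?thesis
    using P X by (auto simp: left_ideal_def submodule_def representable_def pred_ideal_def ideal_pred_def)
qed

text \<open>The bridge between the filter axioms, which speak of ideals, and \<open>almost\<close>:
  the ideal cut out by \<open>P\<close> contains the witness of \<open>almost X P\<close>, so T1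
  applies.\<close>

lemma pred_ideal_in_F_iff:
  assumes "X \<in> Obj C" "ideal_pred X P"
  shows "pred_ideal X P \<in> F X \<longleftrightarrow> almost X P"
proof
  assume "pred_ideal X P \<in> F X"
  then show "almost X P"
    unfolding almost_def by (intro bexI[of _ "pred_ideal X P"]) (auto simp: pred_ideal_def)
next
  assume "almost X P"
  then obtain I where I: "I \<in> F X" "\<And>Y h. Y \<in> Obj C \<Longrightarrow> h \<in> I Y \<Longrightarrow> P Y h"
    by (auto simp: almost_def)
  show "pred_ideal X P \<in> F X"
  proof (rule T1[OF assms(1) I(1) left_ideal_pred_ideal[OF assms]])
    show "I Z \<subseteq> pred_ideal X P Z" for Z
      using I ideals[OF assms(1) I(1)] ideal_subset[OF assms(1) I(1)]
      by (cases "Z \<in> Obj C") (auto simp: pred_ideal_def left_ideal_def submodule_def)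
  qed
qed

lemma almost_mono:
  assumes "almost X P" "X \<in> Obj C" "\<And>Y h. \<lbrakk>Y \<in> Obj C; h \<in> Hom C X Y; P Y h\<rbrakk> \<Longrightarrow> Q Y h"
  shows "almost X Q"
proof -
  obtain I where I: "I \<in> F X" "\<And>Y h. Y \<in> Obj C \<Longrightarrow> h \<in> I Y \<Longrightarrow> P Y h"
    using assms(1) by (auto simp: almost_def)
  show ?thesis
    unfolding almost_def
    using assms(3) I ideal_subset[OF assms(2) I(1)] by (intro bexI[OF _ I(1)] ballI) simp
qed

lemma almost_cong:
  assumes "X \<in> Obj C" "\<And>Y h. \<lbrakk>Y \<in> Obj C; h \<in> Hom C X Y\<rbrakk> \<Longrightarrow> P Y h \<longleftrightarrow> Q Y h"
  shows "almost X P \<longleftrightarrow> almost X Q"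
  using almost_mono[of X P Q] almost_mono[of X Q P] assms by blast

lemma almost_all:
  assumes "X \<in> Obj C" "\<And>Y h. \<lbrakk>Y \<in> Obj C; h \<in> Hom C X Y\<rbrakk> \<Longrightarrow> P Y h"
  shows "almost X P"
  using assms nonempty[of X] ideal_subset unfolding almost_def by blast

lemma almost_conj:
  assumes "X \<in> Obj C" "almost X P" "almost X Q"
  shows "almost X (\<lambda>Y h. P Y h \<and> Q Y h)"
proof -
  obtain I J where "I \<in> F X" "\<forall>Y\<in>Obj C. \<forall>h\<in>I Y. P Y h" "J \<in> F X" "\<forall>Y\<in>Obj C. \<forall>h\<in>J Y. Q Y h"
    using assms unfolding almost_def by blast
  then show ?thesis
    using T2[OF assms(1), of I J] unfolding almost_def by (intro bexI[of _ "\<lambda>Z. I Z \<inter> J Z"]) auto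
qed

lemma almost_mono2:
  assumes "almost X P" "almost X Q" "X \<in> Obj C"
    "\<And>Y h. \<lbrakk>Y \<in> Obj C; h \<in> Hom C X Y; P Y h; Q Y h\<rbrakk> \<Longrightarrow> R Y h"
  shows "almost X R"
  using almost_mono[OF almost_conj[OF assms(3,1,2)]] assms by blast

text \<open>T3, read as the pullback of a property along \<open>k\<close>.\<close>

lemma almost_colon:
  assumes "almost X P" "X \<in> Obj C" "Y \<in> Obj C" "k \<in> Hom C X Y"
  shows "almost Y (\<lambda>Z h. P Z (Comp C X Y Z h k))"
proof -
  obtain I where "I \<in> F X" "\<forall>Y\<in>Obj C. \<forall>h\<in>I Y. P Y h"
    using assms unfolding almost_def by blast
  then show ?thesis
    using T3[of X Y I k] assms unfolding almost_def
    by (intro bexI[of _ "colon C I X Y k"]) (auto simp: colon_def)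
qed

text \<open>T4, read for properties. The ideal to be recognized is the one of \<open>Q\<close>, the
  ideal known to be in the filter is the witness for \<open>P\<close>, and \<open>loc\<close> says
  that the colon ideals of the former belong to the filter. \<open>Q\<close> has to be an ideal
  predicate because T4 speaks only of left ideals.\<close>

lemma almost_local:
  assumes X: "X \<in> Obj C" and Q: "ideal_pred X Q" and P: "almost X P"
    and loc: "\<And>Y h. \<lbrakk>Y \<in> Obj C; h \<in> Hom C X Y; P Y h\<rbrakk> \<Longrightarrow> almost Y (\<lambda>Z k. Q Z (Comp C X Y Z k h))"
  shows "almost X Q"
proof -
  obtain I where I: "I \<in> F X" "\<And>Y h. Y \<in> Obj C \<Longrightarrow> h \<in> I Y \<Longrightarrow> P Y h"
    using P by (auto simp: almost_def)
  have "pred_ideal X Q \<in> F X"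
  proof (rule T4[OF X I(1) left_ideal_pred_ideal[OF X Q]])
    fix Y h assume h: "Y \<in> Obj C" "h \<in> I Y"
    have hom: "h \<in> Hom C X Y" using ideal_subset[OF X I(1) h] .
    have "colon C (pred_ideal X Q) X Y h = pred_ideal Y (\<lambda>Z k. Q Z (Comp C X Y Z k h))"
      using X h(1) hom by (auto simp: colon_def pred_ideal_def fun_eq_iff)
    moreover have "ideal_pred Y (\<lambda>Z k. Q Z (Comp C X Y Z k h))"
      using Q X h(1) hom by (simp add: ideal_pred_def comp_zero_left comp_add_left flip: comp_assoc)
    ultimately show "colon C (pred_ideal X Q) X Y h \<in> F Y"
      using pred_ideal_in_F_iff h(1) loc[OF h(1) hom I(2)[OF h]] by simp
  qed
  then show ?thesis using pred_ideal_in_F_iff X Q by blast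
qed

section \<open>Equality up to torsion\<close>

text \<open>Congruence modulo the torsion submodule, see \<open>teq_iff_torsion_part\<close>. Stated
  through the action, it makes sense for elements of the module itself and no quotient has to be
  formed.\<close>

definition teq :: "('o, 'm, 'v) cmod \<Rightarrow> 'o \<Rightarrow> 'v \<Rightarrow> 'v \<Rightarrow> bool" where
  "teq M X x y \<longleftrightarrow> almost X (\<lambda>Y h. Act M X Y h x = Act M X Y h y)"

lemma ideal_pred_eq:
  assumes "is_module C M" "X \<in> Obj C" "x \<in> carrier (Grp M X)" "y \<in> carrier (Grp M X)"
  shows "ideal_pred X (\<lambda>Y h. Act M X Y h x = Act M X Y h y)"
  using assms by (simp add: ideal_pred_def act_zero act_add act_comp)

lemma ideal_pred_submodule:
  assumes "is_module C M" "X \<in> Obj C" "x \<in> carrier (Grp M X)" "submodule C M S"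
  shows "ideal_pred X (\<lambda>Y h. Act M X Y h x \<in> S Y)"
proof -
  have S: "\<And>Y. Y \<in> Obj C \<Longrightarrow> subgroup (S Y) (Grp M Y)"
    "\<And>Y Z f y. \<lbrakk>Y \<in> Obj C; Z \<in> Obj C; f \<in> Hom C Y Z; y \<in> S Y\<rbrakk> \<Longrightarrow> Act M Y Z f y \<in> S Z"
    using assms(4) by (auto simp: submodule_def)
  show ?thesis
    using assms(1-3) S subgroup.one_closed[OF S(1)] subgroup.m_closed[OF S(1)]
    by (simp add: ideal_pred_def act_zero act_add act_comp)
qed

lemma teq_refl [simp]: "X \<in> Obj C \<Longrightarrow> teq M X x x"
  unfolding teq_def by (rule almost_all) auto

lemma teq_sym: "teq M X x y \<Longrightarrow> teq M X y x"
  unfolding teq_def by (metis (mono_tags, lifting) almost_def)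

lemma teq_trans: "\<lbrakk>X \<in> Obj C; teq M X x y; teq M X y z\<rbrakk> \<Longrightarrow> teq M X x z"
  unfolding teq_def by (erule (1) almost_mono2) auto

lemma teq_mult:
  assumes "is_module C M" "X \<in> Obj C" "x \<in> carrier (Grp M X)" "y \<in> carrier (Grp M X)"
    "x' \<in> carrier (Grp M X)" "y' \<in> carrier (Grp M X)" "teq M X x x'" "teq M X y y'"
  shows "teq M X (x \<otimes>\<^bsub>Grp M X\<^esub> y) (x' \<otimes>\<^bsub>Grp M X\<^esub> y')"
  using assms(7,8,2) unfolding teq_def
  by (rule almost_mono2) (use assms in \<open>simp add: act_mult\<close>)

lemma teq_inv:
  assumes "is_module C M" "X \<in> Obj C" "x \<in> carrier (Grp M X)" "x' \<in> carrier (Grp M X)" "teq M X x x'"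
  shows "teq M X (inv\<^bsub>Grp M X\<^esub> x) (inv\<^bsub>Grp M X\<^esub> x')"
  using assms(5,2) unfolding teq_def
  by (rule almost_mono) (use assms in \<open>simp add: act_inv\<close>)

lemma teq_act:
  assumes "is_module C M" "X \<in> Obj C" "x \<in> carrier (Grp M X)" "x' \<in> carrier (Grp M X)"
    "Y \<in> Obj C" "h \<in> Hom C X Y" "teq M X x x'"
  shows "teq M Y (Act M X Y h x) (Act M X Y h x')"
  unfolding teq_def
  by (rule almost_mono[OF almost_colon[OF assms(7)[unfolded teq_def], of Y h]])
    (use assms in \<open>simp_all add: act_comp\<close>)

text \<open>The quotient by the torsion is torsion-free: by T4, two nested "almost everywhere"
  contract to one.\<close>

lemma teq_local:
  assumes "is_module C M" "X \<in> Obj C" "x \<in> carrier (Grp M X)" "y \<in> carrier (Grp M X)"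
    and "almost X (\<lambda>Y h. teq M Y (Act M X Y h x) (Act M X Y h y))"
  shows "teq M X x y"
  unfolding teq_def
proof (rule almost_local[OF _ ideal_pred_eq assms(5)])
  fix Y h assume "Y \<in> Obj C" "h \<in> Hom C X Y" "teq M Y (Act M X Y h x) (Act M X Y h y)"
  then show "almost Y (\<lambda>Z k. Act M X Z (Comp C X Y Z k h) x = Act M X Z (Comp C X Y Z k h) y)"
    unfolding teq_def by - (rule almost_mono, use assms in \<open>simp_all add: act_comp\<close>)
qed (use assms in auto)

lemma teq_one_iff:
  assumes "is_module C M" "X \<in> Obj C" "x \<in> carrier (Grp M X)"
  shows "teq M X x \<one>\<^bsub>Grp M X\<^esub> \<longleftrightarrow> annihilator C M X x \<in> F X"
proof -
  interpret G: comm_group "Grp M X" using module_group assms by blast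
  have "annihilator C M X x = pred_ideal X (\<lambda>Y h. Act M X Y h x = Act M X Y h \<one>\<^bsub>Grp M X\<^esub>)"
    using assms by (auto simp: annihilator_def pred_ideal_def act_one fun_eq_iff)
  then show ?thesis
    using pred_ideal_in_F_iff[OF assms(2) ideal_pred_eq[OF assms G.one_closed]] by (simp add: teq_def)
qed


section \<open>Natural transformations\<close>

lemma nat_homI:
  assumes "\<And>X. X \<in> Obj C \<Longrightarrow> \<eta> X \<in> hom (Grp M X) (Grp N X)"
    and "\<And>X. X \<in> Obj C \<Longrightarrow> \<eta> X \<in> extensional (carrier (Grp M X))"
    and "\<eta> \<in> extensional (Obj C)"
    and "\<And>X Y f x. \<lbrakk>X \<in> Obj C; Y \<in> Obj C; f \<in> Hom C X Y; x \<in> carrier (Grp M X)\<rbrakk>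
      \<Longrightarrow> \<eta> Y (Act M X Y f x) = Act N X Y f (\<eta> X x)"
  shows "\<eta> \<in> nat_hom C M N"
  using assms by (auto simp: nat_hom_def PiE_def)

lemma nat_hom_hom: "\<lbrakk>\<eta> \<in> nat_hom C M N; X \<in> Obj C\<rbrakk> \<Longrightarrow> \<eta> X \<in> hom (Grp M X) (Grp N X)"
  by (auto simp: nat_hom_def)

lemma nat_hom_closed [simp]:
  "\<lbrakk>\<eta> \<in> nat_hom C M N; X \<in> Obj C; x \<in> carrier (Grp M X)\<rbrakk> \<Longrightarrow> \<eta> X x \<in> carrier (Grp N X)"
  by (rule hom_in_carrier[OF nat_hom_hom])

lemma nat_hom_mult:
  "\<lbrakk>\<eta> \<in> nat_hom C M N; X \<in> Obj C; x \<in> carrier (Grp M X); y \<in> carrier (Grp M X)\<rbrakk>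
   \<Longrightarrow> \<eta> X (x \<otimes>\<^bsub>Grp M X\<^esub> y) = \<eta> X x \<otimes>\<^bsub>Grp N X\<^esub> \<eta> X y"
  by (rule hom_mult[OF nat_hom_hom])

lemma nat_hom_one:
  "\<lbrakk>\<eta> \<in> nat_hom C M N; is_module C M; is_module C N; X \<in> Obj C\<rbrakk> \<Longrightarrow> \<eta> X \<one>\<^bsub>Grp M X\<^esub> = \<one>\<^bsub>Grp N X\<^esub>"
  by (rule hom_one[OF nat_hom_hom]) (auto dest: module_group simp: comm_group_def)

lemma nat_hom_inv:
  assumes "\<eta> \<in> nat_hom C M N" "is_module C M" "is_module C N" "X \<in> Obj C" "x \<in> carrier (Grp M X)"
  shows "\<eta> X (inv\<^bsub>Grp M X\<^esub> x) = inv\<^bsub>Grp N X\<^esub> \<eta> X x"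
proof -
  interpret group_hom "Grp M X" "Grp N X" "\<eta> X"
    using assms by (auto intro!: group_hom.intro group_hom_axioms.intro nat_hom_hom
        comm_group.axioms(2) module_group)
  show ?thesis using assms by simp
qed

lemma nat_hom_act:
  "\<lbrakk>\<eta> \<in> nat_hom C M N; X \<in> Obj C; Y \<in> Obj C; f \<in> Hom C X Y; x \<in> carrier (Grp M X)\<rbrakk>
   \<Longrightarrow> \<eta> Y (Act M X Y f x) = Act N X Y f (\<eta> X x)"
  by (simp add: nat_hom_def)

lemma nat_hom_eqI:
  assumes "\<eta> \<in> nat_hom C M N" "\<theta> \<in> nat_hom C M' N'"
    and "\<And>X. X \<in> Obj C \<Longrightarrow> carrier (Grp M' X) = carrier (Grp M X)"
    and "\<And>X x. X \<in> Obj C \<Longrightarrow> x \<in> carrier (Grp M X) \<Longrightarrow> \<eta> X x = \<theta> X x"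
  shows "\<eta> = \<theta>"
proof (rule extensionalityI[of _ "Obj C"])
  fix X assume X: "X \<in> Obj C"
  show "\<eta> X = \<theta> X"
    by (rule extensionalityI[of _ "carrier (Grp M X)"])
      (use assms X in \<open>auto simp: nat_hom_def PiE_def Pi_def\<close>)
qed (use assms in \<open>auto simp: nat_hom_def PiE_def\<close>)

section \<open>The category of modules\<close>

lemma Mod_cat_simps [simp]:
  "M \<in> Obj (Mod_cat U C) \<longleftrightarrow> is_module C M \<and> (\<forall>X\<in>Obj C. carrier (Grp M X) \<in> U)"
  "Hom (Mod_cat U C) = nat_hom C"
  by (simp_all add: Mod_cat_def)

lemma Comp_Mod_cat_apply [simp]:
  "\<lbrakk>X \<in> Obj C; x \<in> carrier (Grp L X)\<rbrakk> \<Longrightarrow> Comp (Mod_cat U C) L M N g f X x = g X (f X x)"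
  by (simp add: Mod_cat_def compose_def)

lemma Ide_Mod_cat_apply [simp]:
  "\<lbrakk>X \<in> Obj C; x \<in> carrier (Grp M X)\<rbrakk> \<Longrightarrow> Ide (Mod_cat U C) M X x = x"
  by (simp add: Mod_cat_def)

lemma Ide_Mod_cat_nat_hom [simp]: "is_module C M \<Longrightarrow> Ide (Mod_cat U C) M \<in> nat_hom C M M"
  by (rule nat_homI) (auto simp: hom_def Mod_cat_def)

lemma Comp_Mod_cat_nat_hom [simp]:
  "\<lbrakk>is_module C L; f \<in> nat_hom C L M; g \<in> nat_hom C M N\<rbrakk>
   \<Longrightarrow> Comp (Mod_cat U C) L M N g f \<in> nat_hom C L N"
  by (rule nat_homI) (auto simp: hom_def nat_hom_act nat_hom_mult Mod_cat_def compose_def)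

lemma category_Mod_cat: "category (Mod_cat U C)"
proof
  fix X Y f assume "X \<in> Obj (Mod_cat U C)" "Y \<in> Obj (Mod_cat U C)" and f: "f \<in> Hom (Mod_cat U C) X Y"
  then show "Comp (Mod_cat U C) X X Y f (Ide (Mod_cat U C) X) = f"
    "Comp (Mod_cat U C) X Y Y (Ide (Mod_cat U C) Y) f = f"
    by (auto intro!: nat_hom_eqI[of _ X Y f X Y])
next
  fix W X Y Z f g h
  assume "W \<in> Obj (Mod_cat U C)" "X \<in> Obj (Mod_cat U C)" "Y \<in> Obj (Mod_cat U C)" "Z \<in> Obj (Mod_cat U C)"
    "f \<in> Hom (Mod_cat U C) W X" "g \<in> Hom (Mod_cat U C) X Y" "h \<in> Hom (Mod_cat U C) Y Z"
  then show "Comp (Mod_cat U C) W Y Z h (Comp (Mod_cat U C) W X Y g f) =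
      Comp (Mod_cat U C) W X Z (Comp (Mod_cat U C) X Y Z h g) f"
    by (auto intro!: nat_hom_eqI[of _ W Z _ W Z] intro: Comp_Mod_cat_nat_hom)
qed auto

section \<open>Closed modules\<close>

definition separated :: "('o, 'm, 'v) cmod \<Rightarrow> bool" where
  "separated L \<longleftrightarrow> (\<forall>X\<in>Obj C. \<forall>x\<in>carrier (Grp L X). \<forall>y\<in>carrier (Grp L X). teq L X x y \<longrightarrow> x = y)"

definition gluing :: "('o, 'm, 'v) cmod \<Rightarrow> bool" where
  "gluing L \<longleftrightarrow> (\<forall>X\<in>Obj C. \<forall>I\<in>F X. \<forall>\<phi>\<in>nat_hom C (sub_mod (representable C X) I) L.
     \<exists>x\<in>carrier (Grp L X). \<forall>Y\<in>Obj C. \<forall>h\<in>I Y. \<phi> Y h = Act L X Y h x)"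

lemma sub_mod_simps [simp]:
  "carrier (Grp (sub_mod M S) X) = S X" "monoid.mult (Grp (sub_mod M S) X) = monoid.mult (Grp M X)"
  "one (Grp (sub_mod M S) X) = one (Grp M X)" "Act (sub_mod M S) = Act M"
  by (simp_all add: sub_mod_def)

lemma representable_simps [simp]:
  "Grp (representable C X) = hom_group C X" "Act (representable C X) = Comp C X"
  by (simp_all add: representable_def)

lemma yoneda:
  assumes "is_module C L" "X \<in> Obj C" "x \<in> carrier (Grp L X)"
  shows "(\<lambda>Y\<in>Obj C. \<lambda>h\<in>Hom C X Y. Act L X Y h x) \<in> nat_hom C (representable C X) L"
  by (rule nat_homI) (use assms in \<open>auto simp: hom_def act_add act_comp\<close>)

lemma restrict_nat_hom:
  assumes X: "X \<in> Obj C" and I: "I \<in> F X" and \<eta>: "\<eta> \<in> nat_hom C (representable C X) L"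
  shows "(\<lambda>Y\<in>Obj C. restrict (\<eta> Y) (I Y)) \<in> nat_hom C (sub_mod (representable C X) I) L"
proof -
  note m = ideal_add[OF X I] and a = ideal_comp[OF X I]
  note h = ideal_subset[OF X I]
  show ?thesis
  proof (rule nat_homI)
    fix Y assume Y: "Y \<in> Obj C"
    have "\<eta> Y f \<in> carrier (Grp L Y)" if "f \<in> I Y" for f
      using nat_hom_closed[OF \<eta> Y] h[OF Y that] by simp
    moreover have "\<eta> Y (Add C X Y f g) = \<eta> Y f \<otimes>\<^bsub>Grp L Y\<^esub> \<eta> Y g" if "f \<in> I Y" "g \<in> I Y" for f g
      using nat_hom_mult[OF \<eta> Y] h[OF Y] that by simp
    ultimately show "(\<lambda>Y\<in>Obj C. restrict (\<eta> Y) (I Y)) Y \<in> hom (Grp (sub_mod (representable C X) I) Y) (Grp L Y)"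
      using Y m by (auto simp: hom_def)
  next
    fix Y Z f x
    assume "Y \<in> Obj C" "Z \<in> Obj C" "f \<in> Hom C Y Z" "x \<in> carrier (Grp (sub_mod (representable C X) I) Y)"
    then show "(\<lambda>Y\<in>Obj C. restrict (\<eta> Y) (I Y)) Z (Act (sub_mod (representable C X) I) Y Z f x) =
       Act L Y Z f ((\<lambda>Y\<in>Obj C. restrict (\<eta> Y) (I Y)) Y x)"
      using nat_hom_act[OF \<eta>, of Y Z f x] a h by simp
  qed auto
qed

lemma nat_hom_representable:
  assumes "X \<in> Obj C" "\<eta> \<in> nat_hom C (representable C X) L" "Y \<in> Obj C" "h \<in> Hom C X Y"
  shows "\<eta> Y h = Act L X Y h (\<eta> X (Ide C X))"
  using nat_hom_act[OF assms(2), of X Y h "Ide C X"] assms by simp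

text \<open>By Yoneda, a homomorphism from Hom(X,-) to \<open>L\<close> is an element of
  \<open>L(X)\<close>, and its restriction to \<open>I\<close> records the action of the arrows of
  \<open>I\<close> on this element. Injectivity of all restrictions is then
  \<open>separated\<close>, and surjectivity is \<open>gluing\<close>.\<close>

lemma closed_module_iff:
  assumes L: "is_module C L"
  shows "closed_module C F L \<longleftrightarrow> separated L \<and> gluing L"
proof
  assume cl: "closed_module C F L"
  have bij: "bij_betw (\<lambda>\<eta>. \<lambda>Y\<in>Obj C. restrict (\<eta> Y) (I Y)) (nat_hom C (representable C X) L)
     (nat_hom C (sub_mod (representable C X) I) L)" if "X \<in> Obj C" "I \<in> F X" for X I
    using cl that by (simp add: closed_module_def iso_def nat_hom_group_def)
  show "separated L \<and> gluing L"
  proof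
    show "separated L"
      unfolding separated_def
    proof (intro ballI impI)
      fix X x y assume X: "X \<in> Obj C" and x: "x \<in> carrier (Grp L X)" and y: "y \<in> carrier (Grp L X)"
        and "teq L X x y"
      then obtain I where I: "I \<in> F X" "\<forall>Y\<in>Obj C. \<forall>h\<in>I Y. Act L X Y h x = Act L X Y h y"
        unfolding teq_def almost_def by blast
      define y' where "y' z = (\<lambda>Y\<in>Obj C. \<lambda>h\<in>Hom C X Y. Act L X Y h z)" for z
      have "(\<lambda>Y\<in>Obj C. restrict (y' x Y) (I Y)) = (\<lambda>Y\<in>Obj C. restrict (y' y Y) (I Y))"
        using I ideal_subset[OF X I(1)] by (auto simp: y'_def restrict_def fun_eq_iff)
      then have "y' x = y' y"
        using bij[OF X I(1)] yoneda[OF L X] x y unfolding bij_betw_def y'_def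
        by (blast dest: inj_onD)
      then have "y' x X (Ide C X) = y' y X (Ide C X)" by simp
      then show "x = y" using X x y L by (simp add: y'_def)
    qed
    show "gluing L"
      unfolding gluing_def
    proof (intro ballI)
      fix X I \<phi> assume X: "X \<in> Obj C" and I: "I \<in> F X"
        and "\<phi> \<in> nat_hom C (sub_mod (representable C X) I) L"
      then obtain \<eta> where \<eta>: "\<eta> \<in> nat_hom C (representable C X) L"
        "\<phi> = (\<lambda>Y\<in>Obj C. restrict (\<eta> Y) (I Y))"
        using bij[OF X I] unfolding bij_betw_def by blast
      have "\<eta> X (Ide C X) \<in> carrier (Grp L X)" using nat_hom_closed[OF \<eta>(1) X] X by simp
      then show "\<exists>x\<in>carrier (Grp L X). \<forall>Y\<in>Obj C. \<forall>h\<in>I Y. \<phi> Y h = Act L X Y h x"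
        using nat_hom_representable[OF X \<eta>(1)] ideal_subset[OF X I] by (auto simp: \<eta>(2))
    qed
  qed
next
  assume sg: "separated L \<and> gluing L"
  show "closed_module C F L"
    unfolding closed_module_def
  proof (intro ballI)
    fix X I assume X: "X \<in> Obj C" and I: "I \<in> F X"
    let ?r = "\<lambda>\<eta>. \<lambda>Y\<in>Obj C. restrict (\<eta> Y) (I Y)"
    let ?A = "nat_hom C (representable C X) L" and ?B = "nat_hom C (sub_mod (representable C X) I) L"
    have "inj_on ?r ?A"
    proof (rule inj_onI)
      fix \<eta> \<theta> assume \<eta>: "\<eta> \<in> ?A" and \<theta>: "\<theta> \<in> ?A" and eq: "?r \<eta> = ?r \<theta>"
      have eq': "\<eta> Y h = \<theta> Y h" if "Y \<in> Obj C" "h \<in> I Y" for Y h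
        using fun_cong[OF fun_cong[OF eq], of Y h] that by simp
      have "teq L X (\<eta> X (Ide C X)) (\<theta> X (Ide C X))"
        unfolding teq_def almost_def
        by (rule bexI[OF _ I])
          (use eq' ideal_subset[OF X I] in \<open>simp flip: nat_hom_representable[OF X \<eta>] nat_hom_representable[OF X \<theta>]\<close>)
      then have "\<eta> X (Ide C X) = \<theta> X (Ide C X)"
        using sg X \<eta> \<theta> unfolding separated_def by simp
      then show "\<eta> = \<theta>"
        by (intro nat_hom_eqI[OF \<eta> \<theta>])
          (simp_all add: nat_hom_representable[OF X \<eta>] nat_hom_representable[OF X \<theta>])
    qed
    moreover have "\<phi> \<in> ?r ` ?A" if \<phi>: "\<phi> \<in> ?B" for \<phi>
    proof -
      obtain x where x: "x \<in> carrier (Grp L X)" "\<forall>Y\<in>Obj C. \<forall>h\<in>I Y. \<phi> Y h = Act L X Y h x"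
        using sg X I \<phi> unfolding gluing_def by blast
      show ?thesis
      proof (rule image_eqI[OF _ yoneda[OF L X x(1)]])
        show "\<phi> = ?r (\<lambda>Y\<in>Obj C. \<lambda>h\<in>Hom C X Y. Act L X Y h x)"
          by (rule nat_hom_eqI[OF \<phi> restrict_nat_hom[OF X I yoneda[OF L X x(1)]]])
            (use x ideal_subset[OF X I] in auto)
      qed
    qed
    ultimately have "bij_betw ?r ?A ?B"
      using restrict_nat_hom[OF X I, of _ L] unfolding bij_betw_def by blast
    then show "?r \<in> iso (nat_hom_group C (representable C X) L)
        (nat_hom_group C (sub_mod (representable C X) I) L)"
      using restrict_nat_hom[OF X I, of _ L] ideal_subset[OF X I]
      by (auto simp: iso_def hom_def nat_hom_group_def restrict_def fun_eq_iff)
  qed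
qed

text \<open>A handier form of \<open>gluing\<close>: the domain is a predicate and \<open>p\<close>
  may be arbitrary outside it. Cut down to the ideal of \<open>P\<close>, it is a natural
  transformation as in the definition.\<close>

lemma gluingE:
  assumes "is_module C L" "gluing L" and X: "X \<in> Obj C" and P: "ideal_pred X P" "almost X P"
    and p: "\<And>Y h. \<lbrakk>Y \<in> Obj C; h \<in> Hom C X Y; P Y h\<rbrakk> \<Longrightarrow> p Y h \<in> carrier (Grp L Y)"
    and add: "\<And>Y f g. \<lbrakk>Y \<in> Obj C; f \<in> Hom C X Y; g \<in> Hom C X Y; P Y f; P Y g\<rbrakk>
      \<Longrightarrow> p Y (Add C X Y f g) = p Y f \<otimes>\<^bsub>Grp L Y\<^esub> p Y g"
    and act: "\<And>Y Z f g. \<lbrakk>Y \<in> Obj C; Z \<in> Obj C; f \<in> Hom C X Y; g \<in> Hom C Y Z; P Y f\<rbrakk>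
      \<Longrightarrow> p Z (Comp C X Y Z g f) = Act L Y Z g (p Y f)"
  obtains x where "x \<in> carrier (Grp L X)"
    "\<And>Y h. \<lbrakk>Y \<in> Obj C; h \<in> Hom C X Y; P Y h\<rbrakk> \<Longrightarrow> p Y h = Act L X Y h x"
proof -
  let ?I = "pred_ideal X P"
  have I: "?I \<in> F X" using pred_ideal_in_F_iff X P by blast
  have mem: "h \<in> ?I Y \<longleftrightarrow> h \<in> Hom C X Y \<and> P Y h" if "Y \<in> Obj C" for Y h
    using that by (simp add: pred_ideal_def)
  have "(\<lambda>Y\<in>Obj C. \<lambda>h\<in>?I Y. p Y h) \<in> nat_hom C (sub_mod (representable C X) ?I) L"
    by (rule nat_homI) (use P p add act X in \<open>auto simp: hom_def mem ideal_pred_def\<close>)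
  then show ?thesis
    using assms(2) X I that unfolding gluing_def by (fastforce simp: mem)
qed

text \<open>The partial homomorphism is given by its graph \<open>R\<close>.\<close>

lemma nat_hom_extension:
  assumes N: "is_module C N" and L: "is_module C L" "separated L" "gluing L"
    and R: "\<And>X x l. \<lbrakk>X \<in> Obj C; (x, l) \<in> R X\<rbrakk> \<Longrightarrow> x \<in> carrier (Grp N X) \<and> l \<in> carrier (Grp L X)"
    and one: "\<And>X. X \<in> Obj C \<Longrightarrow> (\<one>\<^bsub>Grp N X\<^esub>, \<one>\<^bsub>Grp L X\<^esub>) \<in> R X"
    and mult: "\<And>X x y l k. \<lbrakk>X \<in> Obj C; (x, l) \<in> R X; (y, k) \<in> R X\<rbrakk>
      \<Longrightarrow> (x \<otimes>\<^bsub>Grp N X\<^esub> y, l \<otimes>\<^bsub>Grp L X\<^esub> k) \<in> R X"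
    and act: "\<And>X Y f x l. \<lbrakk>X \<in> Obj C; Y \<in> Obj C; f \<in> Hom C X Y; (x, l) \<in> R X\<rbrakk>
      \<Longrightarrow> (Act N X Y f x, Act L X Y f l) \<in> R Y"
    and sv: "\<And>X x l k. \<lbrakk>X \<in> Obj C; (x, l) \<in> R X; (x, k) \<in> R X\<rbrakk> \<Longrightarrow> l = k"
    and dense: "\<And>X x. \<lbrakk>X \<in> Obj C; x \<in> carrier (Grp N X)\<rbrakk>
      \<Longrightarrow> almost X (\<lambda>Y h. \<exists>l. (Act N X Y h x, l) \<in> R Y)"
  obtains \<theta> where "\<theta> \<in> nat_hom C N L" "\<And>X x l. \<lbrakk>X \<in> Obj C; (x, l) \<in> R X\<rbrakk> \<Longrightarrow> \<theta> X x = l"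
proof -
  define D where "D X x = (\<lambda>Y h. \<exists>l. (Act N X Y h x, l) \<in> R Y)" for X x
  define p where "p X x Y h = (THE l. (Act N X Y h x, l) \<in> R Y)" for X x Y h
  have p: "p X x Y h = l" if "Y \<in> Obj C" "(Act N X Y h x, l) \<in> R Y" for X x Y h l
    unfolding p_def using sv that by blast
  \<comment> \<open>For fixed \<open>x\<close>, sending \<open>h\<close> to the value of the graph
    at \<open>h x\<close> is a homomorphism on the ideal of \<open>D X x\<close>, which lies in the
    filter by \<open>dense\<close>. Gluing replaces it by a single element, the value of the
    extension at \<open>x\<close>.\<close>
  have ex: "\<exists>a\<in>carrier (Grp L X). \<forall>Y\<in>Obj C. \<forall>h\<in>Hom C X Y. \<forall>l. (Act N X Y h x, l) \<in> R Y \<longrightarrow> l = Act L X Y h a"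
    if X: "X \<in> Obj C" and x: "x \<in> carrier (Grp N X)" for X x
  proof -
    have D: "ideal_pred X (D X x)"
      unfolding ideal_pred_def D_def
      using one mult act X x by (auto simp: act_zero[OF N] act_add[OF N] act_comp[OF N]; blast)
    obtain a where a: "a \<in> carrier (Grp L X)"
      "\<And>Y h. \<lbrakk>Y \<in> Obj C; h \<in> Hom C X Y; D X x Y h\<rbrakk> \<Longrightarrow> p X x Y h = Act L X Y h a"
    proof (rule gluingE[OF L(1,3) X D])
      show "almost X (D X x)" using dense[OF X x] by (simp add: D_def)
      fix Y h assume Y: "Y \<in> Obj C" "h \<in> Hom C X Y" "D X x Y h"
      then obtain l where l: "(Act N X Y h x, l) \<in> R Y" by (auto simp: D_def)
      show "p X x Y h \<in> carrier (Grp L Y)" using R[OF Y(1) l] p[OF Y(1) l] by simp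
      show "p X x Y (Add C X Y h g) = p X x Y h \<otimes>\<^bsub>Grp L Y\<^esub> p X x Y g"
        if g: "g \<in> Hom C X Y" "D X x Y g" for g
      proof -
        obtain k where k: "(Act N X Y g x, k) \<in> R Y" using g by (auto simp: D_def)
        have "(Act N X Y (Add C X Y h g) x, l \<otimes>\<^bsub>Grp L Y\<^esub> k) \<in> R Y"
          using mult[OF Y(1) l k] X Y g x by (simp add: act_add[OF N])
        then show ?thesis using p Y(1) l k by simp
      qed
      show "p X x Z (Comp C X Y Z g h) = Act L Y Z g (p X x Y h)"
        if g: "Z \<in> Obj C" "g \<in> Hom C Y Z" for Z g
      proof -
        have "(Act N X Z (Comp C X Y Z g h) x, Act L Y Z g l) \<in> R Z"
          using act[OF Y(1) g l] X Y g x by (simp add: act_comp[OF N])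
        then show ?thesis using p Y(1) g l by simp
      qed
    qed (use that in auto)
    show ?thesis
    proof (intro bexI[OF _ a(1)] ballI allI impI)
      fix Y h l assume Y: "Y \<in> Obj C" "h \<in> Hom C X Y" and l: "(Act N X Y h x, l) \<in> R Y"
      then show "l = Act L X Y h a" using a(2)[OF Y] p[OF Y(1) l] by (auto simp: D_def)
    qed
  qed
  define \<theta> where "\<theta> = (\<lambda>X\<in>Obj C. \<lambda>x\<in>carrier (Grp N X). SOME a. a \<in> carrier (Grp L X) \<and>
     (\<forall>Y\<in>Obj C. \<forall>h\<in>Hom C X Y. \<forall>l. (Act N X Y h x, l) \<in> R Y \<longrightarrow> l = Act L X Y h a))"
  have \<theta>: "\<theta> X x \<in> carrier (Grp L X)" 
    "\<And>Y h l. \<lbrakk>Y \<in> Obj C; h \<in> Hom C X Y; (Act N X Y h x, l) \<in> R Y\<rbrakk> \<Longrightarrow> l = Act L X Y h (\<theta> X x)"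
    if "X \<in> Obj C" "x \<in> carrier (Grp N X)" for X x
    using someI_ex[OF ex[OF that, unfolded Bex_def]] that by (simp_all add: \<theta>_def)
  \<comment> \<open>The laws for \<open>\<theta>\<close> are checked after applying arrows that lead
    into the domain of the graph, where they hold by assumption; separatedness removes the
    arrows.\<close>
  have sep: "a = b" if "X \<in> Obj C" "a \<in> carrier (Grp L X)" "b \<in> carrier (Grp L X)"
    "almost X (\<lambda>Y h. Act L X Y h a = Act L X Y h b)" for X a b
    using L(2) that unfolding separated_def teq_def by blast
  show thesis
  proof
    show "\<theta> \<in> nat_hom C N L"
    proof (rule nat_homI)
      fix X assume X: "X \<in> Obj C"
      interpret NX: comm_group "Grp N X" using module_group N X by blast
      interpret LX: comm_group "Grp L X" using module_group L X by blast
      show "\<theta> X \<in> hom (Grp N X) (Grp L X)"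
      proof (rule homI)
        fix x y assume x: "x \<in> carrier (Grp N X)" and y: "y \<in> carrier (Grp N X)"
        show "\<theta> X (x \<otimes>\<^bsub>Grp N X\<^esub> y) = \<theta> X x \<otimes>\<^bsub>Grp L X\<^esub> \<theta> X y"
        proof (rule sep[OF X])
          show "almost X (\<lambda>Y h. Act L X Y h (\<theta> X (x \<otimes>\<^bsub>Grp N X\<^esub> y)) =
                 Act L X Y h (\<theta> X x \<otimes>\<^bsub>Grp L X\<^esub> \<theta> X y))"
            using dense[OF X x] dense[OF X y] X
          proof (rule almost_mono2)
            fix Y h assume Y: "Y \<in> Obj C" "h \<in> Hom C X Y" and "\<exists>l. (Act N X Y h x, l) \<in> R Y"
              "\<exists>l. (Act N X Y h y, l) \<in> R Y"
            then obtain l k where lk: "(Act N X Y h x, l) \<in> R Y" "(Act N X Y h y, k) \<in> R Y" by blast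
            have "(Act N X Y h (x \<otimes>\<^bsub>Grp N X\<^esub> y), l \<otimes>\<^bsub>Grp L Y\<^esub> k) \<in> R Y"
              using mult[OF Y(1) lk] X Y x y N by (simp add: act_mult)
            from \<theta>(2)[OF X _ Y this] \<theta>(2)[OF X x Y lk(1)] \<theta>(2)[OF X y Y lk(2)]
            show "Act L X Y h (\<theta> X (x \<otimes>\<^bsub>Grp N X\<^esub> y)) = Act L X Y h (\<theta> X x \<otimes>\<^bsub>Grp L X\<^esub> \<theta> X y)"
              using x y X Y \<theta>(1)[OF X] L(1) by (simp add: act_mult)
          qed
        qed (use x y X \<theta> in auto)
      qed (use X \<theta> in auto)
    next
      fix X Y f x assume X: "X \<in> Obj C" and Y: "Y \<in> Obj C" and f: "f \<in> Hom C X Y"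
        and x: "x \<in> carrier (Grp N X)"
      have fx: "Act N X Y f x \<in> carrier (Grp N Y)" using X Y f x N by simp
      show "\<theta> Y (Act N X Y f x) = Act L X Y f (\<theta> X x)"
      proof (rule sep[OF Y])
        show "almost Y (\<lambda>Z h. Act L Y Z h (\<theta> Y (Act N X Y f x)) = Act L Y Z h (Act L X Y f (\<theta> X x)))"
          using dense[OF Y fx] Y
        proof (rule almost_mono)
          fix Z h assume Z: "Z \<in> Obj C" "h \<in> Hom C Y Z" and "\<exists>l. (Act N Y Z h (Act N X Y f x), l) \<in> R Z"
          then obtain l where l: "(Act N Y Z h (Act N X Y f x), l) \<in> R Z" by blast
          then have "(Act N X Z (Comp C X Y Z h f) x, l) \<in> R Z"
            using X Y Z f x N by (simp add: act_comp)
          from \<theta>(2)[OF X x Z(1) _ this] \<theta>(2)[OF Y fx Z l]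
          show "Act L Y Z h (\<theta> Y (Act N X Y f x)) = Act L Y Z h (Act L X Y f (\<theta> X x))"
            using X Y Z f \<theta>(1)[OF X x] L(1) by (simp add: act_comp)
        qed
      qed (use X Y f x fx \<theta> L(1) in auto)
    qed (auto simp: \<theta>_def)
    fix X x l assume X: "X \<in> Obj C" and xl: "(x, l) \<in> R X"
    have x: "x \<in> carrier (Grp N X)" using R[OF X xl] by simp
    show "\<theta> X x = l"
      \<comment> \<open>The defining property of \<open>\<theta> X x\<close> at the identity arrow
        says that \<open>\<theta>\<close> extends the graph.\<close>
      using \<theta>(2)[OF X x X, of "Ide C X" l] xl X x N L(1) \<theta>(1)[OF X x] by simp
  qed
qed

text \<open>Complements \<open>nat_hom_extension\<close>: a separated target admits at most one
  extension of a map from a dense part.\<close>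

lemma nat_hom_unique:
  assumes N: "is_module C N" and L: "is_module C L" "separated L"
    and \<theta>: "\<theta> \<in> nat_hom C N L" "\<theta>' \<in> nat_hom C N L"
    and dense: "\<And>X x. \<lbrakk>X \<in> Obj C; x \<in> carrier (Grp N X)\<rbrakk>
      \<Longrightarrow> almost X (\<lambda>Y h. \<theta> Y (Act N X Y h x) = \<theta>' Y (Act N X Y h x))"
  shows "\<theta> = \<theta>'"
proof (rule nat_hom_eqI[OF \<theta>])
  fix X x assume X: "X \<in> Obj C" and x: "x \<in> carrier (Grp N X)"
  have "teq L X (\<theta> X x) (\<theta>' X x)"
    unfolding teq_def
    by (rule almost_mono[OF dense[OF X x] X]) (use X x \<theta> in \<open>simp flip: nat_hom_act\<close>)
  then show "\<theta> X x = \<theta>' X x"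
    using L X x \<theta> unfolding separated_def by simp
qed simp

end

locale gabriel_module = gabriel_modules C F
  for C :: "('o, 'm, 'z) preadd_scheme" and F :: "'o \<Rightarrow> ('o \<Rightarrow> 'm set) set" +
  fixes N :: "('o, 'm, 'u) cmod"
  assumes N: "is_module C N"
begin

section \<open>Module of fractions\<close>

text \<open>A fraction is a family of elements indexed by all arrows out of \<open>X\<close>, which is a natural
  homomorphism up to torsion on some ideal in the filter; its values outside are arbitrary. The
  values are taken in \<open>N\<close> instead of its quotient by the torsion submodule.\<close>

definition arrs :: "'o \<Rightarrow> ('o \<times> 'm) set" where
  "arrs X = (SIGMA Y:Obj C. Hom C X Y)"

definition fraction_on :: "'o \<Rightarrow> ('o \<Rightarrow> 'm set) \<Rightarrow> ('o \<times> 'm \<Rightarrow> 'u) \<Rightarrow> bool" where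
  "fraction_on X I f \<longleftrightarrow>
     (\<forall>Y\<in>Obj C. \<forall>h\<in>I Y. \<forall>k\<in>I Y.
        teq N Y (f (Y, Add C X Y h k)) (f (Y, h) \<otimes>\<^bsub>Grp N Y\<^esub> f (Y, k))) \<and>
     (\<forall>Y\<in>Obj C. \<forall>Z\<in>Obj C. \<forall>h\<in>I Y. \<forall>k\<in>Hom C Y Z.
        teq N Z (f (Z, Comp C X Y Z k h)) (Act N Y Z k (f (Y, h))))"

text \<open>Families on all arrows form a group under the pointwise operations at once. Pairs of an
  ideal and a homomorphism on it would not: adding the negative only gives zero on that ideal, and
  inverses would exist only after passing to classes.\<close>

definition fractions :: "('o, 'm, 'o \<times> 'm \<Rightarrow> 'u) cmod" where
  "fractions = \<lparr>
     Grp = (\<lambda>X. (product_group (arrs X) (\<lambda>p. Grp N (fst p)))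
        \<lparr>carrier := {f \<in> \<Pi>\<^sub>E p\<in>arrs X. carrier (Grp N (fst p)). \<exists>I\<in>F X. fraction_on X I f}\<rparr>),
     Act = (\<lambda>X Y k f. \<lambda>p\<in>arrs Y. f (fst p, Comp C X Y (fst p) (snd p) k))\<rparr>"

text \<open>On fractions, the classes of this relation are the elements of the colimit of Hom(I,
  N/t(N)) over the ideals I of the filter at \<open>X\<close>, where t(N) is the torsion
  submodule.\<close>

definition sim :: "'o \<Rightarrow> ('o \<times> 'm \<Rightarrow> 'u) \<Rightarrow> ('o \<times> 'm \<Rightarrow> 'u) \<Rightarrow> bool" where
  "sim X f g \<longleftrightarrow> almost X (\<lambda>Y h. teq N Y (f (Y, h)) (g (Y, h)))"

lemma arrs_iff [simp]: "(Y, h) \<in> arrs X \<longleftrightarrow> Y \<in> Obj C \<and> h \<in> Hom C X Y"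
  by (simp add: arrs_def)

lemma fractions_simps [simp]:
  "f \<in> carrier (Grp fractions X) \<longleftrightarrow>
     f \<in> (\<Pi>\<^sub>E p\<in>arrs X. carrier (Grp N (fst p))) \<and> (\<exists>I\<in>F X. fraction_on X I f)"
  "f \<otimes>\<^bsub>Grp fractions X\<^esub> g = (\<lambda>p\<in>arrs X. f p \<otimes>\<^bsub>Grp N (fst p)\<^esub> g p)"
  "\<one>\<^bsub>Grp fractions X\<^esub> = (\<lambda>p\<in>arrs X. \<one>\<^bsub>Grp N (fst p)\<^esub>)"
  "Act fractions X Y k f = (\<lambda>p\<in>arrs Y. f (fst p, Comp C X Y (fst p) (snd p) k))"
  by (simp_all add: fractions_def)

lemma fraction_closed:
  "\<lbrakk>f \<in> (\<Pi>\<^sub>E p\<in>arrs X. carrier (Grp N (fst p))); Y \<in> Obj C; h \<in> Hom C X Y\<rbrakk> \<Longrightarrow> f (Y, h) \<in> carrier (Grp N Y)"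
  by (drule PiE_mem[of _ _ _ "(Y, h)"]) auto

lemma fraction_add:
  "\<lbrakk>fraction_on X I f; Y \<in> Obj C; h \<in> I Y; k \<in> I Y\<rbrakk>
   \<Longrightarrow> teq N Y (f (Y, Add C X Y h k)) (f (Y, h) \<otimes>\<^bsub>Grp N Y\<^esub> f (Y, k))"
  by (simp add: fraction_on_def)

lemma fraction_act:
  "\<lbrakk>fraction_on X I f; Y \<in> Obj C; Z \<in> Obj C; h \<in> I Y; k \<in> Hom C Y Z\<rbrakk>
   \<Longrightarrow> teq N Z (f (Z, Comp C X Y Z k h)) (Act N Y Z k (f (Y, h)))"
  by (simp add: fraction_on_def)

lemma fraction_on_mult:
  assumes X: "X \<in> Obj C" and I: "I \<in> F X" "J \<in> F X"
    and fc: "f \<in> (\<Pi>\<^sub>E p\<in>arrs X. carrier (Grp N (fst p)))"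
    and gc: "g \<in> (\<Pi>\<^sub>E p\<in>arrs X. carrier (Grp N (fst p)))"
    and f: "fraction_on X I f" and g: "fraction_on X J g"
  shows "fraction_on X (\<lambda>Y. I Y \<inter> J Y) (\<lambda>p\<in>arrs X. f p \<otimes>\<^bsub>Grp N (fst p)\<^esub> g p)"
  unfolding fraction_on_def
proof (intro conjI ballI)
  fix Y h k assume Y: "Y \<in> Obj C" and h: "h \<in> I Y \<inter> J Y" and k: "k \<in> I Y \<inter> J Y"
  have hk: "h \<in> Hom C X Y" "k \<in> Hom C X Y"
    using h k ideal_subset[OF X I(1) Y] by auto
  interpret G: comm_group "Grp N Y" using module_group N Y by blast
  note cl = fraction_closed[OF fc Y] fraction_closed[OF gc Y]
  have "teq N Y (f (Y, Add C X Y h k) \<otimes>\<^bsub>Grp N Y\<^esub> g (Y, Add C X Y h k))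
     ((f (Y, h) \<otimes>\<^bsub>Grp N Y\<^esub> f (Y, k)) \<otimes>\<^bsub>Grp N Y\<^esub> (g (Y, h) \<otimes>\<^bsub>Grp N Y\<^esub> g (Y, k)))"
    using fraction_add[OF f Y] fraction_add[OF g Y] h k hk X Y
    by (intro teq_mult[OF N Y] G.m_closed cl) auto
  then show "teq N Y ((\<lambda>p\<in>arrs X. f p \<otimes>\<^bsub>Grp N (fst p)\<^esub> g p) (Y, Add C X Y h k))
     ((\<lambda>p\<in>arrs X. f p \<otimes>\<^bsub>Grp N (fst p)\<^esub> g p) (Y, h) \<otimes>\<^bsub>Grp N Y\<^esub> (\<lambda>p\<in>arrs X. f p \<otimes>\<^bsub>Grp N (fst p)\<^esub> g p) (Y, k))"
    using X Y hk cl by (simp add: G.m_ac)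
next
  fix Y Z h k assume Y: "Y \<in> Obj C" and Z: "Z \<in> Obj C" and h: "h \<in> I Y \<inter> J Y" and k: "k \<in> Hom C Y Z"
  have hk: "h \<in> Hom C X Y" using h ideal_subset[OF X I(1) Y] by auto
  have "teq N Z (f (Z, Comp C X Y Z k h) \<otimes>\<^bsub>Grp N Z\<^esub> g (Z, Comp C X Y Z k h))
     (Act N Y Z k (f (Y, h)) \<otimes>\<^bsub>Grp N Z\<^esub> Act N Y Z k (g (Y, h)))"
    using fraction_act[OF f Y Z] fraction_act[OF g Y Z] h k hk X Y Z N
    by (intro teq_mult[OF N Z] act_closed fraction_closed[OF fc] fraction_closed[OF gc]) auto
  then show "teq N Z ((\<lambda>p\<in>arrs X. f p \<otimes>\<^bsub>Grp N (fst p)\<^esub> g p) (Z, Comp C X Y Z k h))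
     (Act N Y Z k ((\<lambda>p\<in>arrs X. f p \<otimes>\<^bsub>Grp N (fst p)\<^esub> g p) (Y, h)))"
    using X Y Z hk k N fraction_closed[OF fc Y] fraction_closed[OF gc Y] by (simp add: act_mult)
qed

lemma fraction_on_inv:
  assumes X: "X \<in> Obj C" and I: "I \<in> F X"
    and fc: "f \<in> (\<Pi>\<^sub>E p\<in>arrs X. carrier (Grp N (fst p)))" and f: "fraction_on X I f"
  shows "fraction_on X I (\<lambda>p\<in>arrs X. inv\<^bsub>Grp N (fst p)\<^esub> f p)"
  unfolding fraction_on_def
proof (intro conjI ballI)
  fix Y h k assume Y: "Y \<in> Obj C" and h: "h \<in> I Y" and k: "k \<in> I Y"
  have hk: "h \<in> Hom C X Y" "k \<in> Hom C X Y"
    using h k ideal_subset[OF X I Y] by auto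
  interpret G: comm_group "Grp N Y" using module_group N Y by blast
  have "teq N Y (inv\<^bsub>Grp N Y\<^esub> f (Y, Add C X Y h k)) (inv\<^bsub>Grp N Y\<^esub> (f (Y, h) \<otimes>\<^bsub>Grp N Y\<^esub> f (Y, k)))"
    using fraction_add[OF f Y h k] hk X Y
    by (intro teq_inv[OF N Y] G.m_closed fraction_closed[OF fc]) auto
  then show "teq N Y ((\<lambda>p\<in>arrs X. inv\<^bsub>Grp N (fst p)\<^esub> f p) (Y, Add C X Y h k))
     ((\<lambda>p\<in>arrs X. inv\<^bsub>Grp N (fst p)\<^esub> f p) (Y, h) \<otimes>\<^bsub>Grp N Y\<^esub> (\<lambda>p\<in>arrs X. inv\<^bsub>Grp N (fst p)\<^esub> f p) (Y, k))"
    using X Y hk fraction_closed[OF fc Y] by (simp add: G.inv_mult)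
next
  fix Y Z h k assume Y: "Y \<in> Obj C" and Z: "Z \<in> Obj C" and h: "h \<in> I Y" and k: "k \<in> Hom C Y Z"
  have hk: "h \<in> Hom C X Y" using h ideal_subset[OF X I Y] by auto
  have "teq N Z (inv\<^bsub>Grp N Z\<^esub> f (Z, Comp C X Y Z k h)) (inv\<^bsub>Grp N Z\<^esub> Act N Y Z k (f (Y, h)))"
    using fraction_act[OF f Y Z h k] k hk X Y Z N
    by (intro teq_inv[OF N Z] act_closed fraction_closed[OF fc]) auto
  then show "teq N Z ((\<lambda>p\<in>arrs X. inv\<^bsub>Grp N (fst p)\<^esub> f p) (Z, Comp C X Y Z k h))
     (Act N Y Z k ((\<lambda>p\<in>arrs X. inv\<^bsub>Grp N (fst p)\<^esub> f p) (Y, h)))"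
    using X Y Z hk k N fraction_closed[OF fc Y] by (simp add: act_inv)
qed

text \<open>The homomorphism that Yoneda's lemma assigns to \<open>n\<close>. Its class will be the
  image of \<open>n\<close> in the localization.\<close>

definition const_frac :: "'o \<Rightarrow> 'u \<Rightarrow> 'o \<times> 'm \<Rightarrow> 'u" where
  "const_frac X n = (\<lambda>p\<in>arrs X. Act N X (fst p) (snd p) n)"

lemma const_frac_closed:
  assumes X: "X \<in> Obj C" and n: "n \<in> carrier (Grp N X)"
  shows "const_frac X n \<in> carrier (Grp fractions X)"
proof -
  obtain I where I: "I \<in> F X" using nonempty[OF X] by blast
  have "fraction_on X I (const_frac X n)"
    unfolding fraction_on_def const_frac_def
    using ideal_subset[OF X I] X n N by (simp add: act_add act_comp)
  then show ?thesis
    using I X n N by (auto simp: const_frac_def)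
qed

lemma fractions_group:
  assumes X: "X \<in> Obj C"
  shows "comm_group (Grp fractions X)"
proof -
  let ?P = "product_group (arrs X) (\<lambda>p. Grp N (fst p))"
  have grp: "comm_group (Grp N (fst p))" if "p \<in> arrs X" for p
    using module_group[OF N] that by (cases p) auto
  interpret P: group ?P
    using grp by (intro product_group) (auto simp: comm_group_def)
  have "subgroup (carrier (Grp fractions X)) ?P"
  proof (rule P.subgroupI)
    show "carrier (Grp fractions X) \<subseteq> carrier ?P" by (auto simp: fractions_def)
    show "carrier (Grp fractions X) \<noteq> {}"
      using const_frac_closed[OF X module_one_closed[OF N X]] by blast
  next
    fix f assume "f \<in> carrier (Grp fractions X)"
    then obtain I where I: "I \<in> F X" "f \<in> (\<Pi>\<^sub>E p\<in>arrs X. carrier (Grp N (fst p)))" "fraction_on X I f"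
      by auto
    have "inv\<^bsub>?P\<^esub> f = (\<lambda>p\<in>arrs X. inv\<^bsub>Grp N (fst p)\<^esub> f p)"
      using grp I(2) by (intro inv_product_group) (auto simp: comm_group_def)
    moreover have "(\<lambda>p\<in>arrs X. inv\<^bsub>Grp N (fst p)\<^esub> f p) \<in> (\<Pi>\<^sub>E p\<in>arrs X. carrier (Grp N (fst p)))"
      using grp I(2) by (auto simp: comm_group_def PiE_iff intro!: group.inv_closed)
    ultimately show "inv\<^bsub>?P\<^esub> f \<in> carrier (Grp fractions X)"
      using fraction_on_inv[OF X I] I(1) by auto
  next
    fix f g assume "f \<in> carrier (Grp fractions X)" "g \<in> carrier (Grp fractions X)"
    then obtain I J where I: "I \<in> F X" "J \<in> F X"
      and f: "f \<in> (\<Pi>\<^sub>E p\<in>arrs X. carrier (Grp N (fst p)))" "g \<in> (\<Pi>\<^sub>E p\<in>arrs X. carrier (Grp N (fst p)))"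
        "fraction_on X I f" "fraction_on X J g"
      by auto
    have "(\<lambda>p\<in>arrs X. f p \<otimes>\<^bsub>Grp N (fst p)\<^esub> g p) \<in> (\<Pi>\<^sub>E p\<in>arrs X. carrier (Grp N (fst p)))"
      using grp f(1,2) by (auto simp: comm_group_def PiE_iff intro!: monoid.m_closed group.is_monoid)
    then show "f \<otimes>\<^bsub>?P\<^esub> g \<in> carrier (Grp fractions X)"
      using fraction_on_mult[OF X I f] T2[OF X I] by auto
  qed
  from subgroup.subgroup_is_group[OF this P.is_group]
  interpret G: group "Grp fractions X"
    by (simp add: fractions_def)
  show ?thesis
  proof (rule G.group_comm_groupI)
    fix f g assume "f \<in> carrier (Grp fractions X)" "g \<in> carrier (Grp fractions X)"
    then have "f p \<otimes>\<^bsub>Grp N (fst p)\<^esub> g p = g p \<otimes>\<^bsub>Grp N (fst p)\<^esub> f p" if "p \<in> arrs X" for p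
      using comm_groupE(4)[OF grp[OF that]] that by (auto simp: PiE_iff)
    then show "f \<otimes>\<^bsub>Grp fractions X\<^esub> g = g \<otimes>\<^bsub>Grp fractions X\<^esub> f"
      by (auto simp: restrict_def fun_eq_iff)
  qed
qed

lemma fractions_act_closed:
  assumes X: "X \<in> Obj C" and Y: "Y \<in> Obj C" and k: "k \<in> Hom C X Y"
    and f: "f \<in> carrier (Grp fractions X)"
  shows "Act fractions X Y k f \<in> carrier (Grp fractions Y)"
proof -
  obtain I where I: "I \<in> F X" "fraction_on X I f" and fc: "f \<in> (\<Pi>\<^sub>E p\<in>arrs X. carrier (Grp N (fst p)))"
    using f by auto
  have J: "colon C I X Y k \<in> F Y" using T3 X Y k I by blast
  have "fraction_on Y (colon C I X Y k) (Act fractions X Y k f)"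
    unfolding fraction_on_def using I(2) X Y k
    by (auto simp: colon_def fraction_on_def comp_add_left simp flip: comp_assoc)
  moreover have "Act fractions X Y k f \<in> (\<Pi>\<^sub>E p\<in>arrs Y. carrier (Grp N (fst p)))"
    using fraction_closed[OF fc] X Y k by auto
  ultimately show ?thesis using J by auto
qed

section \<open>Fractions modulo equality up to torsion almost everywhere\<close>

lemma sim_refl [simp]: "X \<in> Obj C \<Longrightarrow> sim X f f"
  unfolding sim_def by (rule almost_all) auto

lemma sim_sym: "\<lbrakk>sim X f g; X \<in> Obj C\<rbrakk> \<Longrightarrow> sim X g f"
  unfolding sim_def by (erule almost_mono) (auto intro: teq_sym)

lemma sim_trans: "\<lbrakk>sim X f g; sim X g h; X \<in> Obj C\<rbrakk> \<Longrightarrow> sim X f h"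
  unfolding sim_def by (erule (1) almost_mono2) (auto intro: teq_trans)

lemma sim_mult:
  assumes "X \<in> Obj C" "f \<in> carrier (Grp fractions X)" "g \<in> carrier (Grp fractions X)"
    "f' \<in> carrier (Grp fractions X)" "g' \<in> carrier (Grp fractions X)" "sim X f f'" "sim X g g'"
  shows "sim X (f \<otimes>\<^bsub>Grp fractions X\<^esub> g) (f' \<otimes>\<^bsub>Grp fractions X\<^esub> g')"
  using assms(6,7,1) unfolding sim_def
proof (rule almost_mono2)
  fix Y h assume "Y \<in> Obj C" "h \<in> Hom C X Y" "teq N Y (f (Y, h)) (f' (Y, h))" "teq N Y (g (Y, h)) (g' (Y, h))"
  then show "teq N Y ((f \<otimes>\<^bsub>Grp fractions X\<^esub> g) (Y, h)) ((f' \<otimes>\<^bsub>Grp fractions X\<^esub> g') (Y, h))"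
    using assms(1-5) fraction_closed[of f X] fraction_closed[of g X] fraction_closed[of f' X]
      fraction_closed[of g' X] teq_mult[OF N] by simp
qed

lemma sim_act:
  assumes "X \<in> Obj C" "Y \<in> Obj C" "k \<in> Hom C X Y" "sim X f g"
  shows "sim Y (Act fractions X Y k f) (Act fractions X Y k g)"
  unfolding sim_def
  by (rule almost_mono[OF almost_colon[OF assms(4)[unfolded sim_def] assms(1-3)]]) (use assms in auto)

lemma sim_restrict:
  assumes "X \<in> Obj C" "\<And>Y h. \<lbrakk>Y \<in> Obj C; h \<in> Hom C X Y\<rbrakk> \<Longrightarrow> f (Y, h) = g (Y, h)"
  shows "sim X f g"
  unfolding sim_def by (rule almost_all) (use assms in auto)

text \<open>Here equality cannot be expected: \<open>f\<close> is additive only up to torsion and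
  only on an ideal. This is the reason why \<open>is_module_image\<close> asks for the module laws
  after \<open>\<pi>\<close>.\<close>

lemma fractions_additive:
  assumes X: "X \<in> Obj C" and Y: "Y \<in> Obj C" and k: "k \<in> Hom C X Y" "k' \<in> Hom C X Y"
    and f: "f \<in> carrier (Grp fractions X)"
  shows "sim Y (Act fractions X Y (Add C X Y k k') f)
    (Act fractions X Y k f \<otimes>\<^bsub>Grp fractions Y\<^esub> Act fractions X Y k' f)"
proof -
  obtain I where I: "I \<in> F X" "fraction_on X I f"
    using f by auto
  have J: "(\<lambda>Z. colon C I X Y k Z \<inter> colon C I X Y k' Z) \<in> F Y" using T2 T3 X Y k I by blast
  show ?thesis
    unfolding sim_def almost_def
    by (rule bexI[OF _ J])
      (use I(2) X Y k in \<open>auto simp: colon_def comp_add_right intro: fraction_add\<close>)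
qed

text \<open>Naturality gives \<open>f(k h) = k f(h)\<close> up to torsion for every
  \<open>k\<close>. So arrows of the domain turn a fraction into a constant one, which makes the
  image of \<open>N\<close> dense in the localization.\<close>

lemma fraction_value:
  assumes X: "X \<in> Obj C" and I: "I \<in> F X" "fraction_on X I f"
    and Y: "Y \<in> Obj C" and h: "h \<in> I Y"
  shows "sim Y (Act fractions X Y h f) (const_frac Y (f (Y, h)))"
  unfolding sim_def
  by (rule almost_all) (use fraction_act[OF I(2) Y] h Y in \<open>auto simp: const_frac_def\<close>)

text \<open>Only torsion is killed by the map from \<open>N\<close> to classes of fractions: the
  assumption gives \<open>teq\<close> after almost every arrow, and \<open>teq_local\<close> removes
  the arrow.\<close>

lemma sim_const_frac:
  assumes "X \<in> Obj C" "m \<in> carrier (Grp N X)" "n \<in> carrier (Grp N X)"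
  shows "sim X (const_frac X m) (const_frac X n) \<longleftrightarrow> teq N X m n"
proof
  assume *: "sim X (const_frac X m) (const_frac X n)"
  show "teq N X m n"
    by (rule teq_local[OF N assms])
      (rule almost_mono[OF *[unfolded sim_def]], use assms in \<open>auto simp: const_frac_def\<close>)
next
  assume *: "teq N X m n"
  show "sim X (const_frac X m) (const_frac X n)"
    unfolding sim_def
    by (rule almost_mono[OF *[unfolded teq_def]]) (use assms in \<open>auto simp: const_frac_def\<close>)
qed

lemma const_frac_mult:
  assumes "X \<in> Obj C" "m \<in> carrier (Grp N X)" "n \<in> carrier (Grp N X)"
  shows "const_frac X (m \<otimes>\<^bsub>Grp N X\<^esub> n) = const_frac X m \<otimes>\<^bsub>Grp fractions X\<^esub> const_frac X n"
  using assms N by (auto simp: const_frac_def act_mult intro!: restrict_ext)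

lemma const_frac_act:
  assumes "X \<in> Obj C" "Y \<in> Obj C" "k \<in> Hom C X Y" "n \<in> carrier (Grp N X)"
  shows "const_frac Y (Act N X Y k n) = Act fractions X Y k (const_frac X n)"
  using assms N by (auto simp: const_frac_def act_comp intro!: restrict_ext)

section \<open>The module of fractions fits into the universe\<close>

text \<open>The code of a fraction consists of its values on the arrows to a skeleton, indexed by \<open>J\<close>; only one
  implication holds, as similar fractions may have different values.\<close>

lemma fraction_encoding:
  assumes small: "skeletally_small J C" and U: "universe J U"
    and NU: "\<And>X. X \<in> Obj C \<Longrightarrow> carrier (Grp N X) \<in> U" and X: "X \<in> Obj C"
  shows "\<exists>e. e ` carrier (Grp fractions X) \<in> U \<and>
    (\<forall>f\<in>carrier (Grp fractions X). \<forall>g\<in>carrier (Grp fractions X). e f = e g \<longrightarrow> sim X f g)"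
proof -
  obtain S where S: "S \<subseteq> Obj C" "\<And>X. X \<in> Obj C \<Longrightarrow> \<exists>Y\<in>S. \<exists>f. iso_arrow C X Y f" "arrows C S \<lesssim> J"
    using small by (auto simp: skeletally_small_def)
  obtain c where c: "inj_on c (arrows C S)" "c ` arrows C S \<subseteq> J"
    using S(3) by (auto simp: lepoll_def)
  \<comment> \<open>\<open>X\<close> need not belong to the skeleton, so arrows out of
    \<open>X\<close> are traded for arrows out of an isomorphic object \<open>X0\<close>.\<close>
  obtain X0 u v where X0: "X0 \<in> S" and u: "u \<in> Hom C X X0" and v: "v \<in> Hom C X0 X"
    and vu: "Comp C X X0 X v u = Ide C X"
    using S(2)[OF X] by (auto simp: iso_arrow_def)
  \<comment> \<open>The closure condition of \<open>universe\<close> requires a family indexed by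
    all of \<open>J\<close>; an index that codes no arrow receives the carrier at \<open>X\<close>
    as a dummy.\<close>
  define V where "V j = (if j \<in> c ` arrows C S then carrier (Grp N (fst (snd (inv_into (arrows C S) c j))))
      else carrier (Grp N X))" for j
  have V_c: "V (c (W, Y, g)) = carrier (Grp N Y)" if "(W, Y, g) \<in> arrows C S" for W Y g
    using that c(1) by (simp add: V_def)
  have V_U: "V j \<in> U" for j
  proof (cases "j \<in> c ` arrows C S")
    case True
    then obtain W Y g where "(W, Y, g) \<in> arrows C S" "j = c (W, Y, g)" by auto
    then show ?thesis using V_c NU S(1) by (auto simp: arrows_def)
  qed (use NU X in \<open>simp add: V_def\<close>)
  obtain B where B: "B \<in> U" "(\<Pi>\<^sub>E j\<in>J. V j) \<lesssim> B"
    using U V_U unfolding universe_def by blast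
  \<comment> \<open>\<open>E\<close> brings the tuples back into the type \<open>'u\<close> and into
    a member of \<open>U\<close>.\<close>
  obtain E where E: "inj_on E (\<Pi>\<^sub>E j\<in>J. V j)" "E ` (\<Pi>\<^sub>E j\<in>J. V j) \<subseteq> B"
    using B(2) by (auto simp: lepoll_def)
  \<comment> \<open>The entry at \<open>(X0, Y, g)\<close> is the value of \<open>f\<close> at
    \<open>g \<circ> u\<close>. All other entries are filled with units, which belong to every
    carrier.\<close>
  define tup where "tup f = (\<lambda>j\<in>J. if j \<in> c ` arrows C S
     then (case inv_into (arrows C S) c j of (W, Y, g) \<Rightarrow>
        if W = X0 then f (Y, Comp C X X0 Y g u) else \<one>\<^bsub>Grp N Y\<^esub>)
     else \<one>\<^bsub>Grp N X\<^esub>)" for f :: "'o \<times> 'm \<Rightarrow> 'u"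
  have tup: "tup f \<in> (\<Pi>\<^sub>E j\<in>J. V j)" if f: "f \<in> (\<Pi>\<^sub>E p\<in>arrs X. carrier (Grp N (fst p)))" for f
  proof
    fix j assume j: "j \<in> J"
    show "tup f j \<in> V j"
    proof (cases "j \<in> c ` arrows C S")
      case True
      then obtain W Y g where *: "(W, Y, g) \<in> arrows C S" "j = c (W, Y, g)" by auto
      have **: "Y \<in> Obj C" "W \<in> Obj C" "g \<in> Hom C W Y"
        using *(1) S(1) by (auto simp: arrows_def)
      show ?thesis
        using j True c(1) * ** X u N by (auto simp: tup_def V_c intro!: fraction_closed[OF f])
    qed (use j X N in \<open>simp add: tup_def V_def\<close>)
  qed (simp add: tup_def)
  have val: "f (Y, h) = g (Y, h)"
    if eq: "tup f = tup g" and Y: "Y \<in> S" and h: "h \<in> Hom C X Y" for f g Y h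
  proof -
    have Obj: "Y \<in> Obj C" "X0 \<in> Obj C" using Y X0 S(1) by auto
    \<comment> \<open>As \<open>v \<circ> u\<close> is the identity, the entry at
      \<open>h \<circ> v\<close> is the value at \<open>h\<close>. So the tuple knows the values on
      all arrows from \<open>X\<close> into the skeleton.\<close>
    let ?k = "Comp C X0 X Y h v"
    have k: "Comp C X X0 Y ?k u = h"
      using comp_assoc[of X X0 X Y u v h] vu Obj X u v h by simp
    have "(X0, Y, ?k) \<in> arrows C S"
      using X0 Y Obj X v h by (simp add: arrows_def)
    then show ?thesis
      using fun_cong[OF eq, of "c (X0, Y, ?k)"] c k by (auto simp: tup_def image_subset_iff)
  qed
  have "sim X f g"
    if f: "f \<in> carrier (Grp fractions X)" and g: "g \<in> carrier (Grp fractions X)" and eq: "tup f = tup g"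
    for f g
  proof -
    obtain I where I: "I \<in> F X" "fraction_on X I f" and fc: "f \<in> (\<Pi>\<^sub>E p\<in>arrs X. carrier (Grp N (fst p)))"
      using f by auto
    obtain K where K: "K \<in> F X" "fraction_on X K g" and gc: "g \<in> (\<Pi>\<^sub>E p\<in>arrs X. carrier (Grp N (fst p)))"
      using g by auto
    \<comment> \<open>For a target \<open>Z\<close> outside the skeleton, the value is determined up
      to torsion: on the domain of \<open>f\<close>, naturality gives
      \<open>f(h) = w' f(w h)\<close> up to torsion, and \<open>w \<circ> h\<close> ends in the
      skeleton.\<close>
    have "teq N Z (f (Z, h)) (g (Z, h))" if Z: "Z \<in> Obj C" and h: "h \<in> I Z \<inter> K Z" for Z h
    proof -
      obtain Y w w' where Y: "Y \<in> S" and w: "w \<in> Hom C Z Y" "w' \<in> Hom C Y Z"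
        and w'w: "Comp C Z Y Z w' w = Ide C Z"
        using S(2)[OF Z] by (auto simp: iso_arrow_def)
      have YO: "Y \<in> Obj C" using Y S by auto
      have h': "h \<in> Hom C X Z" using ideal_subset[OF X I(1) Z] h by auto
      let ?wh = "Comp C X Z Y w h"
      have wh: "?wh \<in> I Y" "?wh \<in> K Y"
        using ideal_comp[OF X _ Z YO _ w(1)] h I(1) K(1) by auto
      have wwh: "Comp C X Y Z w' ?wh = h"
        using comp_assoc[of X Z Y Z h w w'] X Z YO w h' w'w by simp
      have "teq N Z (f (Z, h)) (Act N Y Z w' (f (Y, ?wh)))"
        using fraction_act[OF I(2) YO Z wh(1) w(2)] by (simp add: wwh)
      moreover have "teq N Z (g (Z, h)) (Act N Y Z w' (g (Y, ?wh)))"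
        using fraction_act[OF K(2) YO Z wh(2) w(2)] by (simp add: wwh)
      moreover have "f (Y, ?wh) = g (Y, ?wh)"
        using val[OF eq Y] X Z YO w h' by simp
      ultimately show ?thesis
        using teq_trans[OF Z] teq_sym by metis
    qed
    then show ?thesis
      unfolding sim_def almost_def using T2[OF X I(1) K(1)] by (intro bexI[where x = "\<lambda>Z. I Z \<inter> K Z"]) auto
  qed
  moreover have "tup f = tup g" if "f \<in> carrier (Grp fractions X)" "g \<in> carrier (Grp fractions X)"
    "E (tup f) = E (tup g)" for f g
    using inj_onD[OF E(1), of "tup f" "tup g"] tup that by simp
  moreover have "(\<lambda>f. E (tup f)) ` carrier (Grp fractions X) \<in> U"
  proof -
    have "(\<lambda>f. E (tup f)) ` carrier (Grp fractions X) \<subseteq> B"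
      using E(2) tup by auto
    then show ?thesis
      using U B(1) subset_imp_lepoll unfolding universe_def by blast
  qed
  ultimately show ?thesis
    by (intro exI[of _ "\<lambda>f. E (tup f)"]) blast
qed


section \<open>Localization\<close>

text \<open>Sets of fractions as elements of the quotient would leave the type \<open>'u\<close>.
  The classes are represented by codes instead, so that the quotient becomes an object of the module
  category over \<open>U\<close>.\<close>

lemma fraction_quotient:
  assumes small: "skeletally_small J C" and U: "universe J U"
    and NU: "\<And>X. X \<in> Obj C \<Longrightarrow> carrier (Grp N X) \<in> U"
  obtains L :: "('o, 'm, 'u) cmod" and \<pi> where "is_module C L"
    "\<And>X. X \<in> Obj C \<Longrightarrow> carrier (Grp L X) \<in> U"
    "\<And>X. X \<in> Obj C \<Longrightarrow> \<pi> X ` carrier (Grp fractions X) = carrier (Grp L X)"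
    "\<And>X f g. \<lbrakk>X \<in> Obj C; f \<in> carrier (Grp fractions X); g \<in> carrier (Grp fractions X)\<rbrakk>
       \<Longrightarrow> \<pi> X (f \<otimes>\<^bsub>Grp fractions X\<^esub> g) = \<pi> X f \<otimes>\<^bsub>Grp L X\<^esub> \<pi> X g"
    "\<And>X Y k f. \<lbrakk>X \<in> Obj C; Y \<in> Obj C; k \<in> Hom C X Y; f \<in> carrier (Grp fractions X)\<rbrakk>
       \<Longrightarrow> Act L X Y k (\<pi> X f) = \<pi> Y (Act fractions X Y k f)"
    "\<And>X f g. \<lbrakk>X \<in> Obj C; f \<in> carrier (Grp fractions X); g \<in> carrier (Grp fractions X)\<rbrakk>
       \<Longrightarrow> \<pi> X f = \<pi> X g \<longleftrightarrow> sim X f g"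
proof -
  let ?A = "\<lambda>X. carrier (Grp fractions X)"
  have "\<forall>X. \<exists>e. X \<in> Obj C \<longrightarrow> e ` ?A X \<in> U \<and> (\<forall>f\<in>?A X. \<forall>g\<in>?A X. e f = e g \<longrightarrow> sim X f g)"
    using fraction_encoding[OF small U NU] by blast
  then obtain e where e: "\<And>X. X \<in> Obj C \<Longrightarrow> e X ` ?A X \<in> U"
    "\<And>X f g. \<lbrakk>X \<in> Obj C; f \<in> ?A X; g \<in> ?A X; e X f = e X g\<rbrakk> \<Longrightarrow> sim X f g"
    by metis
  \<comment> \<open>The code \<open>e\<close> is not constant on the classes of \<open>sim\<close>, so it is taken at a chosen representative.\<close>
  define r where "r X f = (SOME g. g \<in> ?A X \<and> sim X f g)" for X f
  have r: "r X f \<in> ?A X" "sim X f (r X f)" if "X \<in> Obj C" "f \<in> ?A X" for X f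
    using someI[of "\<lambda>g. g \<in> ?A X \<and> sim X f g" f] that sim_refl[OF that(1)] unfolding r_def by blast+
  define \<pi> where "\<pi> X f = e X (r X f)" for X f
  have \<pi>: "\<pi> X f = \<pi> X g \<longleftrightarrow> sim X f g" if "X \<in> Obj C" "f \<in> ?A X" "g \<in> ?A X" for X f g
  proof
    assume "\<pi> X f = \<pi> X g"
    then have "sim X (r X f) (r X g)" using e(2) r that by (simp add: \<pi>_def)
    then show "sim X f g" using sim_trans[OF r(2)[OF that(1,2)]] sim_trans[OF _ sim_sym[OF r(2)[OF that(1,3)]]] that(1) by blast
  next
    assume "sim X f g"
    then have "sim X f k \<longleftrightarrow> sim X g k" for k
      using sim_trans[of X f g k] sim_trans[of X g f k] sim_sym[of X f g] that(1) by blast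
    then show "\<pi> X f = \<pi> X g" by (simp add: \<pi>_def r_def)
  qed
  define s where "s X a = inv_into (?A X) (\<pi> X) a" for X a
  have s: "s X (\<pi> X f) \<in> ?A X" "sim X (s X (\<pi> X f)) f" if "X \<in> Obj C" "f \<in> ?A X" for X f
  proof -
    show *: "s X (\<pi> X f) \<in> ?A X" unfolding s_def using inv_into_into[of "\<pi> X f" "\<pi> X"] that by blast
    have "\<pi> X (s X (\<pi> X f)) = \<pi> X f"
      unfolding s_def by (rule f_inv_into_f[OF imageI[OF that(2)]])
    then show "sim X (s X (\<pi> X f)) f" using \<pi> that * by blast
  qed
  define L :: "('o, 'm, 'u) cmod" where "L = \<lparr>
    Grp = (\<lambda>X. \<lparr>carrier = \<pi> X ` ?A X,
       monoid.mult = (\<lambda>a b. \<pi> X (s X a \<otimes>\<^bsub>Grp fractions X\<^esub> s X b)),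
       one = \<pi> X \<one>\<^bsub>Grp fractions X\<^esub>\<rparr>),
    Act = (\<lambda>X Y k a. \<pi> Y (Act fractions X Y k (s X a)))\<rparr>"
  have mcl: "f \<otimes>\<^bsub>Grp fractions X\<^esub> g \<in> ?A X" if "X \<in> Obj C" "f \<in> ?A X" "g \<in> ?A X" for X f g
    using monoid.m_closed[OF group.is_monoid[OF comm_group.axioms(2)[OF fractions_group[OF that(1)]]] that(2,3)] .
  have mult: "\<pi> X (f \<otimes>\<^bsub>Grp fractions X\<^esub> g) = \<pi> X f \<otimes>\<^bsub>Grp L X\<^esub> \<pi> X g"
    if X: "X \<in> Obj C" and f: "f \<in> ?A X" and g: "g \<in> ?A X" for X f g
  proof -
    have "sim X (f \<otimes>\<^bsub>Grp fractions X\<^esub> g) (s X (\<pi> X f) \<otimes>\<^bsub>Grp fractions X\<^esub> s X (\<pi> X g))"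
      by (rule sim_mult[OF X f g s(1)[OF X f] s(1)[OF X g] sim_sym[OF s(2)[OF X f] X]
            sim_sym[OF s(2)[OF X g] X]])
    then have "\<pi> X (f \<otimes>\<^bsub>Grp fractions X\<^esub> g) = \<pi> X (s X (\<pi> X f) \<otimes>\<^bsub>Grp fractions X\<^esub> s X (\<pi> X g))"
      using \<pi>[OF X mcl[OF X f g] mcl[OF X s(1)[OF X f] s(1)[OF X g]]] by blast
    then show ?thesis by (simp add: L_def del: fractions_simps)
  qed
  have act: "Act L X Y k (\<pi> X f) = \<pi> Y (Act fractions X Y k f)"
    if X: "X \<in> Obj C" and Y: "Y \<in> Obj C" and k: "k \<in> Hom C X Y" and f: "f \<in> ?A X" for X Y k f
  proof -
    have "sim Y (Act fractions X Y k (s X (\<pi> X f))) (Act fractions X Y k f)"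
      using s(2)[OF X f] by (rule sim_act[OF X Y k])
    then show ?thesis
      using \<pi>[OF Y] fractions_act_closed[OF X Y k] f s(1)[OF X f]
      by (simp add: L_def del: fractions_simps)
  qed
  have "is_module C L"
  proof (rule is_module_image[of fractions \<pi>], goal_cases)
    case 1 then show ?case by (rule fractions_group)
  next
    case 2 then show ?case by (simp add: L_def)
  next
    case 3 then show ?case by (rule mult)
  next
    case 4 then show ?case by (simp add: L_def)
  next
    case 5 then show ?case by (rule fractions_act_closed)
  next
    case 6 then show ?case by (rule act)
  next
    case (7 X Y k f g)
    then have "Act fractions X Y k (f \<otimes>\<^bsub>Grp fractions X\<^esub> g) =
      Act fractions X Y k f \<otimes>\<^bsub>Grp fractions Y\<^esub> Act fractions X Y k g"
      by (auto intro!: restrict_ext)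
    then show ?case by (rule arg_cong)
  next
    case (8 X f)
    have "Act fractions X X (Ide C X) f \<in> ?A X"
      using 8 by (intro fractions_act_closed) auto
    then show ?case
      using \<pi>[OF 8(1) _ 8(2)] 8 by (auto intro!: sim_restrict)
  next
    case (9 X Y Z k k' f)
    then have "Act fractions X Z (Comp C X Y Z k' k) f = Act fractions Y Z k' (Act fractions X Y k f)"
      by (auto intro!: restrict_ext simp: comp_assoc)
    then show ?case by (rule arg_cong)
  next
    case (10 X Y k k' f)
    then show ?case
      using fractions_additive[OF 10] fractions_act_closed mcl[of Y] \<pi>[of Y]
      by (simp del: fractions_simps)
  qed
  moreover have "carrier (Grp L X) \<in> U" if X: "X \<in> Obj C" for X
  proof -
    have "carrier (Grp L X) \<subseteq> e X ` ?A X"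
      using r[OF X] by (auto simp: L_def \<pi>_def simp del: fractions_simps)
    then show ?thesis
      using e(1)[OF X] U subset_imp_lepoll unfolding universe_def by blast
  qed
  moreover have "\<pi> X ` ?A X = carrier (Grp L X)" if "X \<in> Obj C" for X
    by (simp add: L_def)
  ultimately show thesis
    by (rule that[OF _ _ _ mult act \<pi>])
qed

text \<open>An arrow in the domain of a fraction carries its class to the image of its value.
  Density is immediate from this, separatedness holds because classes are determined by their values
  up to torsion, and for gluing the values of the given homomorphism are lifted to
  \<open>N\<close>.\<close>

lemma localization_exists:
  assumes "skeletally_small J C" "universe J U"
    and "\<And>X. X \<in> Obj C \<Longrightarrow> carrier (Grp N X) \<in> U"
  obtains L :: "('o, 'm, 'u) cmod" and \<l> where "is_module C L"
    "\<And>X. X \<in> Obj C \<Longrightarrow> carrier (Grp L X) \<in> U" "separated L" "gluing L" "\<l> \<in> nat_hom C N L"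
    "\<And>X x y. \<lbrakk>X \<in> Obj C; x \<in> carrier (Grp N X); y \<in> carrier (Grp N X); \<l> X x = \<l> X y\<rbrakk> \<Longrightarrow> teq N X x y"
    "\<And>X a. \<lbrakk>X \<in> Obj C; a \<in> carrier (Grp L X)\<rbrakk>
      \<Longrightarrow> almost X (\<lambda>Y h. Act L X Y h a \<in> \<l> Y ` carrier (Grp N Y))"
proof (rule fraction_quotient[OF assms])
  let ?A = "\<lambda>X. carrier (Grp fractions X)"
  fix L :: "('o, 'm, 'u) cmod" and \<pi>
  assume L: "is_module C L"
    and LU: "\<And>X. X \<in> Obj C \<Longrightarrow> carrier (Grp L X) \<in> U"
    and surj: "\<And>X. X \<in> Obj C \<Longrightarrow> \<pi> X ` ?A X = carrier (Grp L X)"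
    and mult: "\<And>X f g. \<lbrakk>X \<in> Obj C; f \<in> ?A X; g \<in> ?A X\<rbrakk>
       \<Longrightarrow> \<pi> X (f \<otimes>\<^bsub>Grp fractions X\<^esub> g) = \<pi> X f \<otimes>\<^bsub>Grp L X\<^esub> \<pi> X g"
    and act: "\<And>X Y k f. \<lbrakk>X \<in> Obj C; Y \<in> Obj C; k \<in> Hom C X Y; f \<in> ?A X\<rbrakk>
       \<Longrightarrow> Act L X Y k (\<pi> X f) = \<pi> Y (Act fractions X Y k f)"
    and eq: "\<And>X f g. \<lbrakk>X \<in> Obj C; f \<in> ?A X; g \<in> ?A X\<rbrakk> \<Longrightarrow> \<pi> X f = \<pi> X g \<longleftrightarrow> sim X f g"
  define \<l> where "\<l> = (\<lambda>X\<in>Obj C. \<lambda>n\<in>carrier (Grp N X). \<pi> X (const_frac X n))"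
  have \<l>_eq: "\<l> X x = \<l> X y \<longleftrightarrow> teq N X x y"
    if "X \<in> Obj C" "x \<in> carrier (Grp N X)" "y \<in> carrier (Grp N X)" for X x y
    using that eq const_frac_closed sim_const_frac by (simp add: \<l>_def del: fractions_simps)
  have \<l>: "\<l> \<in> nat_hom C N L"
  proof (rule nat_homI)
    fix X assume X: "X \<in> Obj C"
    show "\<l> X \<in> hom (Grp N X) (Grp L X)"
      using X surj[OF X] const_frac_closed[OF X] mult[OF X] N
      by (auto simp: hom_def \<l>_def const_frac_mult simp del: fractions_simps)
  next
    fix X Y k x assume "X \<in> Obj C" "Y \<in> Obj C" "k \<in> Hom C X Y" "x \<in> carrier (Grp N X)"
    then show "\<l> Y (Act N X Y k x) = Act L X Y k (\<l> X x)"
      using N const_frac_closed by (simp add: \<l>_def act const_frac_act del: fractions_simps)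
  qed (auto simp: \<l>_def)
  have act_value: "Act L X Y h (\<pi> X f) = \<l> Y (f (Y, h))"
    if X: "X \<in> Obj C" and f: "f \<in> ?A X" and I: "I \<in> F X" "fraction_on X I f"
      and Y: "Y \<in> Obj C" and h: "h \<in> I Y" for X Y f I h
  proof -
    have h': "h \<in> Hom C X Y" using ideal_subset[OF X I(1) Y h] .
    have "f (Y, h) \<in> carrier (Grp N Y)" using f fraction_closed[of f X Y h] Y h' by simp
    then show ?thesis
      using fraction_value[OF X I Y h] eq[OF Y fractions_act_closed[OF X Y h' f]]
        const_frac_closed[OF Y] act[OF X Y h' f] Y by (simp add: \<l>_def del: fractions_simps)
  qed
  have frac: "\<exists>f I. a = \<pi> X f \<and> f \<in> ?A X \<and> I \<in> F X \<and> fraction_on X I f"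
    if "X \<in> Obj C" "a \<in> carrier (Grp L X)" for X a
    using surj[OF that(1)] that(2) by force
  have dense: "almost X (\<lambda>Y h. Act L X Y h a \<in> \<l> Y ` carrier (Grp N Y))"
    if X: "X \<in> Obj C" and a: "a \<in> carrier (Grp L X)" for X a
  proof -
    obtain f I where f: "a = \<pi> X f" "f \<in> ?A X" and I: "I \<in> F X" "fraction_on X I f"
      using frac[OF X a] by blast
    show ?thesis
      unfolding almost_def
      using act_value[OF X f(2) I] ideal_subset[OF X I(1)] fraction_closed[of f X] f
      by (intro bexI[OF _ I(1)]) (auto intro!: imageI)
  qed
  have sep: "separated L"
    unfolding separated_def
  proof (intro ballI impI)
    fix X a b assume X: "X \<in> Obj C" and a: "a \<in> carrier (Grp L X)" and b: "b \<in> carrier (Grp L X)"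
      and ab: "teq L X a b"
    obtain f I where f: "a = \<pi> X f" "f \<in> ?A X" and I: "I \<in> F X" "fraction_on X I f"
      using frac[OF X a] by blast
    obtain g K where g: "b = \<pi> X g" "g \<in> ?A X" and K: "K \<in> F X" "fraction_on X K g"
      using frac[OF X b] by blast
    obtain H where H: "H \<in> F X" "\<And>Y h. Y \<in> Obj C \<Longrightarrow> h \<in> H Y \<Longrightarrow> Act L X Y h a = Act L X Y h b"
      using ab by (auto simp: teq_def almost_def)
    have "sim X f g"
      unfolding sim_def almost_def
    proof (intro bexI ballI)
      show "(\<lambda>Z. (I Z \<inter> K Z) \<inter> H Z) \<in> F X" using T2 X I K H by blast
      fix Y h assume Y: "Y \<in> Obj C" and h: "h \<in> (I Y \<inter> K Y) \<inter> H Y"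
      have "\<l> Y (f (Y, h)) = \<l> Y (g (Y, h))"
        using act_value[OF X f(2) I Y, of h] act_value[OF X g(2) K Y, of h] H(2)[OF Y, of h] h
        by (simp add: f(1) g(1))
      then show "teq N Y (f (Y, h)) (g (Y, h))"
        using \<l>_eq[OF Y] fraction_closed[of f X Y h] fraction_closed[of g X Y h] f g Y h
          ideal_subset[OF X I(1) Y] by auto
    qed
    then show "a = b" using eq X f g by blast
  qed
  have glue: "gluing L"
    unfolding gluing_def
  proof (intro ballI)
    fix X I \<phi> assume X: "X \<in> Obj C" and I: "I \<in> F X"
      and \<phi>: "\<phi> \<in> nat_hom C (sub_mod (representable C X) I) L"
    note h = ideal_subset[OF X I]
    have \<phi>cl: "\<phi> Y h \<in> carrier (Grp L Y)" if "Y \<in> Obj C" "h \<in> I Y" for Y h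
      using nat_hom_closed[OF \<phi>] that by simp
    have \<phi>act: "\<phi> Z (Comp C X Y Z k h) = Act L Y Z k (\<phi> Y h)"
      if "Y \<in> Obj C" "Z \<in> Obj C" "h \<in> I Y" "k \<in> Hom C Y Z" for Y Z h k
      using nat_hom_act[OF \<phi>] that by simp
    have \<phi>add: "\<phi> Y (Add C X Y g h) = \<phi> Y g \<otimes>\<^bsub>Grp L Y\<^esub> \<phi> Y h"
      if "Y \<in> Obj C" "g \<in> I Y" "h \<in> I Y" for Y g h
      using nat_hom_mult[OF \<phi>] that by simp
    \<comment> \<open>The arrows of \<open>I\<close> at which \<open>\<phi>\<close> can be lifted to
      \<open>N\<close>. Every value of \<open>\<phi>\<close> enters the image of \<open>N\<close>
      under almost all arrows, so by T4 the arrows satisfying \<open>P\<close> still form an ideal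
      of the filter.\<close>
    define P where "P Y h \<longleftrightarrow> h \<in> I Y \<and> \<phi> Y h \<in> \<l> Y ` carrier (Grp N Y)" for Y h
    have "ideal_pred X P"
      unfolding ideal_pred_def
    proof (intro conjI ballI impI)
      fix Y assume Y: "Y \<in> Obj C"
      have z: "Zero C X Y \<in> I Y"
        using ideals[OF X I] Y subgroup.one_closed[of "I Y" "hom_group C X Y"]
        by (auto simp: left_ideal_def submodule_def)
      \<comment> \<open>The zero arrow is a composite of itself with a zero arrow, and a zero arrow
        annihilates everything.\<close>
      have "\<phi> Y (Zero C X Y) = Act L Y Y (Zero C Y Y) (\<phi> Y (Zero C X Y))"
        using \<phi>act[OF Y Y z, of "Zero C Y Y"] Y X by (simp add: comp_zero_left)
      also have "\<dots> = \<l> Y \<one>\<^bsub>Grp N Y\<^esub>"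
        using act_zero[OF L Y Y \<phi>cl[OF Y z]] nat_hom_one[OF \<l> N L Y] by simp
      finally show "P Y (Zero C X Y)"
        using z Y N by (auto simp: P_def)
    next
      fix Y f g assume "Y \<in> Obj C" "P Y f" "P Y g"
      then show "P Y (Add C X Y f g)"
        using \<phi>add ideal_add[OF X I] N
        by (auto simp: P_def simp flip: nat_hom_mult[OF \<l>])
    next
      fix Y Z f g assume "Y \<in> Obj C" "Z \<in> Obj C" "g \<in> Hom C Y Z" "P Y f"
      then show "P Z (Comp C X Y Z g f)"
        using \<phi>act ideal_comp[OF X I] N
        by (auto simp: P_def simp flip: nat_hom_act[OF \<l>])
    qed
    moreover have "almost X P"
    proof (rule almost_local[OF X \<open>ideal_pred X P\<close>])
      show "almost X (\<lambda>Y h. h \<in> I Y)" unfolding almost_def using I by blast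
      fix Y h assume Y: "Y \<in> Obj C" and "h \<in> Hom C X Y" and h: "h \<in> I Y"
      show "almost Y (\<lambda>Z k. P Z (Comp C X Y Z k h))"
        using dense[OF Y \<phi>cl[OF Y h]] Y
        by (rule almost_mono) (use \<phi>act[OF Y] ideal_comp[OF X I Y] h in \<open>simp add: P_def\<close>)
    qed
    ultimately have PF: "pred_ideal X P \<in> F X" using pred_ideal_in_F_iff X by blast
    have mem: "g \<in> pred_ideal X P Y \<longleftrightarrow> P Y g" if "Y \<in> Obj C" for Y g
      using that h by (auto simp: pred_ideal_def P_def)
    \<comment> \<open>The lifts are chosen independently of each other. Hence \<open>f\<close> is
      additive and natural only up to the kernel of \<open>\<l>\<close>, which is torsion; this is
      just what a fraction is allowed to be. Outside \<open>P\<close> the unit serves as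
      filler.\<close>
    define f where "f = (\<lambda>p\<in>arrs X. if P (fst p) (snd p)
       then SOME n. n \<in> carrier (Grp N (fst p)) \<and> \<l> (fst p) n = \<phi> (fst p) (snd p) else \<one>\<^bsub>Grp N (fst p)\<^esub>)"
    have f: "f (Y, h) \<in> carrier (Grp N Y) \<and> \<l> Y (f (Y, h)) = \<phi> Y h"
      if "Y \<in> Obj C" "P Y h" for Y h
    proof -
      have "f (Y, h) = (SOME n. n \<in> carrier (Grp N Y) \<and> \<l> Y n = \<phi> Y h)"
        using that h by (simp add: f_def P_def)
      moreover have "\<exists>n. n \<in> carrier (Grp N Y) \<and> \<l> Y n = \<phi> Y h"
        using that(2) by (auto simp: P_def)
      ultimately show ?thesis by (metis (mono_tags, lifting) someI_ex)
    qed
    have fc: "f \<in> (\<Pi>\<^sub>E p\<in>arrs X. carrier (Grp N (fst p)))"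
    proof
      fix p assume p: "p \<in> arrs X"
      obtain Y h where "p = (Y, h)" by (cases p)
      then show "f p \<in> carrier (Grp N (fst p))"
        using f[of Y h] p N by (cases "P Y h") (auto simp: f_def)
    qed (simp add: f_def)
    have "fraction_on X (pred_ideal X P) f"
      unfolding fraction_on_def
    proof (intro conjI ballI)
      fix Y g h assume Y: "Y \<in> Obj C" and "g \<in> pred_ideal X P Y" "h \<in> pred_ideal X P Y"
      then have gh: "P Y g" "P Y h" "P Y (Add C X Y g h)"
        using mem[OF Y] ideal_add[OF X PF Y] by auto
      have "\<l> Y (f (Y, Add C X Y g h)) = \<l> Y (f (Y, g) \<otimes>\<^bsub>Grp N Y\<^esub> f (Y, h))"
        using f[OF Y gh(1)] f[OF Y gh(2)] f[OF Y gh(3)] \<phi>add[OF Y] gh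
        by (simp add: nat_hom_mult[OF \<l> Y] P_def)
      then show "teq N Y (f (Y, Add C X Y g h)) (f (Y, g) \<otimes>\<^bsub>Grp N Y\<^esub> f (Y, h))"
        using \<l>_eq[OF Y, of "f (Y, Add C X Y g h)" "f (Y, g) \<otimes>\<^bsub>Grp N Y\<^esub> f (Y, h)"]
          f[OF Y gh(1)] f[OF Y gh(2)] f[OF Y gh(3)] N Y by simp
    next
      fix Y Z g k assume Y: "Y \<in> Obj C" and Z: "Z \<in> Obj C" and "g \<in> pred_ideal X P Y" and k: "k \<in> Hom C Y Z"
      then have g: "P Y g" "P Z (Comp C X Y Z k g)"
        using mem[OF Y] mem[OF Z] ideal_comp[OF X PF Y Z] by auto
      have "\<l> Z (f (Z, Comp C X Y Z k g)) = \<l> Z (Act N Y Z k (f (Y, g)))"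
        using f[OF Y g(1)] f[OF Z g(2)] \<phi>act[OF Y Z] g k
        by (simp add: nat_hom_act[OF \<l> Y Z] P_def)
      then show "teq N Z (f (Z, Comp C X Y Z k g)) (Act N Y Z k (f (Y, g)))"
        using \<l>_eq[OF Z, of "f (Z, Comp C X Y Z k g)" "Act N Y Z k (f (Y, g))"]
          f[OF Y g(1)] f[OF Z g(2)] N Y Z k by simp
    qed
    then have fA: "f \<in> ?A X" and fP: "fraction_on X (pred_ideal X P) f" using fc PF by auto
    have on_P: "\<phi> Y h = Act L X Y h (\<pi> X f)" if "Y \<in> Obj C" "P Y h" for Y h
      using act_value[OF X fA PF fP that(1)] mem[OF that(1)] f[OF that] that(2) by simp
    have a: "\<pi> X f \<in> carrier (Grp L X)" using surj[OF X] fA by blast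
    show "\<exists>x\<in>carrier (Grp L X). \<forall>Y\<in>Obj C. \<forall>h\<in>I Y. \<phi> Y h = Act L X Y h x"
    proof (intro bexI[OF _ a] ballI)
      fix Y g assume Y: "Y \<in> Obj C" and g: "g \<in> I Y"
      \<comment> \<open>So far the element is known to be right on \<open>P\<close> only. For
        \<open>g\<close> in \<open>I\<close>, almost all composites \<open>k \<circ> g\<close>
        satisfy \<open>P\<close>, and separatedness of \<open>L\<close> settles the rest.\<close>
      have "teq L Y (\<phi> Y g) (Act L X Y g (\<pi> X f))"
        unfolding teq_def using dense[OF Y \<phi>cl[OF Y g]] Y
      proof (rule almost_mono)
        fix Z k assume Z: "Z \<in> Obj C" and k: "k \<in> Hom C Y Z"
          and "Act L Y Z k (\<phi> Y g) \<in> \<l> Z ` carrier (Grp N Z)"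
        then have "P Z (Comp C X Y Z k g)"
          using \<phi>act[OF Y Z g k] ideal_comp[OF X I Y Z g k] by (simp add: P_def)
        then show "Act L Y Z k (\<phi> Y g) = Act L Y Z k (Act L X Y g (\<pi> X f))"
          using on_P[OF Z] \<phi>act[OF Y Z g k] X Y Z h[OF Y g] k a L by (simp add: act_comp)
      qed
      then show "\<phi> Y g = Act L X Y g (\<pi> X f)"
        using sep Y \<phi>cl[OF Y g] L X h[OF Y g] a unfolding separated_def by simp
    qed
  qed
  show thesis
    using that[OF L LU sep glue \<l> _ dense] \<l>_eq by blast
qed


end

context gabriel_modules begin

section \<open>Submodules and quotients\<close>

lemma submodule_subgroup: "\<lbrakk>submodule C M S; X \<in> Obj C\<rbrakk> \<Longrightarrow> subgroup (S X) (Grp M X)"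
  by (simp add: submodule_def)

lemma submodule_act:
  "\<lbrakk>submodule C M S; X \<in> Obj C; Y \<in> Obj C; f \<in> Hom C X Y; x \<in> S X\<rbrakk> \<Longrightarrow> Act M X Y f x \<in> S Y"
  by (simp add: submodule_def)

lemma submodule_carrier: "\<lbrakk>submodule C M S; X \<in> Obj C; x \<in> S X\<rbrakk> \<Longrightarrow> x \<in> carrier (Grp M X)"
  using submodule_subgroup subgroup.subset by blast

lemma submodule_one: "\<lbrakk>submodule C M S; X \<in> Obj C\<rbrakk> \<Longrightarrow> \<one>\<^bsub>Grp M X\<^esub> \<in> S X"
  using submodule_subgroup subgroup.one_closed by blast

lemma submodule_mult:
  "\<lbrakk>submodule C M S; X \<in> Obj C; x \<in> S X; y \<in> S X\<rbrakk> \<Longrightarrow> x \<otimes>\<^bsub>Grp M X\<^esub> y \<in> S X"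
  by (rule subgroup.m_closed[OF submodule_subgroup])

lemma submodule_inv: "\<lbrakk>submodule C M S; X \<in> Obj C; x \<in> S X\<rbrakk> \<Longrightarrow> inv\<^bsub>Grp M X\<^esub> x \<in> S X"
  by (rule subgroup.m_inv_closed[OF submodule_subgroup])

lemma submoduleI:
  assumes M: "is_module C M"
    and "\<And>X x. \<lbrakk>X \<in> Obj C; x \<in> S X\<rbrakk> \<Longrightarrow> x \<in> carrier (Grp M X)"
    and "\<And>X. X \<in> Obj C \<Longrightarrow> \<one>\<^bsub>Grp M X\<^esub> \<in> S X"
    and "\<And>X x y. \<lbrakk>X \<in> Obj C; x \<in> S X; y \<in> S X\<rbrakk> \<Longrightarrow> x \<otimes>\<^bsub>Grp M X\<^esub> y \<in> S X"
    and "\<And>X x. \<lbrakk>X \<in> Obj C; x \<in> S X\<rbrakk> \<Longrightarrow> inv\<^bsub>Grp M X\<^esub> x \<in> S X"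
    and "\<And>X Y f x. \<lbrakk>X \<in> Obj C; Y \<in> Obj C; f \<in> Hom C X Y; x \<in> S X\<rbrakk> \<Longrightarrow> Act M X Y f x \<in> S Y"
    and "\<And>X. X \<notin> Obj C \<Longrightarrow> S X = {}"
  shows "submodule C M S"
  unfolding submodule_def using assms by (auto intro!: subgroup.intro)

lemma mem_r_coset_iff:
  assumes "is_module C M" "submodule C M S" "X \<in> Obj C" "x \<in> carrier (Grp M X)"
  shows "y \<in> S X #>\<^bsub>Grp M X\<^esub> x \<longleftrightarrow> y \<in> carrier (Grp M X) \<and> y \<otimes>\<^bsub>Grp M X\<^esub> inv\<^bsub>Grp M X\<^esub> x \<in> S X"
proof -
  interpret G: comm_group "Grp M X" using module_group assms by blast
  interpret S: subgroup "S X" "Grp M X" using submodule_subgroup assms by blast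
  show ?thesis
    using S.rcos_module[OF G.is_group assms(4), of y] S.elemrcos_carrier[OF G.is_group assms(4), of y]
    by blast
qed

lemma quot_mod_simps [simp]:
  "Grp (quot_mod M S) X = Grp M X Mod S X"
  "Act (quot_mod M S) X Y f K = S Y <#>\<^bsub>Grp M Y\<^esub> (Act M X Y f ` K)"
  by (simp_all add: quot_mod_def)

lemma quot_mod_act:
  assumes M: "is_module C M" and S: "submodule C M S" and X: "X \<in> Obj C" and Y: "Y \<in> Obj C"
    and f: "f \<in> Hom C X Y" and x: "x \<in> carrier (Grp M X)"
  shows "S Y <#>\<^bsub>Grp M Y\<^esub> (Act M X Y f ` (S X #>\<^bsub>Grp M X\<^esub> x)) = S Y #>\<^bsub>Grp M Y\<^esub> Act M X Y f x"
proof (intro equalityI subsetI)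
  interpret GY: comm_group "Grp M Y" using module_group M Y by blast
  interpret GX: comm_group "Grp M X" using module_group M X by blast
  have fx: "Act M X Y f x \<in> carrier (Grp M Y)" using M X Y f x by simp
  fix z assume "z \<in> S Y <#>\<^bsub>Grp M Y\<^esub> (Act M X Y f ` (S X #>\<^bsub>Grp M X\<^esub> x))"
  then obtain t s where t: "t \<in> S Y" and s: "s \<in> S X" and z: "z = t \<otimes>\<^bsub>Grp M Y\<^esub> Act M X Y f (s \<otimes>\<^bsub>Grp M X\<^esub> x)"
    by (auto simp: set_mult_def r_coset_def)
  have "Act M X Y f s \<in> S Y" using submodule_act[OF S X Y f s] .
  moreover have "z = (t \<otimes>\<^bsub>Grp M Y\<^esub> Act M X Y f s) \<otimes>\<^bsub>Grp M Y\<^esub> Act M X Y f x"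
    using z t s fx submodule_carrier[OF S] X Y f M x by (simp add: act_mult GY.m_assoc)
  ultimately show "z \<in> S Y #>\<^bsub>Grp M Y\<^esub> Act M X Y f x"
    using submodule_mult[OF S Y t] by (auto simp: r_coset_def)
next
  interpret GX: comm_group "Grp M X" using module_group M X by blast
  fix z assume "z \<in> S Y #>\<^bsub>Grp M Y\<^esub> Act M X Y f x"
  moreover have "x \<in> S X #>\<^bsub>Grp M X\<^esub> x"
    using GX.rcos_self[OF x submodule_subgroup[OF S X]] .
  ultimately show "z \<in> S Y <#>\<^bsub>Grp M Y\<^esub> (Act M X Y f ` (S X #>\<^bsub>Grp M X\<^esub> x))"
    unfolding set_mult_def r_coset_def[of _ "S Y"] by blast
qed

lemma quot_mod_module:
  assumes M: "is_module C M" and S: "submodule C M S"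
  shows "is_module C (quot_mod M S)"
proof (rule is_module_image[of M "\<lambda>X x. S X #>\<^bsub>Grp M X\<^esub> x"])
  fix X assume X: "X \<in> Obj C"
  interpret G: comm_group "Grp M X" using module_group M X by blast
  interpret S: normal "S X" "Grp M X"
    using G.subgroup_imp_normal submodule_subgroup[OF S X] by blast
  show "comm_group (Grp M X)" by (rule G.comm_group_axioms)
  show "(\<lambda>x. S X #>\<^bsub>Grp M X\<^esub> x) ` carrier (Grp M X) = carrier (Grp (quot_mod M S) X)"
    by (simp add: carrier_FactGroup)
  show "S X #>\<^bsub>Grp M X\<^esub> \<one>\<^bsub>Grp M X\<^esub> = \<one>\<^bsub>Grp (quot_mod M S) X\<^esub>"
    using G.coset_mult_one S.subset by simp
  show "S X #>\<^bsub>Grp M X\<^esub> (a \<otimes>\<^bsub>Grp M X\<^esub> b) =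
     (S X #>\<^bsub>Grp M X\<^esub> a) \<otimes>\<^bsub>Grp (quot_mod M S) X\<^esub> (S X #>\<^bsub>Grp M X\<^esub> b)"
    if "a \<in> carrier (Grp M X)" "b \<in> carrier (Grp M X)" for a b
    using S.rcos_sum that by simp
qed (use M S in \<open>simp_all add: quot_mod_act act_mult act_comp act_add\<close>)

lemma sub_mod_module:
  assumes M: "is_module C M" and S: "submodule C M S"
  shows "is_module C (sub_mod M S)"
proof -
  have "comm_group (Grp (sub_mod M S) X)" if X: "X \<in> Obj C" for X
  proof -
    interpret G: comm_group "Grp M X" using module_group M X by blast
    interpret S: group "(Grp M X)\<lparr>carrier := S X\<rparr>"
      using subgroup.subgroup_is_group[OF submodule_subgroup[OF S X] G.is_group] .
    show ?thesis
      unfolding sub_mod_def using submodule_carrier[OF S X] G.m_comm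
      by (auto intro!: S.group_comm_groupI)
  qed
  then show ?thesis
    unfolding is_module_def
    using M submodule_carrier[OF S] submodule_act[OF S]
    by (simp add: hom_def Pi_def act_mult act_comp act_add)
qed

text \<open>The annihilator of the coset of \<open>x\<close> in \<open>M/S\<close> consists of the
  arrows that carry \<open>x\<close> into \<open>S\<close>.\<close>

lemma dense_sub_iff:
  assumes M: "is_module C M"
  shows "dense_sub C F M S \<longleftrightarrow> submodule C M S \<and>
    (\<forall>X\<in>Obj C. \<forall>x\<in>carrier (Grp M X). almost X (\<lambda>Y h. Act M X Y h x \<in> S Y))"
proof (cases "submodule C M S")
  case S: True
  let ?Q = "quot_mod M S"
  have Q: "is_module C ?Q" by (rule quot_mod_module[OF M S])
  have "annihilator C ?Q X (S X #>\<^bsub>Grp M X\<^esub> x) \<in> F X \<longleftrightarrow> almost X (\<lambda>Y h. Act M X Y h x \<in> S Y)"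
    if X: "X \<in> Obj C" and x: "x \<in> carrier (Grp M X)" for X x
  proof -
    have cl: "S X #>\<^bsub>Grp M X\<^esub> x \<in> carrier (Grp ?Q X)"
      using x by (simp add: carrier_FactGroup)
    have "Act ?Q X Y h (S X #>\<^bsub>Grp M X\<^esub> x) = \<one>\<^bsub>Grp ?Q Y\<^esub> \<longleftrightarrow> Act M X Y h x \<in> S Y"
      if Y: "Y \<in> Obj C" and h: "h \<in> Hom C X Y" for Y h
    proof -
      interpret G: comm_group "Grp M Y" using module_group M Y by blast
      show ?thesis
        using quot_mod_act[OF M S X Y h x] G.coset_join1[of "S Y"] G.coset_join2[of _ "S Y"]
          submodule_subgroup[OF S Y] subgroup.subset act_closed[OF M X Y h x]
        by auto
    qed
    then have "almost X (\<lambda>Y h. Act ?Q X Y h (S X #>\<^bsub>Grp M X\<^esub> x) = Act ?Q X Y h \<one>\<^bsub>Grp ?Q X\<^esub>)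
       \<longleftrightarrow> almost X (\<lambda>Y h. Act M X Y h x \<in> S Y)"
      by (intro almost_cong[OF X]) (simp add: act_one[OF Q X] del: quot_mod_simps)
    then show ?thesis
      unfolding teq_one_iff[OF Q X cl, symmetric] teq_def .
  qed
  then show ?thesis
    using S Q by (auto simp: dense_sub_def torsion_def carrier_FactGroup)
qed (simp add: dense_sub_def)

lemma torsion_sub_iff:
  assumes M: "is_module C M"
  shows "torsion_sub C F M T \<longleftrightarrow> submodule C M T \<and> (\<forall>X\<in>Obj C. \<forall>x\<in>T X. teq M X x \<one>\<^bsub>Grp M X\<^esub>)"
proof (cases "submodule C M T")
  case T: True
  have "annihilator C (sub_mod M T) X x = annihilator C M X x" for X x
    by (simp add: annihilator_def cong: if_cong)
  then show ?thesis
    using T sub_mod_module[OF M T] teq_one_iff[OF M] submodule_carrier[OF T]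
    by (simp add: torsion_sub_def torsion_def)
qed (simp add: torsion_sub_def)

lemma dense_sub_inter:
  assumes M: "is_module C M" and "dense_sub C F M S" "dense_sub C F M S'"
  shows "dense_sub C F M (\<lambda>X. S X \<inter> S' X)"
proof -
  have "submodule C M (\<lambda>X. S X \<inter> S' X)"
    using assms(2,3) group.subgroups_Inter_pair[OF comm_group.axioms(2)[OF module_group[OF M]]]
    by (auto simp: dense_sub_def submodule_def)
  then show ?thesis
    using assms(2,3) unfolding dense_sub_iff[OF M] by (auto intro: almost_conj)
qed

section \<open>The torsion submodule\<close>

definition torsion_part :: "('o, 'm, 'v) cmod \<Rightarrow> 'o \<Rightarrow> 'v set" where
  "torsion_part M X = (if X \<in> Obj C then {x \<in> carrier (Grp M X). teq M X x \<one>\<^bsub>Grp M X\<^esub>} else {})"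

lemma torsion_sub_torsion_part:
  assumes M: "is_module C M"
  shows "torsion_sub C F M (torsion_part M)"
proof -
  have "submodule C M (torsion_part M)"
  proof (rule submoduleI[OF M])
    fix X assume X: "X \<in> Obj C"
    interpret G: comm_group "Grp M X" using module_group M X by blast
    show "\<one>\<^bsub>Grp M X\<^esub> \<in> torsion_part M X" using X by (simp add: torsion_part_def)
    show "x \<otimes>\<^bsub>Grp M X\<^esub> y \<in> torsion_part M X"
      if "x \<in> torsion_part M X" "y \<in> torsion_part M X" for x y
      using that teq_mult[OF M X, of x y "\<one>\<^bsub>Grp M X\<^esub>" "\<one>\<^bsub>Grp M X\<^esub>"] X by (simp add: torsion_part_def)
    show "inv\<^bsub>Grp M X\<^esub> x \<in> torsion_part M X" if "x \<in> torsion_part M X" for x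
      using that teq_inv[OF M X, of x "\<one>\<^bsub>Grp M X\<^esub>"] X by (simp add: torsion_part_def)
    fix Y f x assume "Y \<in> Obj C" "f \<in> Hom C X Y" "x \<in> torsion_part M X"
    then show "Act M X Y f x \<in> torsion_part M Y"
      using teq_act[OF M X, of x "\<one>\<^bsub>Grp M X\<^esub>" Y f] X M by (simp add: torsion_part_def act_one)
  qed (auto simp: torsion_part_def)
  then show ?thesis
    using torsion_sub_iff[OF M] by (auto simp: torsion_part_def)
qed

lemma teq_iff_torsion_part:
  assumes M: "is_module C M" and X: "X \<in> Obj C" and x: "x \<in> carrier (Grp M X)" and y: "y \<in> carrier (Grp M X)"
  shows "teq M X x y \<longleftrightarrow> x \<otimes>\<^bsub>Grp M X\<^esub> inv\<^bsub>Grp M X\<^esub> y \<in> torsion_part M X"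
proof -
  interpret G: comm_group "Grp M X" using module_group M X by blast
  show ?thesis
  proof
    assume "teq M X x y"
    then show "x \<otimes>\<^bsub>Grp M X\<^esub> inv\<^bsub>Grp M X\<^esub> y \<in> torsion_part M X"
      using teq_mult[OF M X, of x "inv\<^bsub>Grp M X\<^esub> y" y "inv\<^bsub>Grp M X\<^esub> y"] X x y
      by (simp add: torsion_part_def)
  next
    assume "x \<otimes>\<^bsub>Grp M X\<^esub> inv\<^bsub>Grp M X\<^esub> y \<in> torsion_part M X"
    then show "teq M X x y"
      using teq_mult[OF M X, of "x \<otimes>\<^bsub>Grp M X\<^esub> inv\<^bsub>Grp M X\<^esub> y" y "\<one>\<^bsub>Grp M X\<^esub>" y] X x y
      by (simp add: torsion_part_def G.m_assoc)
  qed
qed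

lemma ideal_pred_image:
  assumes M: "is_module C M" and L: "is_module C L" and \<theta>: "\<theta> \<in> nat_hom C M L"
    and S: "submodule C M S" and X: "X \<in> Obj C" and a: "a \<in> carrier (Grp L X)"
  shows "ideal_pred X (\<lambda>Y h. Act L X Y h a \<in> \<theta> Y ` S Y)"
  unfolding ideal_pred_def
proof (intro conjI ballI impI)
  fix Y assume Y: "Y \<in> Obj C"
  show "Act L X Y (Zero C X Y) a \<in> \<theta> Y ` S Y"
    using act_zero[OF L X Y a] nat_hom_one[OF \<theta> M L Y] submodule_one[OF S Y] by (metis image_eqI)
next
  fix Y f g assume Y: "Y \<in> Obj C" and f: "f \<in> Hom C X Y" "g \<in> Hom C X Y"
    and "Act L X Y f a \<in> \<theta> Y ` S Y" "Act L X Y g a \<in> \<theta> Y ` S Y"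
  then obtain x y where "x \<in> S Y" "Act L X Y f a = \<theta> Y x" "y \<in> S Y" "Act L X Y g a = \<theta> Y y" by blast
  then show "Act L X Y (Add C X Y f g) a \<in> \<theta> Y ` S Y"
    using act_add[OF L X Y f a] nat_hom_mult[OF \<theta> Y, of x y] submodule_carrier[OF S Y] submodule_mult[OF S Y, of x y]
    by (metis image_eqI)
next
  fix Y Z f g assume Y: "Y \<in> Obj C" and Z: "Z \<in> Obj C" and f: "f \<in> Hom C X Y" "g \<in> Hom C Y Z"
    and "Act L X Y f a \<in> \<theta> Y ` S Y"
  then obtain x where "x \<in> S Y" "Act L X Y f a = \<theta> Y x" by blast
  then show "Act L X Z (Comp C X Y Z g f) a \<in> \<theta> Z ` S Z"
    using act_comp[OF L X Y Z f a] nat_hom_act[OF \<theta> Y Z f(2), of x] submodule_carrier[OF S Y]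
      submodule_act[OF S Y Z f(2), of x] by (metis image_eqI)
qed

section \<open>Partial homomorphisms\<close>

context
  fixes M N :: "('o, 'm, 'u) cmod" and S T f
  assumes M: "is_module C M" and N: "is_module C N"
    and p: "(S, T, f) \<in> partial_homs C F M N"
begin

lemma partial_hom_dom: "submodule C M S"
  using p by (simp add: partial_homs_def dense_sub_def)

lemma partial_hom_ker: "submodule C N T"
  using p by (simp add: partial_homs_def torsion_sub_def)

lemma partial_hom_dense:
  "\<lbrakk>X \<in> Obj C; x \<in> carrier (Grp M X)\<rbrakk> \<Longrightarrow> almost X (\<lambda>Y h. Act M X Y h x \<in> S Y)"
  using p by (simp add: partial_homs_def dense_sub_iff[OF M])

lemma partial_hom_torsion: "\<lbrakk>X \<in> Obj C; x \<in> T X\<rbrakk> \<Longrightarrow> x \<in> torsion_part N X"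
  using p submodule_carrier[OF partial_hom_ker]
  by (simp add: partial_homs_def torsion_sub_iff[OF N] torsion_part_def)

lemma partial_hom_nat_hom: "f \<in> nat_hom C (sub_mod M S) (quot_mod N T)"
  using p by (simp add: partial_homs_def)

lemma partial_hom_ex:
  assumes X: "X \<in> Obj C" and x: "x \<in> S X"
  shows "\<exists>n\<in>carrier (Grp N X). f X x = T X #>\<^bsub>Grp N X\<^esub> n"
  using nat_hom_closed[OF partial_hom_nat_hom X, of x] x by (auto simp: carrier_FactGroup)

text \<open>A coset is fixed by any of its elements. From here on \<open>f\<close> is treated as a
  multivalued map into \<open>N\<close>: \<open>n \<in> f X x\<close> means that \<open>n\<close> is
  a value at \<open>x\<close>, and values at the same \<open>x\<close> differ by elements of
  \<open>T\<close>.\<close>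

lemma partial_hom_coset:
  assumes X: "X \<in> Obj C" and x: "x \<in> S X" and n: "n \<in> f X x"
  shows "n \<in> carrier (Grp N X)" "f X x = T X #>\<^bsub>Grp N X\<^esub> n"
proof -
  interpret G: comm_group "Grp N X" using module_group N X by blast
  interpret T: subgroup "T X" "Grp N X" using submodule_subgroup[OF partial_hom_ker X] .
  obtain m where m: "m \<in> carrier (Grp N X)" "f X x = T X #>\<^bsub>Grp N X\<^esub> m"
    using partial_hom_ex[OF X x] by blast
  show n': "n \<in> carrier (Grp N X)" using m n T.elemrcos_carrier[OF G.is_group] by blast
  show "f X x = T X #>\<^bsub>Grp N X\<^esub> n"
    using G.repr_independence[OF _ m(1) T.subgroup_axioms] n m(2) by simp
qed

lemma partial_hom_nonempty: "\<lbrakk>X \<in> Obj C; x \<in> S X\<rbrakk> \<Longrightarrow> \<exists>n. n \<in> f X x"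
  using partial_hom_ex group.rcos_self[OF comm_group.axioms(2)[OF module_group[OF N]]]
    submodule_subgroup[OF partial_hom_ker] by blast

lemma partial_hom_diff:
  assumes X: "X \<in> Obj C" and x: "x \<in> S X" and n: "n \<in> f X x" and m: "m \<in> f X x"
  shows "n \<otimes>\<^bsub>Grp N X\<^esub> inv\<^bsub>Grp N X\<^esub> m \<in> T X"
  using mem_r_coset_iff[OF N partial_hom_ker X, of m n] partial_hom_coset[OF X x m] n by auto

lemma partial_hom_translate:
  assumes X: "X \<in> Obj C" and x: "x \<in> S X" and n: "n \<in> f X x" and t: "t \<in> T X"
  shows "t \<otimes>\<^bsub>Grp N X\<^esub> n \<in> f X x"
  using partial_hom_coset[OF X x n] t by (auto simp: r_coset_def)

lemma partial_hom_teq: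
  assumes X: "X \<in> Obj C" and x: "x \<in> S X" and n: "n \<in> f X x" and m: "m \<in> f X x"
  shows "teq N X n m"
  using teq_iff_torsion_part[OF N X] partial_hom_coset(1)[OF X x] n m
    partial_hom_torsion[OF X partial_hom_diff[OF X x n m]] by blast

lemma partial_hom_mult:
  assumes X: "X \<in> Obj C" and x: "x \<in> S X" and y: "y \<in> S X" and n: "n \<in> f X x" and m: "m \<in> f X y"
  shows "n \<otimes>\<^bsub>Grp N X\<^esub> m \<in> f X (x \<otimes>\<^bsub>Grp M X\<^esub> y)"
  using nat_hom_mult[OF partial_hom_nat_hom X, of x y] x y n m by (auto simp: set_mult_def)

lemma partial_hom_act:
  assumes X: "X \<in> Obj C" and Y: "Y \<in> Obj C" and k: "k \<in> Hom C X Y" and x: "x \<in> S X" and n: "n \<in> f X x"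
  shows "Act N X Y k n \<in> f Y (Act M X Y k x)"
proof -
  interpret G: comm_group "Grp N Y" using module_group N Y by blast
  have "f Y (Act M X Y k x) = T Y <#>\<^bsub>Grp N Y\<^esub> (Act N X Y k ` f X x)"
    using nat_hom_act[OF partial_hom_nat_hom X Y k, of x] x by simp
  moreover have "Act N X Y k n = \<one>\<^bsub>Grp N Y\<^esub> \<otimes>\<^bsub>Grp N Y\<^esub> Act N X Y k n"
    using partial_hom_coset(1)[OF X x n] X Y k N by simp
  ultimately show ?thesis
    using submodule_one[OF partial_hom_ker Y] n unfolding set_mult_def by blast
qed

lemma partial_hom_one: "X \<in> Obj C \<Longrightarrow> f X \<one>\<^bsub>Grp M X\<^esub> = T X"
  using nat_hom_one[OF partial_hom_nat_hom sub_mod_module[OF M partial_hom_dom]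
      quot_mod_module[OF N partial_hom_ker]] by simp

lemma partial_hom_inv:
  assumes X: "X \<in> Obj C" and x: "x \<in> S X" and n: "n \<in> f X x"
  shows "inv\<^bsub>Grp N X\<^esub> n \<in> f X (inv\<^bsub>Grp M X\<^esub> x)"
proof -
  interpret G: comm_group "Grp N X" using module_group N X by blast
  interpret GM: comm_group "Grp M X" using module_group M X by blast
  have x': "inv\<^bsub>Grp M X\<^esub> x \<in> S X" using submodule_inv[OF partial_hom_dom X x] .
  obtain m where m: "m \<in> f X (inv\<^bsub>Grp M X\<^esub> x)" using partial_hom_nonempty[OF X x'] by blast
  note nm = partial_hom_coset(1)[OF X x n] partial_hom_coset(1)[OF X x' m]
  \<comment> \<open>The product is a value at the unit, hence in \<open>T\<close>. Translating
    \<open>m\<close> by its inverse stays within the values at the inverse of \<open>x\<close> and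
    produces the inverse of \<open>n\<close>.\<close>
  have "n \<otimes>\<^bsub>Grp N X\<^esub> m \<in> T X"
    using partial_hom_mult[OF X x x' n m] partial_hom_one[OF X] submodule_carrier[OF partial_hom_dom X x]
    by simp
  from submodule_inv[OF partial_hom_ker X this]
  have "inv\<^bsub>Grp N X\<^esub> (n \<otimes>\<^bsub>Grp N X\<^esub> m) \<otimes>\<^bsub>Grp N X\<^esub> m \<in> f X (inv\<^bsub>Grp M X\<^esub> x)"
    by (rule partial_hom_translate[OF X x' m])
  moreover have "inv\<^bsub>Grp N X\<^esub> (n \<otimes>\<^bsub>Grp N X\<^esub> m) \<otimes>\<^bsub>Grp N X\<^esub> m = inv\<^bsub>Grp N X\<^esub> n"
    using nm by (simp add: G.inv_mult G.m_assoc)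
  ultimately show ?thesis by simp
qed

end

text \<open>Cosets that meet are equal. So for values that are cosets of \<open>T\<close> it is
  enough to exhibit one common element on each side of the homomorphism laws.\<close>

lemma partial_homI:
  assumes M: "is_module C M" and N: "is_module C N" and S: "dense_sub C F M S" and T: "torsion_sub C F N T"
    and ext: "f \<in> extensional (Obj C)" "\<And>X. X \<in> Obj C \<Longrightarrow> f X \<in> extensional (S X)"
    and coset: "\<And>X x. \<lbrakk>X \<in> Obj C; x \<in> S X\<rbrakk>
      \<Longrightarrow> \<exists>n\<in>carrier (Grp N X). f X x = T X #>\<^bsub>Grp N X\<^esub> n"
    and mult: "\<And>X x y n m. \<lbrakk>X \<in> Obj C; x \<in> S X; y \<in> S X; n \<in> f X x; m \<in> f X y\<rbrakk>
      \<Longrightarrow> n \<otimes>\<^bsub>Grp N X\<^esub> m \<in> f X (x \<otimes>\<^bsub>Grp M X\<^esub> y)"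
    and act: "\<And>X Y k x n. \<lbrakk>X \<in> Obj C; Y \<in> Obj C; k \<in> Hom C X Y; x \<in> S X; n \<in> f X x\<rbrakk>
      \<Longrightarrow> Act N X Y k n \<in> f Y (Act M X Y k x)"
  shows "(S, T, f) \<in> partial_homs C F M N"
proof -
  have Ss: "submodule C M S" and Ts: "submodule C N T"
    using S T by (auto simp: dense_sub_def torsion_sub_def)
  have eq: "f X x = T X #>\<^bsub>Grp N X\<^esub> m" if X: "X \<in> Obj C" and x: "x \<in> S X" and m: "m \<in> f X x" for X x m
  proof -
    obtain n where n: "n \<in> carrier (Grp N X)" "f X x = T X #>\<^bsub>Grp N X\<^esub> n"
      using coset[OF X x] by blast
    show ?thesis
      using group.repr_independence[OF comm_group.axioms(2)[OF module_group[OF N X]] _ n(1)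
          submodule_subgroup[OF Ts X], of m] m n(2) by simp
  qed
  have self: "n \<in> f X x" if "X \<in> Obj C" "n \<in> carrier (Grp N X)" "f X x = T X #>\<^bsub>Grp N X\<^esub> n" for X x n
    using group.rcos_self[OF comm_group.axioms(2)[OF module_group[OF N that(1)]] that(2) submodule_subgroup[OF Ts that(1)]] that(3)
    by simp
  have "f \<in> nat_hom C (sub_mod M S) (quot_mod N T)"
  proof (rule nat_homI)
    fix X assume X: "X \<in> Obj C"
    interpret G: comm_group "Grp N X" using module_group N X by blast
    interpret T: normal "T X" "Grp N X"
      using G.subgroup_imp_normal submodule_subgroup[OF Ts X] by blast
    have "f X (x \<otimes>\<^bsub>Grp M X\<^esub> y) = f X x <#>\<^bsub>Grp N X\<^esub> f X y" if x: "x \<in> S X" and y: "y \<in> S X" for x y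
    proof -
      obtain n m where n: "n \<in> carrier (Grp N X)" "f X x = T X #>\<^bsub>Grp N X\<^esub> n"
        and m: "m \<in> carrier (Grp N X)" "f X y = T X #>\<^bsub>Grp N X\<^esub> m"
        using coset[OF X x] coset[OF X y] by blast
      have "n \<otimes>\<^bsub>Grp N X\<^esub> m \<in> f X (x \<otimes>\<^bsub>Grp M X\<^esub> y)"
        using mult[OF X x y self[OF X n] self[OF X m]] .
      from eq[OF X submodule_mult[OF Ss X x y] this] show ?thesis
        using T.rcos_sum n m by simp
    qed
    then show "f X \<in> hom (Grp (sub_mod M S) X) (Grp (quot_mod N T) X)"
      using coset[OF X] by (auto simp: hom_def carrier_FactGroup image_iff)
  next
    fix X Y k x assume X: "X \<in> Obj C" and Y: "Y \<in> Obj C" and k: "k \<in> Hom C X Y"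
      and "x \<in> carrier (Grp (sub_mod M S) X)"
    then have x: "x \<in> S X" by simp
    obtain n where n: "n \<in> carrier (Grp N X)" "f X x = T X #>\<^bsub>Grp N X\<^esub> n"
      using coset[OF X x] by blast
    have "f Y (Act M X Y k x) = T Y #>\<^bsub>Grp N Y\<^esub> Act N X Y k n"
      using eq[OF Y submodule_act[OF Ss X Y k x] act[OF X Y k x self[OF X n]]] .
    then show "f Y (Act (sub_mod M S) X Y k x) = Act (quot_mod N T) X Y k (f X x)"
      using quot_mod_act[OF N Ts X Y k n(1)] n(2) by simp
  qed (use ext in auto)
  then show ?thesis using S T by (simp add: partial_homs_def)
qed


section \<open>Morphisms of the Serre quotient as morphisms between localizations\<close>

text \<open>Abstracts from fractions: a map to a closed module with torsion kernel and dense image.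
  The identity of a closed module is an instance as well, see
  \<open>localization_self\<close>.\<close>

definition localization ::
  "('o, 'm, 'v) cmod \<Rightarrow> ('o, 'm, 'w) cmod \<Rightarrow> ('o \<Rightarrow> 'v \<Rightarrow> 'w) \<Rightarrow> bool" where
  "localization M L \<l> \<longleftrightarrow> is_module C L \<and> separated L \<and> gluing L \<and> \<l> \<in> nat_hom C M L \<and>
     (\<forall>X\<in>Obj C. \<forall>x\<in>carrier (Grp M X). \<forall>y\<in>carrier (Grp M X). \<l> X x = \<l> X y \<longrightarrow> teq M X x y) \<and>
     (\<forall>X\<in>Obj C. \<forall>a\<in>carrier (Grp L X). almost X (\<lambda>Y h. Act L X Y h a \<in> \<l> Y ` carrier (Grp M Y)))"

lemma localization_eq_iff:
  assumes M: "is_module C M" and L: "localization M L \<l>" and X: "X \<in> Obj C"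
    and x: "x \<in> carrier (Grp M X)" and y: "y \<in> carrier (Grp M X)"
  shows "\<l> X x = \<l> X y \<longleftrightarrow> teq M X x y"
proof
  assume "\<l> X x = \<l> X y"
  then show "teq M X x y" using L X x y by (auto simp: localization_def)
next
  assume t: "teq M X x y"
  have \<l>: "\<l> \<in> nat_hom C M L" and sep: "separated L" using L by (auto simp: localization_def)
  have "teq L X (\<l> X x) (\<l> X y)"
    unfolding teq_def
    by (rule almost_mono[OF t[unfolded teq_def] X]) (use X x y in \<open>simp flip: nat_hom_act[OF \<l>]\<close>)
  then show "\<l> X x = \<l> X y"
    using sep X x y nat_hom_closed[OF \<l> X] unfolding separated_def by blast
qed

lemma localization_self:
  assumes "is_module C M" "closed_module C F M"
  shows "localization M M (Ide (Mod_cat U C) M)"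
  using assms closed_module_iff[OF assms(1)] by (auto simp: localization_def image_def intro!: almost_all)

text \<open>Density is transitive. An element of \<open>L\<close> first moves into the image of
  \<open>M\<close>, then its preimage moves into \<open>S\<close>; \<open>almost_local\<close>
  combines both.\<close>

lemma localization_dense_image:
  assumes M: "is_module C M" and L: "localization M L \<l>" and S: "dense_sub C F M S"
    and X: "X \<in> Obj C" and a: "a \<in> carrier (Grp L X)"
  shows "almost X (\<lambda>Y h. Act L X Y h a \<in> \<l> Y ` S Y)"
proof -
  have \<l>: "\<l> \<in> nat_hom C M L" and Lm: "is_module C L"
    and d: "almost X (\<lambda>Y h. Act L X Y h a \<in> \<l> Y ` carrier (Grp M Y))"
    using L X a by (auto simp: localization_def)
  have Ss: "submodule C M S" using S by (simp add: dense_sub_def)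
  show ?thesis
  proof (rule almost_local[OF X ideal_pred_image[OF M Lm \<l> Ss X a] d])
    fix Y h assume Y: "Y \<in> Obj C" and h: "h \<in> Hom C X Y" and "Act L X Y h a \<in> \<l> Y ` carrier (Grp M Y)"
    then obtain x where x: "x \<in> carrier (Grp M Y)" "Act L X Y h a = \<l> Y x" by blast
    have "almost Y (\<lambda>Z k. Act M Y Z k x \<in> S Z)"
      using S x Y by (simp add: dense_sub_iff[OF M])
    then show "almost Y (\<lambda>Z k. Act L X Z (Comp C X Y Z k h) a \<in> \<l> Z ` S Z)"
    proof (rule almost_mono[OF _ Y])
      fix Z k assume Z: "Z \<in> Obj C" and k: "k \<in> Hom C Y Z" and "Act M Y Z k x \<in> S Z"
      moreover have "Act L X Z (Comp C X Y Z k h) a = \<l> Z (Act M Y Z k x)"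
        using act_comp[OF Lm X Y Z h k a] x nat_hom_act[OF \<l> Y Z k x(1)] by simp
      ultimately show "Act L X Z (Comp C X Y Z k h) a \<in> \<l> Z ` S Z" by blast
    qed
  qed
qed

text \<open>The square formed by \<open>\<theta>\<close>, the partial homomorphism and the
  localization maps commutes on \<open>S\<close>. Running through all values \<open>n\<close> is
  harmless, because they differ by torsion, which the localization map \<open>\<k>\<close>
  kills.\<close>

definition represents ::
  "('o \<Rightarrow> 'u \<Rightarrow> 'v) \<Rightarrow> ('o \<Rightarrow> 'u \<Rightarrow> 'w) \<Rightarrow> ('o, 'u) partial_hom \<Rightarrow> ('o \<Rightarrow> 'v \<Rightarrow> 'w) \<Rightarrow> bool" where
  "represents \<l> \<k> = (\<lambda>(S, T, f) \<theta>. \<forall>X\<in>Obj C. \<forall>x\<in>S X. \<forall>n\<in>f X x. \<theta> X (\<l> X x) = \<k> X n)"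

lemma represents_unique:
  assumes M: "is_module C M" and N: "is_module C N" and L: "localization M L \<l>" and K: "localization N K \<k>"
    and p: "(S, T, f) \<in> partial_homs C F M N"
    and \<theta>: "\<theta> \<in> nat_hom C L K" "\<theta>' \<in> nat_hom C L K"
    and r: "represents \<l> \<k> (S, T, f) \<theta>" "represents \<l> \<k> (S, T, f) \<theta>'"
  shows "\<theta> = \<theta>'"
proof (rule nat_hom_unique[OF _ _ _ \<theta>])
  show "is_module C L" "is_module C K" "separated K" using L K by (auto simp: localization_def)
  fix X a assume X: "X \<in> Obj C" and a: "a \<in> carrier (Grp L X)"
  have "dense_sub C F M S" using p by (simp add: partial_homs_def)
  from localization_dense_image[OF M L this X a]
  show "almost X (\<lambda>Y h. \<theta> Y (Act L X Y h a) = \<theta>' Y (Act L X Y h a))"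
  proof (rule almost_mono[OF _ X])
    fix Y h assume Y: "Y \<in> Obj C" and "Act L X Y h a \<in> \<l> Y ` S Y"
    then obtain x where x: "x \<in> S Y" "Act L X Y h a = \<l> Y x" by blast
    obtain n where "n \<in> f Y x" using partial_hom_nonempty[OF M N p Y x(1)] by blast
    then show "\<theta> Y (Act L X Y h a) = \<theta>' Y (Act L X Y h a)"
      using r Y x by (simp add: represents_def)
  qed
qed

text \<open>\<open>nat_hom_extension\<close> is applied to the graph of \<open>f\<close> transported
  to the localizations. The graph has a dense domain because \<open>S\<close> is dense; the
  essential point is that it is single-valued.\<close>

lemma represents_ex:
  assumes M: "is_module C M" and N: "is_module C N" and L: "localization M L \<l>" and K: "localization N K \<k>"
    and p: "(S, T, f) \<in> partial_homs C F M N"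
  shows "\<exists>\<theta>\<in>nat_hom C L K. represents \<l> \<k> (S, T, f) \<theta>"
proof -
  have Lm: "is_module C L" and \<l>: "\<l> \<in> nat_hom C M L" using L by (auto simp: localization_def)
  have Km: "is_module C K" and \<k>: "\<k> \<in> nat_hom C N K" and sep: "separated K" and glue: "gluing K"
    using K by (auto simp: localization_def)
  note S = partial_hom_dom[OF M N p]
  have cl: "x \<in> carrier (Grp M X)" "n \<in> carrier (Grp N X)" if "X \<in> Obj C" "x \<in> S X" "n \<in> f X x" for X x n
    using submodule_carrier[OF S] partial_hom_coset[OF M N p] that by blast+
  define R where "R X = {(\<l> X x, \<k> X n) | x n. x \<in> S X \<and> n \<in> f X x}" for X
  have R_I: "(\<l> X x, \<k> X n) \<in> R X" if "x \<in> S X" "n \<in> f X x" for X x n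
    using that by (auto simp: R_def)
  have "\<And>X a b. X \<in> Obj C \<Longrightarrow> (a, b) \<in> R X \<Longrightarrow> a \<in> carrier (Grp L X) \<and> b \<in> carrier (Grp K X)"
    using nat_hom_closed[OF \<l>] nat_hom_closed[OF \<k>] cl by (auto simp: R_def)
  moreover have "(\<one>\<^bsub>Grp L X\<^esub>, \<one>\<^bsub>Grp K X\<^esub>) \<in> R X" if X: "X \<in> Obj C" for X
    unfolding R_def
    using nat_hom_one[OF \<l> M Lm X] nat_hom_one[OF \<k> N Km X] submodule_one[OF S X]
      partial_hom_one[OF M N p X] submodule_one[OF partial_hom_ker[OF M N p] X] by force
  moreover have "(a \<otimes>\<^bsub>Grp L X\<^esub> b, c \<otimes>\<^bsub>Grp K X\<^esub> d) \<in> R X"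
    if X: "X \<in> Obj C" and ac: "(a, c) \<in> R X" and bd: "(b, d) \<in> R X" for X a b c d
  proof -
    obtain x n y m where x: "x \<in> S X" "n \<in> f X x" "a = \<l> X x" "c = \<k> X n"
      and y: "y \<in> S X" "m \<in> f X y" "b = \<l> X y" "d = \<k> X m"
      using ac bd by (auto simp: R_def)
    show ?thesis
      using R_I[OF submodule_mult[OF S X x(1) y(1)] partial_hom_mult[OF M N p X x(1) y(1) x(2) y(2)]]
        nat_hom_mult[OF \<l> X cl(1)[OF X x(1,2)] cl(1)[OF X y(1,2)]]
        nat_hom_mult[OF \<k> X cl(2)[OF X x(1,2)] cl(2)[OF X y(1,2)]] x y by simp
  qed
  moreover have "(Act L X Y k a, Act K X Y k b) \<in> R Y"
    if X: "X \<in> Obj C" and Y: "Y \<in> Obj C" and k: "k \<in> Hom C X Y" and ab: "(a, b) \<in> R X" for X Y k a b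
  proof -
    obtain x n where x: "x \<in> S X" "n \<in> f X x" "a = \<l> X x" "b = \<k> X n"
      using ab by (auto simp: R_def)
    show ?thesis
      using R_I[OF submodule_act[OF S X Y k x(1)] partial_hom_act[OF M N p X Y k x(1,2)]]
        nat_hom_act[OF \<l> X Y k cl(1)[OF X x(1,2)]] nat_hom_act[OF \<k> X Y k cl(2)[OF X x(1,2)]] x by simp
  qed
  \<comment> \<open>If \<open>x\<close> and \<open>y\<close> have the same image in
    \<open>L\<close>, then \<open>h x = h y\<close> for almost all \<open>h\<close>. For such
    \<open>h\<close> the elements \<open>h n\<close> and \<open>h m\<close> are values at the same
    point, so they agree up to torsion, and by locality so do \<open>n\<close> and
    \<open>m\<close>.\<close>
  moreover have "c = d" if X: "X \<in> Obj C" and ac: "(a, c) \<in> R X" and ad: "(a, d) \<in> R X" for X a c d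
  proof -
    obtain x n where x: "x \<in> S X" "n \<in> f X x" "a = \<l> X x" "c = \<k> X n" using ac by (auto simp: R_def)
    obtain y m where y: "y \<in> S X" "m \<in> f X y" "a = \<l> X y" "d = \<k> X m" using ad by (auto simp: R_def)
    note c = cl[OF X x(1,2)] cl[OF X y(1,2)]
    have "teq M X x y" using localization_eq_iff[OF M L X c(1,3)] x y by simp
    then have "teq N X n m"
      unfolding teq_def[of M]
    proof (intro teq_local[OF N X c(2,4)], elim almost_mono)
      fix Y h assume Y: "Y \<in> Obj C" and h: "h \<in> Hom C X Y" and eq: "Act M X Y h x = Act M X Y h y"
      have "Act N X Y h n \<in> f Y (Act M X Y h x)" "Act N X Y h m \<in> f Y (Act M X Y h x)"
        using partial_hom_act[OF M N p X Y h x(1,2)] partial_hom_act[OF M N p X Y h y(1,2)] eq by simp_all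
      then show "teq N Y (Act N X Y h n) (Act N X Y h m)"
        using partial_hom_teq[OF M N p Y submodule_act[OF S X Y h x(1)]] by blast
    qed (rule X)
    then show ?thesis using localization_eq_iff[OF N K X c(2,4)] x y by simp
  qed
  moreover have "almost X (\<lambda>Y h. \<exists>b. (Act L X Y h a, b) \<in> R Y)" if X: "X \<in> Obj C" and a: "a \<in> carrier (Grp L X)" for X a
  proof -
    have "dense_sub C F M S" using p by (simp add: partial_homs_def)
    from localization_dense_image[OF M L this X a] X show ?thesis
      by (rule almost_mono) (use partial_hom_nonempty[OF M N p] in \<open>fastforce simp: R_def\<close>)
  qed
  ultimately show ?thesis
  proof (rule nat_hom_extension[OF Lm Km sep glue])
    fix \<theta> assume "\<theta> \<in> nat_hom C L K" "\<And>X a b. \<lbrakk>X \<in> Obj C; (a, b) \<in> R X\<rbrakk> \<Longrightarrow> \<theta> X a = b"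
    then show ?thesis
      unfolding represents_def using R_I by (intro bexI[of _ \<theta>]) auto
  qed
qed

text \<open>A common refinement determines \<open>\<theta>\<close>, because the image of
  \<open>S0\<close> is dense in \<open>L\<close> and \<open>\<k>\<close> kills \<open>T0\<close>.
  Conversely, \<open>S \<inter> S'\<close> together with the whole torsion submodule always serves
  as refinement, since values with the same image in \<open>K\<close> differ by torsion.\<close>

lemma partial_hom_rel_iff:
  assumes M: "is_module C M" and N: "is_module C N" and L: "localization M L \<l>" and K: "localization N K \<k>"
    and p: "(S, T, f) \<in> partial_homs C F M N" and p': "(S', T', f') \<in> partial_homs C F M N"
    and \<theta>: "\<theta> \<in> nat_hom C L K" "\<theta>' \<in> nat_hom C L K"
    and r: "represents \<l> \<k> (S, T, f) \<theta>" "represents \<l> \<k> (S', T', f') \<theta>'"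
  shows "((S, T, f), (S', T', f')) \<in> partial_hom_rel C F M N \<longleftrightarrow> \<theta> = \<theta>'"
proof
  assume "((S, T, f), (S', T', f')) \<in> partial_hom_rel C F M N"
  then obtain S0 T0 where S0: "dense_sub C F M S0" and T0: "torsion_sub C F N T0"
    and sub: "\<And>X. S0 X \<subseteq> S X \<inter> S' X"
    and eq: "\<And>X x. X \<in> Obj C \<Longrightarrow> x \<in> S0 X \<Longrightarrow> T0 X <#>\<^bsub>Grp N X\<^esub> f X x = T0 X <#>\<^bsub>Grp N X\<^esub> f' X x"
    by (auto simp: partial_hom_rel_def)
  have T0s: "submodule C N T0" using T0 by (simp add: torsion_sub_def)
  show "\<theta> = \<theta>'"
  proof (rule nat_hom_unique[OF _ _ _ \<theta>])
    show "is_module C L" "is_module C K" "separated K" using L K by (auto simp: localization_def)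
    fix X a assume X: "X \<in> Obj C" and a: "a \<in> carrier (Grp L X)"
    from localization_dense_image[OF M L S0 X a]
    show "almost X (\<lambda>Y h. \<theta> Y (Act L X Y h a) = \<theta>' Y (Act L X Y h a))"
    proof (rule almost_mono[OF _ X])
      fix Y h assume Y: "Y \<in> Obj C" and "Act L X Y h a \<in> \<l> Y ` S0 Y"
      then obtain x where x: "x \<in> S0 Y" "Act L X Y h a = \<l> Y x" by blast
      interpret G: comm_group "Grp N Y" using module_group N Y by blast
      have xS: "x \<in> S Y" "x \<in> S' Y" using x sub by auto
      obtain n where n: "n \<in> f Y x" using partial_hom_nonempty[OF M N p Y xS(1)] by blast
      note nc = partial_hom_coset(1)[OF M N p Y xS(1) n]
      have "\<one>\<^bsub>Grp N Y\<^esub> \<otimes>\<^bsub>Grp N Y\<^esub> n \<in> T0 Y <#>\<^bsub>Grp N Y\<^esub> f Y x"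
        using submodule_one[OF T0s Y] n unfolding set_mult_def by blast
      then have "n \<in> T0 Y <#>\<^bsub>Grp N Y\<^esub> f' Y x"
        using eq[OF Y x(1)] nc by simp
      then obtain t m where t: "t \<in> T0 Y" and m: "m \<in> f' Y x" and nm: "n = t \<otimes>\<^bsub>Grp N Y\<^esub> m"
        unfolding set_mult_def by blast
      note mc = partial_hom_coset(1)[OF M N p' Y xS(2) m]
      have tc: "t \<in> carrier (Grp N Y)" using submodule_carrier[OF T0s Y t] .
      have "teq N Y t \<one>\<^bsub>Grp N Y\<^esub>" using T0 t Y by (simp add: torsion_sub_iff[OF N])
      then have "teq N Y n m"
        using teq_mult[OF N Y tc mc G.one_closed mc _ teq_refl[OF Y]] mc nm by simp
      then have "\<k> Y n = \<k> Y m" using localization_eq_iff[OF N K Y nc mc] by blast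
      then show "\<theta> Y (Act L X Y h a) = \<theta>' Y (Act L X Y h a)"
        using r Y x xS n m by (simp add: represents_def)
    qed
  qed
next
  assume eq: "\<theta> = \<theta>'"
  have half: "torsion_part N X <#>\<^bsub>Grp N X\<^esub> f X x \<subseteq> torsion_part N X <#>\<^bsub>Grp N X\<^esub> f' X x"
    if p: "(S, T, f) \<in> partial_homs C F M N" and p': "(S', T', f') \<in> partial_homs C F M N"
      and r: "represents \<l> \<k> (S, T, f) \<theta>" "represents \<l> \<k> (S', T', f') \<theta>"
      and X: "X \<in> Obj C" and x: "x \<in> S X" "x \<in> S' X" for S T f S' T' f' X x
  proof
    interpret G: comm_group "Grp N X" using module_group N X by blast
    have tp: "submodule C N (torsion_part N)"
      using torsion_sub_torsion_part[OF N] by (simp add: torsion_sub_def)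
    fix z assume "z \<in> torsion_part N X <#>\<^bsub>Grp N X\<^esub> f X x"
    then obtain t n where t: "t \<in> torsion_part N X" and n: "n \<in> f X x" and z: "z = t \<otimes>\<^bsub>Grp N X\<^esub> n"
      by (auto simp: set_mult_def)
    obtain m where m: "m \<in> f' X x" using partial_hom_nonempty[OF M N p' X x(2)] by blast
    note c = submodule_carrier[OF tp X t] partial_hom_coset(1)[OF M N p X x(1) n]
      partial_hom_coset(1)[OF M N p' X x(2) m]
    have "\<k> X n = \<k> X m" using r X x n m unfolding represents_def by fastforce
    then have "n \<otimes>\<^bsub>Grp N X\<^esub> inv\<^bsub>Grp N X\<^esub> m \<in> torsion_part N X"
      using localization_eq_iff[OF N K X c(2,3)] teq_iff_torsion_part[OF N X c(2,3)] by blast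
    from submodule_mult[OF tp X t this]
    have "t \<otimes>\<^bsub>Grp N X\<^esub> (n \<otimes>\<^bsub>Grp N X\<^esub> inv\<^bsub>Grp N X\<^esub> m) \<in> torsion_part N X" .
    moreover have "z = (t \<otimes>\<^bsub>Grp N X\<^esub> (n \<otimes>\<^bsub>Grp N X\<^esub> inv\<^bsub>Grp N X\<^esub> m)) \<otimes>\<^bsub>Grp N X\<^esub> m"
      using z c by (simp add: G.m_assoc)
    ultimately show "z \<in> torsion_part N X <#>\<^bsub>Grp N X\<^esub> f' X x"
      using m unfolding set_mult_def by blast
  qed
  have dense: "dense_sub C F M (\<lambda>X. S X \<inter> S' X)"
    using dense_sub_inter[OF M] p p' by (simp add: partial_homs_def)
  have T_sub: "T X \<union> T' X \<subseteq> torsion_part N X" for X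
  proof (cases "X \<in> Obj C")
    case True
    then show ?thesis
      using partial_hom_torsion[OF M N p] partial_hom_torsion[OF M N p'] by blast
  next
    case False
    then show ?thesis
      using partial_hom_ker[OF M N p] partial_hom_ker[OF M N p'] by (simp add: submodule_def)
  qed
  have "\<forall>X\<in>Obj C. \<forall>x\<in>S X \<inter> S' X.
    torsion_part N X <#>\<^bsub>Grp N X\<^esub> f X x = torsion_part N X <#>\<^bsub>Grp N X\<^esub> f' X x"
    using half[OF p p' r(1) r(2)[folded eq]] half[OF p' p r(2)[folded eq] r(1)] by blast
  then show "((S, T, f), (S', T', f')) \<in> partial_hom_rel C F M N"
    unfolding partial_hom_rel_def using p p' dense torsion_sub_torsion_part[OF N] T_sub by blast
qed

text \<open>The image of \<open>N\<close> is dense in \<open>K\<close>, so the elements of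
  \<open>M\<close> whose image under \<open>\<theta>\<close> lifts to \<open>N\<close> form a dense
  submodule. The value at such an element is the set of all its lifts, a coset of the torsion
  submodule.\<close>

lemma represents_surj:
  assumes M: "is_module C M" and N: "is_module C N" and L: "localization M L \<l>" and K: "localization N K \<k>"
    and \<theta>: "\<theta> \<in> nat_hom C L K"
  shows "\<exists>p\<in>partial_homs C F M N. represents \<l> \<k> p \<theta>"
proof -
  have Lm: "is_module C L" and \<l>: "\<l> \<in> nat_hom C M L" using L by (auto simp: localization_def)
  have Km: "is_module C K" and \<k>: "\<k> \<in> nat_hom C N K"
    and dK: "\<And>X a. X \<in> Obj C \<Longrightarrow> a \<in> carrier (Grp K X) \<Longrightarrow> almost X (\<lambda>Y h. Act K X Y h a \<in> \<k> Y ` carrier (Grp N Y))"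
    using K by (auto simp: localization_def)
  define S where "S X = (if X \<in> Obj C then {x \<in> carrier (Grp M X). \<theta> X (\<l> X x) \<in> \<k> X ` carrier (Grp N X)} else {})" for X
  define f where "f = (\<lambda>X\<in>Obj C. \<lambda>x\<in>S X. {n \<in> carrier (Grp N X). \<k> X n = \<theta> X (\<l> X x)})"
  have f: "n \<in> f X x \<longleftrightarrow> n \<in> carrier (Grp N X) \<and> \<k> X n = \<theta> X (\<l> X x)" if "X \<in> Obj C" "x \<in> S X" for X x n
    using that by (simp add: f_def)
  have S_f: "x \<in> S X \<longleftrightarrow> x \<in> carrier (Grp M X) \<and> (\<exists>n. n \<in> carrier (Grp N X) \<and> \<k> X n = \<theta> X (\<l> X x))"
    if "X \<in> Obj C" for X x
    using that by (auto simp: S_def image_iff eq_commute)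
  have mult: "n \<otimes>\<^bsub>Grp N X\<^esub> m \<in> carrier (Grp N X) \<and>
      \<k> X (n \<otimes>\<^bsub>Grp N X\<^esub> m) = \<theta> X (\<l> X (x \<otimes>\<^bsub>Grp M X\<^esub> y))"
    if "X \<in> Obj C" "x \<in> carrier (Grp M X)" "y \<in> carrier (Grp M X)"
      "n \<in> carrier (Grp N X)" "m \<in> carrier (Grp N X)" "\<k> X n = \<theta> X (\<l> X x)" "\<k> X m = \<theta> X (\<l> X y)"
    for X x y n m
    using that M N \<l> \<k> \<theta> by (simp add: nat_hom_mult)
  have act: "Act N X Y h n \<in> carrier (Grp N Y) \<and> \<k> Y (Act N X Y h n) = \<theta> Y (\<l> Y (Act M X Y h x))"
    if "X \<in> Obj C" "Y \<in> Obj C" "h \<in> Hom C X Y" "x \<in> carrier (Grp M X)"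
      "n \<in> carrier (Grp N X)" "\<k> X n = \<theta> X (\<l> X x)" for X Y h x n
    using that M N \<l> \<k> \<theta> by (simp add: nat_hom_act)
  have Ss: "submodule C M S"
  proof (rule submoduleI[OF M])
    fix X assume X: "X \<in> Obj C"
    show "\<one>\<^bsub>Grp M X\<^esub> \<in> S X"
      using X M N nat_hom_one[OF \<l> M Lm X] nat_hom_one[OF \<k> N Km X] nat_hom_one[OF \<theta> Lm Km X]
      by (auto simp: S_f intro!: exI[of _ "\<one>\<^bsub>Grp N X\<^esub>"])
    show "x \<otimes>\<^bsub>Grp M X\<^esub> y \<in> S X" if xy: "x \<in> S X" "y \<in> S X" for x y
    proof -
      obtain n m where n: "x \<in> carrier (Grp M X)" "n \<in> carrier (Grp N X)" "\<k> X n = \<theta> X (\<l> X x)"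
        and m: "y \<in> carrier (Grp M X)" "m \<in> carrier (Grp N X)" "\<k> X m = \<theta> X (\<l> X y)"
        using xy X by (auto simp: S_f)
      show ?thesis
        using mult[OF X n(1) m(1) n(2) m(2) n(3) m(3)] n(1) m(1) M X by (auto simp: S_f)
    qed
    fix x assume "x \<in> S X"
    then obtain n where n: "x \<in> carrier (Grp M X)" "n \<in> carrier (Grp N X)" "\<k> X n = \<theta> X (\<l> X x)"
      using X by (auto simp: S_f)
    then show "inv\<^bsub>Grp M X\<^esub> x \<in> S X"
      using X M N \<l> by (auto simp: S_f nat_hom_inv[OF \<l> M Lm X] nat_hom_inv[OF \<k> N Km X]
          nat_hom_inv[OF \<theta> Lm Km X] intro!: exI[of _ "inv\<^bsub>Grp N X\<^esub> n"])
    fix Y h assume "Y \<in> Obj C" "h \<in> Hom C X Y"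
    then show "Act M X Y h x \<in> S Y"
      using act[OF X _ _ n] n M X by (auto simp: S_f)
  qed (auto simp: S_def)
  moreover have "almost X (\<lambda>Y h. Act M X Y h x \<in> S Y)" if X: "X \<in> Obj C" and x: "x \<in> carrier (Grp M X)" for X x
  proof -
    have a: "\<theta> X (\<l> X x) \<in> carrier (Grp K X)" using X x \<l> \<theta> by simp
    show ?thesis
    proof (rule almost_mono[OF dK[OF X a] X])
      fix Y h assume Y: "Y \<in> Obj C" and h: "h \<in> Hom C X Y"
        and "Act K X Y h (\<theta> X (\<l> X x)) \<in> \<k> Y ` carrier (Grp N Y)"
      moreover have "Act K X Y h (\<theta> X (\<l> X x)) = \<theta> Y (\<l> Y (Act M X Y h x))"
        using X Y h x \<l> by (simp add: nat_hom_act[OF \<l>] nat_hom_act[OF \<theta>])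
      ultimately show "Act M X Y h x \<in> S Y"
        using X Y h x M by (simp add: S_def)
    qed
  qed
  ultimately have S: "dense_sub C F M S" by (simp add: dense_sub_iff[OF M])
  have T: "torsion_sub C F N (torsion_part N)" by (rule torsion_sub_torsion_part[OF N])
  have Ts: "submodule C N (torsion_part N)" using T by (simp add: torsion_sub_def)
  have "(S, torsion_part N, f) \<in> partial_homs C F M N"
  proof (rule partial_homI[OF M N S T])
    fix X x assume X: "X \<in> Obj C" and x: "x \<in> S X"
    then obtain n where n: "n \<in> carrier (Grp N X)" "\<k> X n = \<theta> X (\<l> X x)"
      by (auto simp: S_f)
    have "m \<in> f X x \<longleftrightarrow> m \<in> torsion_part N X #>\<^bsub>Grp N X\<^esub> n" for m
      using f[OF X x, of m] n localization_eq_iff[OF N K X _ n(1), of m] teq_iff_torsion_part[OF N X _ n(1), of m]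
        mem_r_coset_iff[OF N Ts X n(1), of m] by auto
    then show "\<exists>n\<in>carrier (Grp N X). f X x = torsion_part N X #>\<^bsub>Grp N X\<^esub> n"
      using n(1) by blast
  next
    fix X x y n m assume X: "X \<in> Obj C" and x: "x \<in> S X" "y \<in> S X" and n: "n \<in> f X x" "m \<in> f X y"
    have "x \<otimes>\<^bsub>Grp M X\<^esub> y \<in> S X" using submodule_mult[OF Ss X x] .
    then show "n \<otimes>\<^bsub>Grp N X\<^esub> m \<in> f X (x \<otimes>\<^bsub>Grp M X\<^esub> y)"
      using mult[OF X, of x y n m] n x X by (simp add: f S_f)
  next
    fix X Y k x n assume X: "X \<in> Obj C" and Y: "Y \<in> Obj C" and k: "k \<in> Hom C X Y"
      and x: "x \<in> S X" and n: "n \<in> f X x"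
    have "Act M X Y k x \<in> S Y" using submodule_act[OF Ss X Y k x] .
    then show "Act N X Y k n \<in> f Y (Act M X Y k x)"
      using act[OF X Y k, of x n] n x X Y by (simp add: f S_f)
  qed (auto simp: f_def)
  moreover have "represents \<l> \<k> (S, torsion_part N, f) \<theta>"
    by (simp add: represents_def f)
  ultimately show ?thesis by blast
qed

section \<open>Identities and composites of partial homomorphisms\<close>

lemma partial_ide:
  assumes M: "is_module C M" and L: "localization M L \<l>"
  shows "partial_ide C M \<in> partial_homs C F M M" "represents \<l> \<l> (partial_ide C M) (Ide (Mod_cat U C) L)"
proof -
  have \<l>: "\<l> \<in> nat_hom C M L" using L by (auto simp: localization_def)
  have one: "{\<one>\<^bsub>Grp M X\<^esub>} #>\<^bsub>Grp M X\<^esub> x = {x}" if "X \<in> Obj C" "x \<in> carrier (Grp M X)" for X x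
  proof -
    interpret G: comm_group "Grp M X" using module_group M that by blast
    show ?thesis using that by (simp add: r_coset_def)
  qed
  show "partial_ide C M \<in> partial_homs C F M M"
    unfolding partial_ide_def
  proof (rule partial_homI[OF M M])
    show "dense_sub C F M (\<lambda>X. if X \<in> Obj C then carrier (Grp M X) else {})"
      unfolding dense_sub_iff[OF M] using M
      by (auto intro!: submoduleI[OF M] almost_all simp: module_inv_closed split: if_splits)
    have "inv\<^bsub>Grp M X\<^esub> \<one>\<^bsub>Grp M X\<^esub> = \<one>\<^bsub>Grp M X\<^esub>"
      "\<one>\<^bsub>Grp M X\<^esub> \<otimes>\<^bsub>Grp M X\<^esub> \<one>\<^bsub>Grp M X\<^esub> = \<one>\<^bsub>Grp M X\<^esub>" if "X \<in> Obj C" for X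
    proof -
      interpret G: comm_group "Grp M X" using module_group M that by blast
      show "inv\<^bsub>Grp M X\<^esub> \<one>\<^bsub>Grp M X\<^esub> = \<one>\<^bsub>Grp M X\<^esub>"
        "\<one>\<^bsub>Grp M X\<^esub> \<otimes>\<^bsub>Grp M X\<^esub> \<one>\<^bsub>Grp M X\<^esub> = \<one>\<^bsub>Grp M X\<^esub>" by simp_all
    qed
    then show "torsion_sub C F M (\<lambda>X. if X \<in> Obj C then {\<one>\<^bsub>Grp M X\<^esub>} else {})"
      unfolding torsion_sub_iff[OF M] using M
      by (auto intro!: submoduleI[OF M] simp: act_one split: if_splits)
  qed (use M in \<open>auto simp: one\<close>)
  show "represents \<l> \<l> (partial_ide C M) (Ide (Mod_cat U C) L)"
    using nat_hom_closed[OF \<l>] by (auto simp: represents_def partial_ide_def one)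
qed

text \<open>The new domain is dense by \<open>almost_local\<close>: an element is first moved into
  \<open>S\<close>, and then one of its values into \<open>S'\<close>. The new submodule of
  \<open>P\<close> is torsion: an \<open>n\<close> in \<open>T\<close> is annihilated by almost all
  arrows, which therefore carry every value of \<open>g\<close> at \<open>n\<close> into
  \<open>T'\<close>, and \<open>T'\<close> is torsion.\<close>

lemma partial_comp:
  assumes M: "is_module C M" and N: "is_module C N" and P: "is_module C P"
    and a: "(S, T, f) \<in> partial_homs C F M N" and b: "(S', T', g) \<in> partial_homs C F N P"
  shows "partial_comp C (S', T', g) (S, T, f) \<in> partial_homs C F M P"
proof -
  define D where "D X = {x \<in> S X. f X x \<inter> S' X \<noteq> {}}" for X
  define T'' where "T'' X = (\<Union>n\<in>T X \<inter> S' X. g X n)" for X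
  define k where "k = (\<lambda>X\<in>Obj C. \<lambda>x\<in>D X. \<Union>n\<in>f X x \<inter> S' X. g X n)"
  note S = partial_hom_dom[OF M N a] and S' = partial_hom_dom[OF N P b]
    and T = partial_hom_ker[OF M N a] and T' = partial_hom_ker[OF N P b]
  have comp: "partial_comp C (S', T', g) (S, T, f) = (D, T'', k)"
    by (simp add: partial_comp_def D_def T''_def k_def Let_def fun_eq_iff)
  have D_I: "x \<in> D X" if "x \<in> S X" "n \<in> f X x" "n \<in> S' X" for X x n
    using that by (auto simp: D_def)
  have T''_I: "p \<in> T'' X" if "n \<in> T X" "n \<in> S' X" "p \<in> g X n" for X n p
    using that by (auto simp: T''_def)
  have Ds: "submodule C M D"
  proof (rule submoduleI[OF M])
    fix X assume X: "X \<in> Obj C"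
    show "x \<in> carrier (Grp M X)" if "x \<in> D X" for x
      using that submodule_carrier[OF S X] by (simp add: D_def)
    show "\<one>\<^bsub>Grp M X\<^esub> \<in> D X"
      using D_I[of "\<one>\<^bsub>Grp M X\<^esub>" X "\<one>\<^bsub>Grp N X\<^esub>"] submodule_one[OF S X] submodule_one[OF T X]
        submodule_one[OF S' X] partial_hom_one[OF M N a X] by simp
    show "x \<otimes>\<^bsub>Grp M X\<^esub> y \<in> D X" if xy: "x \<in> D X" "y \<in> D X" for x y
    proof -
      obtain n m where n: "x \<in> S X" "n \<in> f X x" "n \<in> S' X" and m: "y \<in> S X" "m \<in> f X y" "m \<in> S' X"
        using xy by (auto simp: D_def)
      show ?thesis
        by (rule D_I[OF submodule_mult[OF S X n(1) m(1)]
              partial_hom_mult[OF M N a X n(1) m(1) n(2) m(2)] submodule_mult[OF S' X n(3) m(3)]])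
    qed
    fix x assume "x \<in> D X"
    then obtain n where n: "x \<in> S X" "n \<in> f X x" "n \<in> S' X" by (auto simp: D_def)
    show "inv\<^bsub>Grp M X\<^esub> x \<in> D X"
      by (rule D_I[OF submodule_inv[OF S X n(1)] partial_hom_inv[OF M N a X n(1,2)]
            submodule_inv[OF S' X n(3)]])
    fix Y h assume Y: "Y \<in> Obj C" and h: "h \<in> Hom C X Y"
    show "Act M X Y h x \<in> D Y"
      by (rule D_I[OF submodule_act[OF S X Y h n(1)] partial_hom_act[OF M N a X Y h n(1,2)]
            submodule_act[OF S' X Y h n(3)]])
  next
    fix X assume "X \<notin> Obj C"
    then show "D X = {}" using S by (simp add: D_def submodule_def)
  qed
  have T''s: "submodule C P T''"
  proof (rule submoduleI[OF P])
    fix X assume X: "X \<in> Obj C"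
    show "p \<in> carrier (Grp P X)" if "p \<in> T'' X" for p
      using that partial_hom_coset(1)[OF N P b X] by (auto simp: T''_def)
    show "\<one>\<^bsub>Grp P X\<^esub> \<in> T'' X"
      using T''_I[of "\<one>\<^bsub>Grp N X\<^esub>" X "\<one>\<^bsub>Grp P X\<^esub>"] submodule_one[OF T X] submodule_one[OF T' X]
        submodule_one[OF S' X] partial_hom_one[OF N P b X] by simp
    show "p \<otimes>\<^bsub>Grp P X\<^esub> q \<in> T'' X" if pq: "p \<in> T'' X" "q \<in> T'' X" for p q
    proof -
      obtain n m where n: "n \<in> T X" "n \<in> S' X" "p \<in> g X n" and m: "m \<in> T X" "m \<in> S' X" "q \<in> g X m"
        using pq by (auto simp: T''_def)
      show ?thesis
        by (rule T''_I[OF submodule_mult[OF T X n(1) m(1)] submodule_mult[OF S' X n(2) m(2)]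
              partial_hom_mult[OF N P b X n(2) m(2) n(3) m(3)]])
    qed
    fix p assume "p \<in> T'' X"
    then obtain n where n: "n \<in> T X" "n \<in> S' X" "p \<in> g X n"
      by (auto simp: T''_def)
    show "inv\<^bsub>Grp P X\<^esub> p \<in> T'' X"
      by (rule T''_I[OF submodule_inv[OF T X n(1)] submodule_inv[OF S' X n(2)]
            partial_hom_inv[OF N P b X n(2,3)]])
    fix Y h assume Y: "Y \<in> Obj C" and h: "h \<in> Hom C X Y"
    show "Act P X Y h p \<in> T'' Y"
      by (rule T''_I[OF submodule_act[OF T X Y h n(1)] submodule_act[OF S' X Y h n(2)]
            partial_hom_act[OF N P b X Y h n(2,3)]])
  next
    fix X assume "X \<notin> Obj C"
    then show "T'' X = {}" using T by (simp add: T''_def submodule_def)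
  qed
  have dense: "dense_sub C F M D"
    unfolding dense_sub_iff[OF M]
  proof (intro conjI ballI Ds)
    fix X x assume X: "X \<in> Obj C" and x: "x \<in> carrier (Grp M X)"
    show "almost X (\<lambda>Y h. Act M X Y h x \<in> D Y)"
    proof (rule almost_local[OF X ideal_pred_submodule[OF M X x Ds] partial_hom_dense[OF M N a X x]])
      fix Y h assume Y: "Y \<in> Obj C" and h: "h \<in> Hom C X Y" and hx: "Act M X Y h x \<in> S Y"
      obtain n where n: "n \<in> f Y (Act M X Y h x)" using partial_hom_nonempty[OF M N a Y hx] by blast
      have nc: "n \<in> carrier (Grp N Y)" using partial_hom_coset(1)[OF M N a Y hx n] .
      show "almost Y (\<lambda>Z l. Act M X Z (Comp C X Y Z l h) x \<in> D Z)"
      proof (rule almost_mono[OF partial_hom_dense[OF N P b Y nc] Y])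
        fix Z l assume Z: "Z \<in> Obj C" and l: "l \<in> Hom C Y Z" and "Act N Y Z l n \<in> S' Z"
        then have "Act M Y Z l (Act M X Y h x) \<in> D Z"
          using D_I submodule_act[OF S Y Z l hx] partial_hom_act[OF M N a Y Z l hx n] by blast
        then show "Act M X Z (Comp C X Y Z l h) x \<in> D Z"
          using act_comp[OF M X Y Z h l x] by simp
      qed
    qed
  qed
  have torsion: "torsion_sub C F P T''"
    unfolding torsion_sub_iff[OF P]
  proof (intro conjI ballI T''s)
    fix X p assume X: "X \<in> Obj C" and p: "p \<in> T'' X"
    then obtain n where n: "n \<in> T X" "n \<in> S' X" and pn: "p \<in> g X n" by (auto simp: T''_def)
    have pc: "p \<in> carrier (Grp P X)" using submodule_carrier[OF T''s X p] .
    have "almost X (\<lambda>Y h. Act N X Y h n = Act N X Y h \<one>\<^bsub>Grp N X\<^esub>)"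
      using partial_hom_torsion[OF M N a X n(1)] X by (simp add: torsion_part_def teq_def)
    then show "teq P X p \<one>\<^bsub>Grp P X\<^esub>"
    proof (intro teq_local[OF P X pc module_one_closed[OF P X]], elim almost_mono)
      fix Y h assume Y: "Y \<in> Obj C" and h: "h \<in> Hom C X Y"
        and "Act N X Y h n = Act N X Y h \<one>\<^bsub>Grp N X\<^esub>"
      then have "Act P X Y h p \<in> T' Y"
        using partial_hom_act[OF N P b X Y h n(2) pn] act_one[OF N X Y h] partial_hom_one[OF N P b Y] by simp
      then show "teq P Y (Act P X Y h p) (Act P X Y h \<one>\<^bsub>Grp P X\<^esub>)"
        using partial_hom_torsion[OF N P b Y] Y act_one[OF P X Y h] by (simp add: torsion_part_def)
    qed (rule X)
  qed
  have k: "p \<in> k X x \<longleftrightarrow> (\<exists>n. n \<in> f X x \<and> n \<in> S' X \<and> p \<in> g X n)" if "X \<in> Obj C" "x \<in> D X" for X x p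
    using that by (auto simp: k_def)
  have "(D, T'', k) \<in> partial_homs C F M P"
  proof (rule partial_homI[OF M P dense torsion])
    fix X x assume X: "X \<in> Obj C" and x: "x \<in> D X"
    interpret GN: comm_group "Grp N X" using module_group N X by blast
    interpret GP: comm_group "Grp P X" using module_group P X by blast
    obtain n where xS: "x \<in> S X" and n: "n \<in> f X x" "n \<in> S' X" using x by (auto simp: D_def)
    obtain p where p: "p \<in> g X n" using partial_hom_nonempty[OF N P b X n(2)] by blast
    have nc: "n \<in> carrier (Grp N X)" and pc: "p \<in> carrier (Grp P X)"
      using partial_hom_coset(1)[OF M N a X xS n(1)] partial_hom_coset(1)[OF N P b X n(2) p] by auto
    \<comment> \<open>Two values of \<open>f\<close> at \<open>x\<close> that lie in
      \<open>S'\<close> differ by an element of \<open>T \<inter> S'\<close>, so values of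
      \<open>g\<close> at them differ by an element of \<open>T''\<close>. Conversely, translating
      by \<open>T''\<close> amounts to translating the intermediate value by
      \<open>T \<inter> S'\<close>.\<close>
    have "k X x = T'' X #>\<^bsub>Grp P X\<^esub> p"
    proof (intro equalityI subsetI)
      fix q assume "q \<in> k X x"
      then obtain m where m: "m \<in> f X x" "m \<in> S' X" and q: "q \<in> g X m" using k[OF X x] by blast
      have "m \<otimes>\<^bsub>Grp N X\<^esub> inv\<^bsub>Grp N X\<^esub> n \<in> T X"
        using partial_hom_diff[OF M N a X xS m(1) n(1)] .
      moreover have "m \<otimes>\<^bsub>Grp N X\<^esub> inv\<^bsub>Grp N X\<^esub> n \<in> S' X"
        using submodule_mult[OF S' X m(2) submodule_inv[OF S' X n(2)]] .
      moreover have "q \<otimes>\<^bsub>Grp P X\<^esub> inv\<^bsub>Grp P X\<^esub> p \<in> g X (m \<otimes>\<^bsub>Grp N X\<^esub> inv\<^bsub>Grp N X\<^esub> n)"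
        using partial_hom_mult[OF N P b X m(2) submodule_inv[OF S' X n(2)] q
            partial_hom_inv[OF N P b X n(2) p]] .
      ultimately have "q \<otimes>\<^bsub>Grp P X\<^esub> inv\<^bsub>Grp P X\<^esub> p \<in> T'' X" by (rule T''_I)
      then show "q \<in> T'' X #>\<^bsub>Grp P X\<^esub> p"
        using mem_r_coset_iff[OF P T''s X pc, of q] partial_hom_coset(1)[OF N P b X m(2) q] by blast
    next
      fix q assume "q \<in> T'' X #>\<^bsub>Grp P X\<^esub> p"
      then obtain t where "t \<in> T'' X" and q: "q = t \<otimes>\<^bsub>Grp P X\<^esub> p" by (auto simp: r_coset_def)
      then obtain m where m: "m \<in> T X" "m \<in> S' X" "t \<in> g X m" by (auto simp: T''_def)
      have "m \<otimes>\<^bsub>Grp N X\<^esub> n \<in> f X x" using partial_hom_translate[OF M N a X xS n(1) m(1)] .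
      moreover have "m \<otimes>\<^bsub>Grp N X\<^esub> n \<in> S' X" using submodule_mult[OF S' X m(2) n(2)] .
      moreover have "q \<in> g X (m \<otimes>\<^bsub>Grp N X\<^esub> n)"
        using partial_hom_mult[OF N P b X m(2) n(2) m(3) p] q by simp
      ultimately show "q \<in> k X x" using k[OF X x] by blast
    qed
    then show "\<exists>p\<in>carrier (Grp P X). k X x = T'' X #>\<^bsub>Grp P X\<^esub> p" using pc by blast
  next
    fix X x y p q assume X: "X \<in> Obj C" and x: "x \<in> D X" and y: "y \<in> D X" and p: "p \<in> k X x" and q: "q \<in> k X y"
    obtain n m where n: "n \<in> f X x" "n \<in> S' X" "p \<in> g X n" and m: "m \<in> f X y" "m \<in> S' X" "q \<in> g X m"
      using p q k[OF X x] k[OF X y] by blast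
    have xy: "x \<in> S X" "y \<in> S X" using x y by (auto simp: D_def)
    show "p \<otimes>\<^bsub>Grp P X\<^esub> q \<in> k X (x \<otimes>\<^bsub>Grp M X\<^esub> y)"
      unfolding k[OF X submodule_mult[OF Ds X x y]]
      using partial_hom_mult[OF M N a X xy n(1) m(1)] partial_hom_mult[OF N P b X n(2) m(2) n(3) m(3)]
        submodule_mult[OF S' X n(2) m(2)] by blast
  next
    fix X Y h x p assume X: "X \<in> Obj C" and Y: "Y \<in> Obj C" and h: "h \<in> Hom C X Y" and x: "x \<in> D X" and p: "p \<in> k X x"
    obtain n where n: "n \<in> f X x" "n \<in> S' X" "p \<in> g X n"
      using p k[OF X x] by blast
    have xS: "x \<in> S X" using x by (auto simp: D_def)
    show "Act P X Y h p \<in> k Y (Act M X Y h x)"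
      unfolding k[OF Y submodule_act[OF Ds X Y h x]]
      using partial_hom_act[OF M N a X Y h xS n(1)] partial_hom_act[OF N P b X Y h n(2,3)]
        submodule_act[OF S' X Y h n(2)] by blast
  qed (auto simp: k_def)
  then show ?thesis by (simp add: comp)
qed

text \<open>A value of the composite comes with an intermediate value in \<open>N\<close>, along
  which the two commuting squares are pasted.\<close>

lemma represents_comp:
  assumes M: "is_module C M" and N: "is_module C N" and L: "localization M L \<l>"
    and a: "(S, T, f) \<in> partial_homs C F M N" "represents \<l> \<k> (S, T, f) \<theta>"
    and b: "represents \<k> \<m> (S', T', g) \<theta>'"
  shows "represents \<l> \<m> (partial_comp C (S', T', g) (S, T, f)) (Comp (Mod_cat U C) L K Q \<theta>' \<theta>)"
proof -
  have \<l>: "\<l> \<in> nat_hom C M L" using L by (auto simp: localization_def)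
  have "\<l> X x \<in> carrier (Grp L X)" if "X \<in> Obj C" "x \<in> S X" for X x
    using nat_hom_closed[OF \<l> that(1)] submodule_carrier[OF partial_hom_dom[OF M N a(1)] that] .
  then show ?thesis
    using a(2) b by (fastforce simp: represents_def partial_comp_def Let_def)
qed

end

section \<open>The equivalence\<close>

text \<open>\<open>B\<close> is not assumed to be a category: its axioms, too, are pulled back along \<open>\<Phi>\<close>.\<close>

lemma equivalent_categories_reflection:
  assumes A: "category A" and sub: "Obj A \<subseteq> Obj B"
    and L: "\<And>X. X \<in> Obj B \<Longrightarrow> L X \<in> Obj A" and fixed: "\<And>X. X \<in> Obj A \<Longrightarrow> L X = X"
    and bij: "\<And>X Y. \<lbrakk>X \<in> Obj B; Y \<in> Obj B\<rbrakk> \<Longrightarrow> bij_betw (\<Phi> X Y) (Hom B X Y) (Hom A (L X) (L Y))"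
    and comp_in: "\<And>X Y Z f g. \<lbrakk>X \<in> Obj B; Y \<in> Obj B; Z \<in> Obj B; f \<in> Hom B X Y; g \<in> Hom B Y Z\<rbrakk>
      \<Longrightarrow> Comp B X Y Z g f \<in> Hom B X Z"
    and comp: "\<And>X Y Z f g. \<lbrakk>X \<in> Obj B; Y \<in> Obj B; Z \<in> Obj B; f \<in> Hom B X Y; g \<in> Hom B Y Z\<rbrakk>
      \<Longrightarrow> \<Phi> X Z (Comp B X Y Z g f) = Comp A (L X) (L Y) (L Z) (\<Phi> Y Z g) (\<Phi> X Y f)"
    and ide_in: "\<And>X. X \<in> Obj B \<Longrightarrow> Ide B X \<in> Hom B X X"
    and ide: "\<And>X. X \<in> Obj B \<Longrightarrow> \<Phi> X X (Ide B X) = Ide A (L X)"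
  shows "equivalent_categories A B"
proof -
  interpret A: category A by fact
  define \<Psi> where "\<Psi> X Y = inv_into (Hom B X Y) (\<Phi> X Y)" for X Y
  have \<Phi>: "\<Phi> X Y f \<in> Hom A (L X) (L Y)" if "X \<in> Obj B" "Y \<in> Obj B" "f \<in> Hom B X Y" for X Y f
    using bij[OF that(1,2)] that(3) by (rule bij_betwE[THEN bspec])
  \<comment> \<open>By faithfulness every equation between arrows of \<open>B\<close> is checked in
    \<open>A\<close> after applying \<open>\<Phi>\<close>.\<close>
  have eqI: "f = g" if "X \<in> Obj B" "Y \<in> Obj B" "f \<in> Hom B X Y" "g \<in> Hom B X Y" "\<Phi> X Y f = \<Phi> X Y g"
    for X Y f g
    using bij[OF that(1,2)] that(3-5) by (auto simp: bij_betw_def dest: inj_onD)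
  have \<Psi>: "\<Psi> X Y f \<in> Hom B X Y" "\<Phi> X Y (\<Psi> X Y f) = f"
    if "X \<in> Obj B" "Y \<in> Obj B" "f \<in> Hom A (L X) (L Y)" for X Y f
    using bij[OF that(1,2)] that(3) unfolding \<Psi>_def bij_betw_def
    by (metis inv_into_into, metis f_inv_into_f)
  have LL: "L (L X) = L X" "L X \<in> Obj B" if "X \<in> Obj B" for X
    using that L fixed sub by auto
  have Obj_B: "X \<in> Obj B" if "X \<in> Obj A" for X
    using that sub by auto
  have B: "category B"
  proof
    fix X Y f assume "X \<in> Obj B" "Y \<in> Obj B" "f \<in> Hom B X Y"
    then show "Comp B X X Y f (Ide B X) = f" "Comp B X Y Y (Ide B Y) f = f"
      by (auto intro!: eqI[of X Y] simp: comp_in comp ide_in ide L \<Phi> A.comp_ide_right A.comp_ide_left)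
  next
    fix W X Y Z f g h
    assume "W \<in> Obj B" "X \<in> Obj B" "Y \<in> Obj B" "Z \<in> Obj B"
      "f \<in> Hom B W X" "g \<in> Hom B X Y" "h \<in> Hom B Y Z"
    then show "Comp B W Y Z h (Comp B W X Y g f) = Comp B W X Z (Comp B X Y Z h g) f"
      by (intro eqI[of W Z]) (simp_all add: comp_in comp L \<Phi> A.comp_assoc)
  qed (fact ide_in comp_in)+
  have "is_functor B A L \<Phi>"
    unfolding is_functor_def by (simp add: L \<Phi> ide comp)
  moreover have "is_functor A B (\<lambda>X. X) \<Psi>"
    unfolding is_functor_def
  proof (intro conjI ballI)
    fix X assume X: "X \<in> Obj A"
    show "X \<in> Obj B" using X sub by auto
    show "\<Psi> X X (Ide A X) = Ide B X"
      using X Obj_B[OF X] by (intro eqI[of X X]) (simp_all add: \<Psi> ide ide_in fixed A.ide_in_hom)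
  next
    fix X Y f assume "X \<in> Obj A" "Y \<in> Obj A" "f \<in> Hom A X Y"
    then show "\<Psi> X Y f \<in> Hom B X Y" by (simp add: \<Psi> Obj_B fixed)
  next
    fix X Y Z f g assume "X \<in> Obj A" "Y \<in> Obj A" "Z \<in> Obj A" "f \<in> Hom A X Y" "g \<in> Hom A Y Z"
    then show "\<Psi> X Z (Comp A X Y Z g f) = Comp B X Y Z (\<Psi> Y Z g) (\<Psi> X Y f)"
      by (intro eqI[of X Z]) (simp_all add: Obj_B \<Psi> comp comp_in fixed A.comp_in_hom)
  qed
  moreover have "natural_iso A A (\<lambda>X. X) (\<lambda>X Y f. f) (\<lambda>X. L X) (\<lambda>X Y f. \<Phi> X Y (\<Psi> X Y f)) (Ide A)"
    unfolding natural_iso_def iso_arrow_def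
    by (auto simp: fixed \<Psi> Obj_B A.ide_in_hom A.comp_ide_left A.comp_ide_right
        intro!: bexI[of _ "Ide A _"])
  \<comment> \<open>Since \<open>L (L X) = L X\<close>, the identity of \<open>L X\<close> has a
    preimage under \<open>\<Phi>\<close> among the arrows from \<open>L X\<close> to
    \<open>X\<close> as well as in the opposite direction. These two arrows are mutually
    inverse.\<close>
  moreover have "natural_iso B B (\<lambda>X. L X) (\<lambda>X Y f. \<Psi> (L X) (L Y) (\<Phi> X Y f)) (\<lambda>X. X) (\<lambda>X Y f. f)
    (\<lambda>X. \<Psi> (L X) X (Ide A (L X)))"
    unfolding natural_iso_def iso_arrow_def
  proof (intro conjI ballI)
    fix X assume X: "X \<in> Obj B"
    have i: "Ide A (L X) \<in> Hom A (L X) (L X)" using X L A.ide_in_hom by blast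
    show "\<Psi> (L X) X (Ide A (L X)) \<in> Hom B (L X) X" using X i by (simp add: \<Psi> LL)
    show "\<exists>g\<in>Hom B X (L X). Comp B (L X) X (L X) g (\<Psi> (L X) X (Ide A (L X))) = Ide B (L X) \<and>
      Comp B X (L X) X (\<Psi> (L X) X (Ide A (L X))) g = Ide B X"
    proof (intro bexI conjI)
      show *: "\<Psi> X (L X) (Ide A (L X)) \<in> Hom B X (L X)" using X i by (simp add: \<Psi> LL)
      show "Comp B (L X) X (L X) (\<Psi> X (L X) (Ide A (L X))) (\<Psi> (L X) X (Ide A (L X))) = Ide B (L X)"
        using X i * L by (intro eqI[of "L X" "L X"]) (simp_all add: \<Psi> LL comp comp_in ide ide_in A.comp_ide_left)
      show "Comp B X (L X) X (\<Psi> (L X) X (Ide A (L X))) (\<Psi> X (L X) (Ide A (L X))) = Ide B X"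
        using X i * L by (intro eqI[of X X]) (simp_all add: \<Psi> LL comp comp_in ide ide_in A.comp_ide_left)
    qed
  next
    fix X Y f assume "X \<in> Obj B" "Y \<in> Obj B" "f \<in> Hom B X Y"
    then show "Comp B (L X) (L Y) Y (\<Psi> (L Y) Y (Ide A (L Y))) (\<Psi> (L X) (L Y) (\<Phi> X Y f)) =
      Comp B (L X) X Y f (\<Psi> (L X) X (Ide A (L X)))"
      by (intro eqI[of "L X" Y])
        (simp_all add: \<Psi> \<Phi> LL L comp comp_in A.ide_in_hom A.comp_ide_left A.comp_ide_right)
  qed
  ultimately show ?thesis
    unfolding equivalent_categories_def using A B by blast
qed

text \<open>\<open>t\<close> is constant on the classes of its own kernel relation. The image of a
  class is thus a singleton, and \<open>the_elem\<close> reads off the map induced on the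
  quotient.\<close>

lemma quotient_kernel:
  assumes R: "R = {(p, q). p \<in> P \<and> q \<in> P \<and> t p = t q}"
  shows "c \<in> P // R \<longleftrightarrow> (\<exists>p\<in>P. c = R `` {p})" "p \<in> P \<Longrightarrow> the_elem (t ` (R `` {p})) = t p"
    "bij_betw (\<lambda>c. the_elem (t ` c)) (P // R) (t ` P)"
proof -
  show 1: "c \<in> P // R \<longleftrightarrow> (\<exists>p\<in>P. c = R `` {p})" for c
    by (auto simp: quotient_def)
  show 2: "the_elem (t ` (R `` {p})) = t p" if "p \<in> P" for p
  proof -
    have "t ` (R `` {p}) = {t p}" using that by (auto simp: R)
    then show ?thesis by simp
  qed
  have 3: "R `` {p} = R `` {q}" if "p \<in> P" "q \<in> P" "t p = t q" for p q
    using that by (auto simp: R)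
  have 4: "P // R = (\<lambda>p. R `` {p}) ` P"
    by (auto simp: quotient_def)
  show "bij_betw (\<lambda>c. the_elem (t ` c)) (P // R) (t ` P)"
    unfolding bij_betw_def
  proof
    show "inj_on (\<lambda>c. the_elem (t ` c)) (P // R)"
      unfolding 4
    proof (rule inj_onI, elim imageE)
      fix c d p q assume p: "c = R `` {p}" "p \<in> P" and q: "d = R `` {q}" "q \<in> P"
        and "the_elem (t ` c) = the_elem (t ` d)"
      then have "t p = t q" using 2[OF p(2)] 2[OF q(2)] by simp
      then show "c = d" using 3[OF p(2) q(2)] p(1) q(1) by simp
    qed
    show "(\<lambda>c. the_elem (t ` c)) ` (P // R) = t ` P"
      unfolding 4 image_image by (rule image_cong) (simp_all add: 2)
  qed
qed

context gabriel_modules begin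

text \<open>\<open>loc\<close> and \<open>\<l>\<close> stand for any choice of localizations that
  keeps closed modules fixed. The comparison functor sends the class of a partial homomorphism to
  the homomorphism \<open>\<tau>\<close> that it represents.\<close>

lemma equivalence:
  fixes loc :: "('o, 'm, 'u) cmod \<Rightarrow> ('o, 'm, 'u) cmod"
  assumes loc: "\<And>M. M \<in> Obj (Mod_cat U C) \<Longrightarrow> loc M \<in> Obj (closed_Mod_cat U C F)"
    "\<And>M. M \<in> Obj (closed_Mod_cat U C F) \<Longrightarrow> loc M = M"
    "\<And>M. M \<in> Obj (Mod_cat U C) \<Longrightarrow> localization M (loc M) (\<l> M)"
  shows "equivalent_categories (closed_Mod_cat U C F) (Serre_quotient U C F)"
proof -
  let ?A = "closed_Mod_cat U C F" and ?B = "Serre_quotient U C F"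
  have A_simps: "Obj ?A = {M \<in> Obj (Mod_cat U C). closed_module C F M}" "Hom ?A = nat_hom C"
    "Comp ?A = Comp (Mod_cat U C)" "Ide ?A = Ide (Mod_cat U C)"
    by (simp_all add: closed_Mod_cat_def Mod_cat_def)
  have B_simps: "Obj ?B = Obj (Mod_cat U C)"
    "Hom ?B = (\<lambda>M N. partial_homs C F M N // partial_hom_rel C F M N)"
    "Comp ?B = (\<lambda>M N P \<psi> \<phi>. \<Union>b\<in>\<psi>. \<Union>a\<in>\<phi>. partial_hom_rel C F M P `` {partial_comp C b a})"
    "Ide ?B = (\<lambda>M. partial_hom_rel C F M M `` {partial_ide C M})"
    by (simp_all add: Serre_quotient_def)
  interpret Mod: category "Mod_cat U C" by (rule category_Mod_cat)
  have catA: "category ?A"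
    unfolding category_def A_simps
    using Mod.ide_in_hom Mod.comp_in_hom Mod.comp_ide_left Mod.comp_ide_right Mod.comp_assoc
    by simp
  have mod: "is_module C M" "is_module C (loc M)" if "M \<in> Obj (Mod_cat U C)" for M
    using that loc(1)[OF that] by (auto simp: A_simps)
  define \<tau> where "\<tau> M N p = (THE \<theta>. \<theta> \<in> nat_hom C (loc M) (loc N) \<and> represents (\<l> M) (\<l> N) p \<theta>)" for M N p
  have \<tau>: "\<tau> M N p = \<theta>"
    if "M \<in> Obj (Mod_cat U C)" "N \<in> Obj (Mod_cat U C)" "p \<in> partial_homs C F M N"
      "\<theta> \<in> nat_hom C (loc M) (loc N)" "represents (\<l> M) (\<l> N) p \<theta>" for M N p \<theta>
    unfolding \<tau>_def
    using that represents_unique[OF mod(1)[OF that(1)] mod(1)[OF that(2)] loc(3)[OF that(1)] loc(3)[OF that(2)]]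
    by (cases p) (blast intro: the_equality)
  have \<tau>_rep: "\<tau> M N p \<in> nat_hom C (loc M) (loc N)" "represents (\<l> M) (\<l> N) p (\<tau> M N p)"
    if M: "M \<in> Obj (Mod_cat U C)" and N: "N \<in> Obj (Mod_cat U C)" and p: "p \<in> partial_homs C F M N" for M N p
  proof -
    obtain \<theta> where "\<theta> \<in> nat_hom C (loc M) (loc N)" "represents (\<l> M) (\<l> N) p \<theta>"
      using represents_ex[OF mod(1)[OF M] mod(1)[OF N] loc(3)[OF M] loc(3)[OF N]] p by (cases p) blast
    with \<tau>[OF M N p this] show "\<tau> M N p \<in> nat_hom C (loc M) (loc N)"
      "represents (\<l> M) (\<l> N) p (\<tau> M N p)" by simp_all
  qed
  \<comment> \<open>As the kernel of \<open>\<tau>\<close>, the relation is an equivalence, in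
    particular transitive.\<close>
  have rel: "partial_hom_rel C F M N =
      {(p, q). p \<in> partial_homs C F M N \<and> q \<in> partial_homs C F M N \<and> \<tau> M N p = \<tau> M N q}"
    if M: "M \<in> Obj (Mod_cat U C)" and N: "N \<in> Obj (Mod_cat U C)" for M N
  proof -
    have 1: "(p, q) \<in> partial_hom_rel C F M N \<longleftrightarrow> \<tau> M N p = \<tau> M N q"
      if p: "p \<in> partial_homs C F M N" and q: "q \<in> partial_homs C F M N" for p q
      using partial_hom_rel_iff[OF mod(1)[OF M] mod(1)[OF N] loc(3)[OF M] loc(3)[OF N] _ _
          \<tau>_rep(1)[OF M N p] \<tau>_rep(1)[OF M N q]] \<tau>_rep(2)[OF M N p] \<tau>_rep(2)[OF M N q] p q
      by (cases p, cases q) simp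
    have 2: "p \<in> partial_homs C F M N \<and> q \<in> partial_homs C F M N"
      if "(p, q) \<in> partial_hom_rel C F M N" for p q
      using that by (auto simp: partial_hom_rel_def)
    show ?thesis
    proof (rule Set.set_eqI)
      fix x :: "('o, 'u) partial_hom \<times> ('o, 'u) partial_hom"
      obtain p q where x: "x = (p, q)" by (cases x)
      show "x \<in> partial_hom_rel C F M N \<longleftrightarrow>
          x \<in> {(p, q). p \<in> partial_homs C F M N \<and> q \<in> partial_homs C F M N \<and> \<tau> M N p = \<tau> M N q}"
        unfolding x mem_Collect_eq prod.case using 1[of p q] 2[of p q] by blast
    qed
  qed
  have surj: "\<tau> M N ` partial_homs C F M N = nat_hom C (loc M) (loc N)"
    if M: "M \<in> Obj (Mod_cat U C)" and N: "N \<in> Obj (Mod_cat U C)" for M N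
  proof (intro equalityI subsetI)
    fix \<theta> assume \<theta>: "\<theta> \<in> nat_hom C (loc M) (loc N)"
    obtain p where p: "p \<in> partial_homs C F M N" "represents (\<l> M) (\<l> N) p \<theta>"
      using represents_surj[OF mod(1)[OF M] mod(1)[OF N] loc(3)[OF M] loc(3)[OF N] \<theta>] by blast
    show "\<theta> \<in> \<tau> M N ` partial_homs C F M N"
      using \<tau>[OF M N p(1) \<theta> p(2)] p(1) by blast
  next
    fix \<theta> assume "\<theta> \<in> \<tau> M N ` partial_homs C F M N"
    then show "\<theta> \<in> nat_hom C (loc M) (loc N)" using \<tau>_rep(1)[OF M N] by auto
  qed
  have comp_ph: "partial_comp C b a \<in> partial_homs C F M P"
      "\<tau> M P (partial_comp C b a) = Comp (Mod_cat U C) (loc M) (loc N) (loc P) (\<tau> N P b) (\<tau> M N a)"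
    if M: "M \<in> Obj (Mod_cat U C)" and N: "N \<in> Obj (Mod_cat U C)" and P: "P \<in> Obj (Mod_cat U C)"
      and a: "a \<in> partial_homs C F M N" and b: "b \<in> partial_homs C F N P" for M N P a b
  proof -
    show *: "partial_comp C b a \<in> partial_homs C F M P"
      using partial_comp[OF mod(1)[OF M] mod(1)[OF N] mod(1)[OF P]] a b by (cases a, cases b) simp
    have "represents (\<l> M) (\<l> P) (partial_comp C b a)
      (Comp (Mod_cat U C) (loc M) (loc N) (loc P) (\<tau> N P b) (\<tau> M N a))"
      using represents_comp[OF mod(1)[OF M] mod(1)[OF N] loc(3)[OF M]] a b
        \<tau>_rep(2)[OF M N a] \<tau>_rep(2)[OF N P b] by (cases a, cases b) blast
    then show "\<tau> M P (partial_comp C b a) =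
        Comp (Mod_cat U C) (loc M) (loc N) (loc P) (\<tau> N P b) (\<tau> M N a)"
      using \<tau>_rep(1)[OF M N a] \<tau>_rep(1)[OF N P b] mod(2)[OF M]
      by (intro \<tau>[OF M P *]) auto
  qed
  \<comment> \<open>The union in the definition of composition runs over all representatives. Since
    \<open>\<tau>\<close> of a composite depends only on \<open>\<tau>\<close> of the factors, every
    pair contributes the same class.\<close>
  have comp_B: "Comp ?B M N P (partial_hom_rel C F N P `` {b}) (partial_hom_rel C F M N `` {a}) =
      partial_hom_rel C F M P `` {partial_comp C b a}"
    if M: "M \<in> Obj (Mod_cat U C)" and N: "N \<in> Obj (Mod_cat U C)" and P: "P \<in> Obj (Mod_cat U C)"
      and a: "a \<in> partial_homs C F M N" and b: "b \<in> partial_homs C F N P" for M N P a b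
  proof -
    have "partial_hom_rel C F M P `` {partial_comp C b' a'} = partial_hom_rel C F M P `` {partial_comp C b a}"
      if "b' \<in> partial_hom_rel C F N P `` {b}" "a' \<in> partial_hom_rel C F M N `` {a}" for a' b'
    proof -
      have "b' \<in> partial_homs C F N P" "\<tau> N P b' = \<tau> N P b" "a' \<in> partial_homs C F M N" "\<tau> M N a' = \<tau> M N a"
        using that by (auto simp: rel[OF M N] rel[OF N P])
      then show ?thesis
        using comp_ph[OF M N P] a b by (auto simp: rel[OF M P])
    qed
    moreover have "b \<in> partial_hom_rel C F N P `` {b}" "a \<in> partial_hom_rel C F M N `` {a}"
      using a b by (auto simp: rel[OF M N] rel[OF N P])
    ultimately show ?thesis
      unfolding B_simps by blast
  qed
  show ?thesis
  proof (rule equivalent_categories_reflection[where L = loc and \<Phi> = "\<lambda>M N c. the_elem (\<tau> M N ` c)"])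
    show "category ?A" by (rule catA)
    show "Obj ?A \<subseteq> Obj ?B" by (auto simp: A_simps B_simps)
    show "loc M \<in> Obj ?A" if "M \<in> Obj ?B" for M
      using that loc(1) by (simp add: B_simps)
    show "loc M = M" if "M \<in> Obj ?A" for M using loc(2)[OF that] .
    show "bij_betw (\<lambda>c. the_elem (\<tau> M N ` c)) (Hom ?B M N) (Hom ?A (loc M) (loc N))"
      if "M \<in> Obj ?B" "N \<in> Obj ?B" for M N
      using quotient_kernel(3)[OF rel] surj that by (simp add: A_simps B_simps)
    show "Ide ?B M \<in> Hom ?B M M" "the_elem (\<tau> M M ` Ide ?B M) = Ide ?A (loc M)" if "M \<in> Obj ?B" for M
    proof -
      have M: "M \<in> Obj (Mod_cat U C)" using that by (simp add: B_simps)
      note i = partial_ide[OF mod(1)[OF M] loc(3)[OF M]]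
      show "Ide ?B M \<in> Hom ?B M M"
        using i(1) quotient_kernel(1)[OF rel[OF M M]] by (auto simp: B_simps)
      have "\<tau> M M (partial_ide C M) = Ide (Mod_cat U C) (loc M)"
        using i mod(2)[OF M] by (intro \<tau>[OF M M]) auto
      then show "the_elem (\<tau> M M ` Ide ?B M) = Ide ?A (loc M)"
        using quotient_kernel(2)[OF rel[OF M M] i(1)] by (simp add: A_simps B_simps)
    qed
    show "Comp ?B M N P g f \<in> Hom ?B M P"
      "the_elem (\<tau> M P ` Comp ?B M N P g f) =
       Comp ?A (loc M) (loc N) (loc P) (the_elem (\<tau> N P ` g)) (the_elem (\<tau> M N ` f))"
      if "M \<in> Obj ?B" "N \<in> Obj ?B" "P \<in> Obj ?B" and f: "f \<in> Hom ?B M N" and g: "g \<in> Hom ?B N P"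
      for M N P f g
    proof -
      have M: "M \<in> Obj (Mod_cat U C)" and N: "N \<in> Obj (Mod_cat U C)" and P: "P \<in> Obj (Mod_cat U C)"
        using that by (simp_all add: B_simps)
      obtain a where a: "a \<in> partial_homs C F M N" "f = partial_hom_rel C F M N `` {a}"
        using f quotient_kernel(1)[OF rel[OF M N]] by (auto simp: B_simps)
      obtain b where b: "b \<in> partial_homs C F N P" "g = partial_hom_rel C F N P `` {b}"
        using g quotient_kernel(1)[OF rel[OF N P]] by (auto simp: B_simps)
      have *: "Comp ?B M N P g f = partial_hom_rel C F M P `` {partial_comp C b a}"
        using comp_B[OF M N P a(1) b(1)] a(2) b(2) by simp
      note c = comp_ph[OF M N P a(1) b(1)]
      show "Comp ?B M N P g f \<in> Hom ?B M P"
        unfolding * using c(1) quotient_kernel(1)[OF rel[OF M P]] by (auto simp: B_simps)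
      show "the_elem (\<tau> M P ` Comp ?B M N P g f) =
         Comp ?A (loc M) (loc N) (loc P) (the_elem (\<tau> N P ` g)) (the_elem (\<tau> M N ` f))"
        unfolding * unfolding a(2) b(2) quotient_kernel(2)[OF rel[OF M P] c(1)]
          quotient_kernel(2)[OF rel[OF M N] a(1)] quotient_kernel(2)[OF rel[OF N P] b(1)]
        using c(2) by (simp add: A_simps)
    qed
  qed
qed

end

theorem proposition4p24:
  fixes C :: "('o, 'm) preadd"
    and F :: "'o \<Rightarrow> ('o \<Rightarrow> 'm set) set"
    and J :: "'j set"
    and U :: "'u set set"
  assumes "preadditive_category C"
    and "skeletally_small J C"
    and "universe J U"
    and "left_Gabriel_filter C F"
  shows "equivalent_categories (closed_Mod_cat U C F) (Serre_quotient U C F)"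
proof -
  interpret gabriel_modules C F
    using assms by (intro gabriel_modules.intro)
  have "\<exists>L \<l>. L \<in> Obj (closed_Mod_cat U C F) \<and> (closed_module C F M \<longrightarrow> L = M) \<and> localization M L \<l>"
    if M: "M \<in> Obj (Mod_cat U C)" for M
  proof (cases "closed_module C F M")
    case True
    then show ?thesis
      using M localization_self[of M U] by (auto simp: closed_Mod_cat_def)
  next
    case False
    interpret gabriel_module C F M
      using M by unfold_locales simp
    have NU: "\<And>X. X \<in> Obj C \<Longrightarrow> carrier (Grp M X) \<in> U" using M by simp
    show ?thesis
    proof (rule localization_exists[OF assms(2,3) NU])
      fix L :: "('o, 'm, 'u) cmod" and \<l>
      assume L: "is_module C L" "\<And>X. X \<in> Obj C \<Longrightarrow> carrier (Grp L X) \<in> U" "separated L" "gluing L"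
        "\<l> \<in> nat_hom C M L"
        "\<And>X x y. \<lbrakk>X \<in> Obj C; x \<in> carrier (Grp M X); y \<in> carrier (Grp M X); \<l> X x = \<l> X y\<rbrakk> \<Longrightarrow> teq M X x y"
        "\<And>X a. \<lbrakk>X \<in> Obj C; a \<in> carrier (Grp L X)\<rbrakk>
          \<Longrightarrow> almost X (\<lambda>Y h. Act L X Y h a \<in> \<l> Y ` carrier (Grp M Y))"
      have "localization M L \<l>"
        unfolding localization_def using L(1,3-5) by (intro conjI ballI impI L(6,7))
      moreover have "L \<in> Obj (closed_Mod_cat U C F)"
        using L(1-4) closed_module_iff[OF L(1)] by (simp add: closed_Mod_cat_def)
      ultimately show ?thesis using False by blast
    qed
  qed
  then obtain loc \<l> where loc: "\<And>M. M \<in> Obj (Mod_cat U C) \<Longrightarrow>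
      loc M \<in> Obj (closed_Mod_cat U C F) \<and> (closed_module C F M \<longrightarrow> loc M = M) \<and> localization M (loc M) (\<l> M)"
    by metis
  have "M \<in> Obj (Mod_cat U C) \<and> closed_module C F M" if "M \<in> Obj (closed_Mod_cat U C F)" for M
    using that by (simp add: closed_Mod_cat_def)
  then show ?thesis
    using loc by (intro equivalence[of U loc \<l>]) blast+
qed

end
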